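(* The law of $W$ is self-decomposable, and it is absolutely continuous with a unimodal density $f$ satisfying $$-\log f(x)\sim r^*x\quad\text{as }x\to\infty,\qquad -\log f(x)\sim\tfrac12(\log x)^2\quad\text{as }x\to0^+.$$
   Context: Let $(\mathbf Z_n)_{n\ge 0}$ be the branching random walk on $\mathbb R_+^2$ started from a single particle at the origin, in which every particle of generation $n$ located at $y\in\mathbb R_+^2$ gives birth, independently of all other particles, to children located at $y+z$, where $z$ ranges over the atoms of an independent copy of a Poisson point process on $(0,\infty)^2$ whose intensity is Lebesgue measure $\mathrm dt\,\mathrm dx$; $\mathbf Z_n$ denotes the point measure of positions of generation $n$. Set $W_n=\int e^{-t-x}\,\mathbf Z_n(\mathrm dt,\mathrm dx)$; $(W_n)_{n\ge0}$ converges almost surely and in $L^1$ to a limit $W$ with $\mathbb E W=1$. Define $$r^*=\exp\Big(\int_0^\infty\Big(\big(2(e^u-u-1)\big)^{-1/2}-u^{-1}\mathbf 1_{\{u<1\}}\Big)\mathrm du\Big)\in(0,\infty).$$ The law of a random variable $U$ is self-decomposable if for every $s>0$ there is a random variable $U_s$ independent of $U$ with $U\overset{d}{=}e^{-s}U+U_s$. A density $h$ on $\mathbb R$ is unimodal if for some $x_0\in\mathbb R$ it is non-decreasing on $(-\infty,x_0)$ and non-increasing on $(x_0,\infty)$. $f\sim g$ means $f/g\to1$. *)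

theory Defs
  imports "HOL-Probability.Probability" "HOL-Library.Landau_Symbols"
begin

definition r_star :: real where
  "r_star = exp (LBINT u:{0<..}. (1 / sqrt (2 * (exp u - u - 1)) - (if u < 1 then 1 / u else 0)))"

definition self_decomposable :: "real measure \<Rightarrow> bool" where
  "self_decomposable mu \<longleftrightarrow>
     (\<forall>s>0. \<exists>nu. prob_space nu \<and> sets nu = sets borel \<and>
        mu = distr (mu \<Otimes>\<^sub>M nu) borel (\<lambda>(a, b). exp (- s) * a + b))"

definition unimodal :: "(real \<Rightarrow> real) \<Rightarrow> bool" where
  "unimodal h \<longleftrightarrow> (\<exists>x0. (\<forall>x y. x \<le> y \<and> y < x0 \<longrightarrow> h x \<le> h y) \<and>
                            (\<forall>x y. x0 < x \<and> x \<le> y \<longrightarrow> h y \<le> h x))"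

text \<open>Poisson point process on (0,oo)^2 with Lebesgue intensity, given by an enumeration
  X :: nat => Omega => real*real of its atoms (counted with multiplicity):
  all atoms lie in (0,oo)^2, and for disjoint Borel sets of finite Lebesgue measure the
  numbers of atoms are independent Poisson variables with means the Lebesgue measures.\<close>
definition is_PPP_leb :: "'a measure \<Rightarrow> (nat \<Rightarrow> 'a \<Rightarrow> real \<times> real) \<Rightarrow> bool" where
  "is_PPP_leb M X \<longleftrightarrow>
     (\<forall>k. X k \<in> borel_measurable M) \<and>
     (\<forall>k. \<forall>\<omega>\<in>space M. X k \<omega> \<in> {0<..} \<times> {0<..}) \<and>
     (\<forall>(A :: nat \<Rightarrow> (real \<times> real) set) (m::nat).
        (\<forall>i<m. A i \<in> sets borel \<and> A i \<subseteq> {0<..} \<times> {0<..} \<and> emeasure lborel (A i) < \<infinity>) \<and>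
        disjoint_family_on A {..<m} \<longrightarrow>
        (\<forall>i<m. \<forall>j::nat. prob_space.prob M {\<omega>\<in>space M. finite {k. X k \<omega> \<in> A i} \<and> card {k. X k \<omega> \<in> A i} = j}
              = exp (- measure lborel (A i)) * measure lborel (A i) ^ j / fact j) \<and>
        prob_space.indep_vars M (\<lambda>_. count_space UNIV) (\<lambda>i \<omega>. card {k. X k \<omega> \<in> A i}) {..<m})"

text \<open>Branching random walk in Ulam-Harris notation. Individuals are labelled by lists;
  the child number k of individual u is (k # u) (labels are stored in reversed order).
  xi u is the enumeration of the offspring displacement process of u.\<close>
definition brw_offspring :: "'a measure \<Rightarrow> (nat list \<Rightarrow> nat \<Rightarrow> 'a \<Rightarrow> real \<times> real) \<Rightarrow> bool" where
  "brw_offspring M xi \<longleftrightarrow>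
     (\<forall>u. is_PPP_leb M (xi u)) \<and>
     prob_space.indep_vars M (\<lambda>_. Pi\<^sub>M UNIV (\<lambda>_. borel)) (\<lambda>u \<omega>. \<lambda>k. xi u k \<omega>) UNIV"

fun brw_pos :: "(nat list \<Rightarrow> nat \<Rightarrow> 'a \<Rightarrow> real \<times> real) \<Rightarrow> 'a \<Rightarrow> nat list \<Rightarrow> real \<times> real" where
  "brw_pos xi \<omega> [] = (0, 0)"
| "brw_pos xi \<omega> (k # u) = brw_pos xi \<omega> u + xi u k \<omega>"

definition brw_W :: "(nat list \<Rightarrow> nat \<Rightarrow> 'a \<Rightarrow> real \<times> real) \<Rightarrow> nat \<Rightarrow> 'a \<Rightarrow> real" where
  "brw_W xi n \<omega> = enn2real (nn_integral (count_space {u. length u = n})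
       (\<lambda>u. ennreal (exp (- fst (brw_pos xi \<omega> u) - snd (brw_pos xi \<omega> u)))))"

end

theory Submission
  imports Defs "HOL-Real_Asymp.Real_Asymp"
begin

text \<open>
  Conditioning on the last generation and using the Laplace functional of the Poisson process, the
  Laplace exponent F of W solves F(s) = integral of 1 - exp(-F(s exp(-t-x))) over the quadrant. Hence
  W is infinitely divisible with Levy density k(z)/z, where k(z) is the integral of P(W > w)/w over
  w > z. As k is decreasing, W is self-decomposable, and x mu(dx) is the convolution of mu with k(x)dx.

  For positive arguments, g = log E exp(theta W) solves g'' = exp g - 1 in the variable log theta.
  Energy conservation shows that g is finite exactly up to theta = r_star, where E exp(theta W) has a
  double pole, and a Tauberian argument gives the upper tail. At the other end,
  F(exp v) ~ v^2/2 as v tends to infinity, which yields the lower tail through Chernoff bounds.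

  Since k(z) is at least 4 exp(-bz) for some b, the law of W has a Gamma factor of shape 4, so it has a
  density with two bounded derivatives. The size-bias equation differentiated twice, compared
  at two zeros of f', gives unimodality.
\<close>

section \<open>Laplace transforms on the half line\<close>

text \<open>Almost sure convergence links \<open>W\<close> to the generations, so mean and
  exponential moments have to be carried through the limit. The bounds s - s^2/6 <= -log E exp(-s
  W_n) <= s hold for every n and give E W = 1. The bound E exp(t W_n) <= exp(\<open>chi\<close> t),
  with \<open>chi\<close> the explosive solution of g'' = exp g - 1, is propagated from W_0 = 1 by a
  Gronwall argument on truncated moments and reaches \<open>W\<close> by Fatou. Hence the locale
  \<open>smoothed\<close> relates two laws: consecutive generations, or the limit with itself. Only
  then does the differential equation apply to \<open>W\<close> and turn the bound into an equality.
  The remainder in self-decomposability and the cofactor of the Gamma law are prescribed by their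
  Levy densities and realised as sums over the offspring process of the root. Shape 4 is chosen
  because x^3 exp(-bx), extended by 0, has a bounded second derivative on the whole line, as the
  twice differentiated equation demands. Both logarithmic asymptotics are proved for interval masses
  and transferred to the density by monotonicity on either side of the mode.\<close>

lemma has_real_derivative_integral:
  fixes g :: "real \<Rightarrow> 'a \<Rightarrow> real"
  assumes S: "open S" "x0 \<in> S"
    and int: "\<And>x. x \<in> S \<Longrightarrow> integrable M (g x)"
    and meas: "g' x0 \<in> borel_measurable M"
    and der: "AE y in M. \<forall>x\<in>S. ((\<lambda>x. g x y) has_real_derivative g' x y) (at x) \<and> \<bar>g' x y\<bar> \<le> w y"
    and w: "integrable M w"
  shows "((\<lambda>x. \<integral>y. g x y \<partial>M) has_real_derivative (\<integral>y. g' x0 y \<partial>M)) (at x0)"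
proof -
  obtain e where e: "e > 0" "ball x0 e \<subseteq> S" using S open_contains_ball by blast
  have "((\<lambda>x. ((\<integral>y. g x y \<partial>M) - (\<integral>y. g x0 y \<partial>M)) / (x - x0)) \<longlongrightarrow> (\<integral>y. g' x0 y \<partial>M)) (at x0)"
    unfolding tendsto_at_iff_sequentially comp_def
  proof (intro allI impI)
    fix X :: "nat \<Rightarrow> real"
    assume X: "\<forall>i. X i \<in> UNIV - {x0}" and lim: "X \<longlonglongrightarrow> x0"
    obtain N where N: "\<And>n. n \<ge> N \<Longrightarrow> dist (X n) x0 < e"
      using metric_LIMSEQ_D[OF lim e(1)] by blast
    define Y where "Y n = X (n + N)" for n
    have Yb: "Y n \<in> ball x0 e" for n using N[of "n+N"] by (simp add: Y_def dist_commute)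
    have YS: "Y n \<in> S" for n using Yb e by blast
    have Yne: "Y n \<noteq> x0" for n using X by (simp add: Y_def)
    have Ylim: "Y \<longlonglongrightarrow> x0" unfolding Y_def using lim LIMSEQ_ignore_initial_segment by blast
    have "(\<lambda>n. \<integral>y. (g (Y n) y - g x0 y) / (Y n - x0) \<partial>M) \<longlonglongrightarrow> (\<integral>y. g' x0 y \<partial>M)"
    proof (rule integral_dominated_convergence)
      show "g' x0 \<in> borel_measurable M" by fact
      show "(\<lambda>y. (g (Y n) y - g x0 y) / (Y n - x0)) \<in> borel_measurable M" for n
        using int[OF YS[of n]] int[OF S(2)] by (auto intro!: borel_measurable_divide borel_measurable_diff)
      show "integrable M w" by fact
      show "AE y in M. (\<lambda>n. (g (Y n) y - g x0 y) / (Y n - x0)) \<longlonglongrightarrow> g' x0 y"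
        using der
      proof eventually_elim
        case (elim y)
        have "((\<lambda>x. (g x y - g x0 y) / (x - x0)) \<longlongrightarrow> g' x0 y) (at x0)"
          using elim S(2) by (simp add: has_field_derivative_iff)
        then show ?case
          unfolding tendsto_at_iff_sequentially comp_def using Yne Ylim by auto
      qed
      show "AE y in M. norm ((g (Y n) y - g x0 y) / (Y n - x0)) \<le> w y" for n
        using der
      proof eventually_elim
        case (elim y)
        have seg: "closed_segment x0 (Y n) \<subseteq> ball x0 e"
          using Yb[of n] e(1) by (intro closed_segment_subset convex_ball) auto
        have "norm (g (Y n) y - g x0 y) \<le> w y * norm (Y n - x0)"
        proof (rule field_differentiable_bound[of "ball x0 e" "\<lambda>x. g x y" "\<lambda>x. g' x y"])
          show "((\<lambda>x. g x y) has_field_derivative g' z y) (at z within ball x0 e)" if "z \<in> ball x0 e" for z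
            using elim that e by (meson has_field_derivative_at_within subsetD)
          show "norm (g' z y) \<le> w y" if "z \<in> ball x0 e" for z
            using elim that e by auto
        qed (use Yb e in auto)
        then show ?case using Yne[of n] by (simp add: divide_le_eq)
      qed
    qed
    moreover have "(\<integral>y. (g (Y n) y - g x0 y) / (Y n - x0) \<partial>M)
        = ((\<integral>y. g (Y n) y \<partial>M) - (\<integral>y. g x0 y \<partial>M)) / (Y n - x0)" for n
      using int[OF YS[of n]] int[OF S(2)] by simp
    ultimately have "(\<lambda>n. ((\<integral>y. g (Y n) y \<partial>M) - (\<integral>y. g x0 y \<partial>M)) / (Y n - x0)) \<longlonglongrightarrow> (\<integral>y. g' x0 y \<partial>M)"
      using Yne by simp
    then show "(\<lambda>n. ((\<integral>y. g (X n) y \<partial>M) - (\<integral>y. g x0 y \<partial>M)) / (X n - x0)) \<longlonglongrightarrow> (\<integral>y. g' x0 y \<partial>M)"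
      unfolding Y_def by (rule LIMSEQ_offset)
  qed
  then show ?thesis by (simp add: has_field_derivative_iff)
qed

definition laplace :: "real measure \<Rightarrow> real \<Rightarrow> real" where
  "laplace N s = (\<integral>x. exp (- (s * x)) \<partial>N)"

locale nonneg_distribution = real_distribution N for N :: "real measure" +
  assumes AE_nonneg: "AE x in N. 0 \<le> x"
begin

lemma prob_UNIV [simp]: "measure N UNIV = 1"
  using prob_space by simp

lemma integrable_exp_neg: "s \<ge> 0 \<Longrightarrow> integrable N (\<lambda>x. exp (- (s * x)))"
proof (rule integrable_const_bound[of _ 1])
  assume "s \<ge> 0"
  show "AE x in N. norm (exp (- (s * x))) \<le> 1"
    using AE_nonneg by eventually_elim (use \<open>s \<ge> 0\<close> in auto)
qed auto

lemma laplace_le_1: "s \<ge> 0 \<Longrightarrow> laplace N s \<le> 1"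
proof -
  assume s: "s \<ge> 0"
  have "laplace N s \<le> (\<integral>x. 1 \<partial>N)" unfolding laplace_def
    by (intro integral_mono_AE integrable_exp_neg s)
       (use AE_nonneg in \<open>auto elim!: eventually_mono intro: mult_nonneg_nonneg s\<close>)
  then show ?thesis by (simp add: prob_space)
qed

lemma laplace_pos: "s \<ge> 0 \<Longrightarrow> laplace N s > 0"
proof -
  assume s: "s \<ge> 0"
  have "laplace N s \<ge> 0" unfolding laplace_def by simp
  moreover have "laplace N s \<noteq> 0"
  proof
    assume "laplace N s = 0"
    then have "AE x in N. exp (- (s * x)) = 0"
      unfolding laplace_def using integral_nonneg_eq_0_iff_AE[OF integrable_exp_neg[OF s]] by simp
    then show False using AE_False by simp
  qed
  ultimately show ?thesis by simp
qed

lemma laplace_0: "laplace N 0 = 1" by (simp add: laplace_def prob_space)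

text \<open>The variable y = exp (- x) maps the half line into [0,1], so Laplace values at natural
  numbers become moments. The default 0 for negative x keeps the integrand bounded and Borel on the
  whole line, where exp (- x) would leave [0,1].\<close>

lemma integrable_fun_exp:
  fixes g :: "real \<Rightarrow> real"
  assumes "continuous_on {0..1} g"
  shows "integrable N (\<lambda>x. if x \<ge> 0 then g (exp (- x)) else 0)"
proof -
  have "compact (g ` {0..1})" using assms by (intro compact_continuous_image) auto
  then obtain B where B: "\<And>y. y \<in> {0..1} \<Longrightarrow> norm (g y) \<le> B"
    using compact_imp_bounded bounded_iff by (metis (no_types, lifting) image_eqI)
  have m: "(\<lambda>x. if x \<ge> 0 then g (exp (- x)) else 0) \<in> borel_measurable borel"
  proof -
    have "continuous_on {0..} (\<lambda>x. g (exp (- x)))"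
      by (intro continuous_on_compose2[OF assms] continuous_intros) auto
    then have "(\<lambda>x. if x \<in> {0..} then g (exp (- x)) else 0) \<in> borel_measurable borel"
      by (intro borel_measurable_continuous_on_if) auto
    then show ?thesis by simp
  qed
  have "norm (if x \<ge> 0 then g (exp (- x)) else 0) \<le> max B 0" for x
    using B[of "exp (- x)"] by auto
  with m show ?thesis
    by (intro integrable_const_bound[of _ "max B 0"]) auto
qed

end

text \<open>In the variable y = exp (- x) the assumption is convergence of all moments on [0,1], and
  Stone-Weierstrass replaces g uniformly by a polynomial. The filter is arbitrary because a constant
  sequence gives uniqueness and \<open>at_right 0\<close> gives the Tauberian argument.\<close>

lemma laplace_tendsto_imp_integral:
  fixes N :: "'i \<Rightarrow> real measure"
  assumes nd: "\<forall>\<^sub>F i in F. nonneg_distribution (N i)" and nd': "nonneg_distribution N'"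
    and lim: "\<And>j::nat. ((\<lambda>i. laplace (N i) (real j)) \<longlongrightarrow> laplace N' (real j)) F"
    and g: "continuous_on {0..1} (g :: real \<Rightarrow> real)"
  shows "((\<lambda>i. \<integral>x. (if x \<ge> 0 then g (exp (- x)) else 0) \<partial>N i) \<longlongrightarrow> (\<integral>x. (if x \<ge> 0 then g (exp (- x)) else 0) \<partial>N')) F"
proof (rule tendstoI)
  fix e :: real assume e: "e > 0"
  obtain p where p: "real_polynomial_function p" "\<And>y. y \<in> {0..1} \<Longrightarrow> \<bar>g y - p y\<bar> < e / 3"
    using Stone_Weierstrass_real_polynomial_function[of "{0..1::real}" g "e/3"] g e by auto
  obtain a n where pa: "p = (\<lambda>x. \<Sum>i\<le>(n::nat). a i * x ^ i)"
    using p(1) real_polynomial_function_iff_sum by auto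
  define I where "I Q h = (\<integral>x. (if x \<ge> 0 then h (exp (- x)) else 0) \<partial>Q)" for Q :: "real measure" and h :: "real \<Rightarrow> real"
  have cp: "continuous_on {0..1} p" unfolding pa by (intro continuous_intros)
  have near: "\<bar>I Q g - I Q p\<bar> \<le> e / 3" if "nonneg_distribution Q" for Q
  proof -
    interpret nonneg_distribution Q by fact
    have "I Q g - I Q p = (\<integral>x. (if x \<ge> 0 then g (exp (- x)) - p (exp (- x)) else 0) \<partial>Q)"
      unfolding I_def by (subst Bochner_Integration.integral_diff[symmetric])
        (auto intro!: integrable_fun_exp g cp Bochner_Integration.integral_cong)
    also have "\<bar>\<dots>\<bar> \<le> (\<integral>x. e / 3 \<partial>Q)"
      by (rule integral_abs_bound[THEN order_trans], rule integral_mono)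
         (use integrable_fun_exp[of "\<lambda>y. g y - p y"] g cp p(2) e in
           \<open>auto intro!: integrable_abs continuous_intros less_imp_le\<close>)
    finally show ?thesis by (simp add: prob_space)
  qed
  have Ip: "I Q p = (\<Sum>i\<le>n. a i * laplace Q (real i))" if "nonneg_distribution Q" for Q
  proof -
    interpret nonneg_distribution Q by fact
    have "I Q p = (\<integral>x. (\<Sum>i\<le>n. a i * exp (- (real i * x))) \<partial>Q)"
      unfolding I_def pa
      by (rule integral_cong_AE)
         (use AE_nonneg in \<open>auto elim!: eventually_mono simp: exp_of_nat_mult[symmetric] intro!: measurable_If\<close>)
    also have "\<dots> = (\<Sum>i\<le>n. a i * laplace Q (real i))"
      unfolding laplace_def
      by (subst Bochner_Integration.integral_sum)
         (auto intro: integrable_exp_neg)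
    finally show ?thesis .
  qed
  have "((\<lambda>i. \<Sum>j\<le>n. a j * laplace (N i) (real j)) \<longlongrightarrow> (\<Sum>j\<le>n. a j * laplace N' (real j))) F"
    by (intro tendsto_sum tendsto_mult lim tendsto_const)
  then have "\<forall>\<^sub>F i in F. dist (\<Sum>j\<le>n. a j * laplace (N i) (real j)) (\<Sum>j\<le>n. a j * laplace N' (real j)) < e / 3"
    using e by (intro tendstoD) auto
  with nd show "\<forall>\<^sub>F i in F. dist (\<integral>x. (if x \<ge> 0 then g (exp (- x)) else 0) \<partial>N i) (\<integral>x. (if x \<ge> 0 then g (exp (- x)) else 0) \<partial>N') < e"
  proof eventually_elim
    case (elim i)
    have "dist (I (N i) p) (I N' p) < e / 3" using elim Ip nd' by simp
    with near[OF elim(1)] near[OF nd'] show ?case unfolding I_def[symmetric] dist_real_def by linarith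
  qed
qed

text \<open>Applied to a constant sequence, the preceding convergence shows that both laws integrate
  continuous functions of exp (- x) equally; clipped linear ramps then recover the distribution
  functions.\<close>

theorem laplace_unique:
  assumes "nonneg_distribution N1" "nonneg_distribution N2"
    and eq: "\<And>j::nat. laplace N1 (real j) = laplace N2 (real j)"
  shows "N1 = N2"
proof -
  interpret N1: nonneg_distribution N1 by fact
  interpret N2: nonneg_distribution N2 by fact
  have I: "(\<integral>x. (if x \<ge> 0 then g (exp (- x)) else 0) \<partial>N1) = (\<integral>x. (if x \<ge> 0 then g (exp (- x)) else 0) \<partial>N2)"
    if g: "continuous_on {0..1} g" for g :: "real \<Rightarrow> real"
  proof -
    have "((\<lambda>i::nat. \<integral>x. (if x \<ge> 0 then g (exp (- x)) else 0) \<partial>N1) \<longlongrightarrow> (\<integral>x. (if x \<ge> 0 then g (exp (- x)) else 0) \<partial>N2)) sequentially"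
      by (rule laplace_tendsto_imp_integral) (use assms g in auto)
    then show ?thesis using LIMSEQ_const_iff by blast
  qed
  \<comment> \<open>The ramp has slope n in the variable exp (- x): it equals 1 for x <= t, and for
    x > t the expression before clipping tends to minus infinity.\<close>
  have lim: "(\<lambda>n. \<integral>x. (if x \<ge> 0 then max 0 (min 1 (1 + real n * (exp (- x) - exp (- t)))) else 0) \<partial>Q) \<longlonglongrightarrow> cdf Q t"
    if "nonneg_distribution Q" for Q t
  proof -
    interpret nonneg_distribution Q by fact
    have "(\<lambda>n. \<integral>x. (if x \<ge> 0 then max 0 (min 1 (1 + real n * (exp (- x) - exp (- t)))) else 0) \<partial>Q)
       \<longlonglongrightarrow> (\<integral>x. indicator {..t} x \<partial>Q)"
    proof (rule integral_dominated_convergence[where w="\<lambda>_. 1"])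
      show "AE x in Q. (\<lambda>n. if x \<ge> 0 then max 0 (min 1 (1 + real n * (exp (- x) - exp (- t)))) else 0) \<longlonglongrightarrow> indicator {..t} x"
        using AE_nonneg
      proof eventually_elim
        case (elim x)
        show ?case
        proof (cases "x \<le> t")
          case True
          then have "max 0 (min 1 (1 + real n * (exp (- x) - exp (- t)))) = 1" for n by (simp add: min_def)
          then show ?thesis using True elim by simp
        next
          case False
          then have d: "exp (- x) - exp (- t) < 0" by simp
          then have "filterlim (\<lambda>n. 1 + real n * (exp (- x) - exp (- t))) at_bot sequentially"
            by real_asymp
          then have "\<forall>\<^sub>F n in sequentially. 1 + real n * (exp (- x) - exp (- t)) \<le> 0"
            by (simp add: filterlim_at_bot)
          then have "\<forall>\<^sub>F n in sequentially. max 0 (min 1 (1 + real n * (exp (- x) - exp (- t)))) = 0"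
            by eventually_elim auto
          then have "(\<lambda>n. max 0 (min 1 (1 + real n * (exp (- x) - exp (- t))))) \<longlonglongrightarrow> 0"
            by (rule tendsto_eventually)
          then show ?thesis using False elim by simp
        qed
      qed
    qed (auto intro!: AE_I2 simp: abs_le_iff)
    then show ?thesis by (simp add: cdf_def)
  qed
  have "cdf N1 = cdf N2"
  proof
    fix t
    have c: "continuous_on {0..1} (\<lambda>y. max 0 (min 1 (1 + real n * (y - exp (- t)))))" for n
      by (intro continuous_intros)
    show "cdf N1 t = cdf N2 t"
      using lim[OF assms(1), of t] lim[OF assms(2), of t] I[OF c] by (auto intro: LIMSEQ_unique)
  qed
  then show ?thesis
    by (intro cdf_unique N1.real_distribution_axioms N2.real_distribution_axioms)
qed

text \<open>The set of disagreement is open and Lebesgue null, hence empty.\<close>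

lemma AE_eq_continuous_imp_eq:
  fixes f g :: "real \<Rightarrow> real"
  assumes "continuous_on S f" "continuous_on S g" "open S"
    and ae: "AE x in lborel. x \<in> S \<longrightarrow> f x = g x" and x: "x \<in> S"
  shows "f x = g x"
proof (rule ccontr)
  assume ne: "f x \<noteq> g x"
  define U where "U = {y \<in> S. f y - g y \<noteq> 0}"
  have "continuous_on S (\<lambda>y. f y - g y)" using assms by (intro continuous_intros)
  then have "open (S \<inter> (\<lambda>y. f y - g y) -` (- {0}))"
    using continuous_open_preimage[of S "\<lambda>y. f y - g y" "- {0}"] assms(3) by auto
  moreover have "S \<inter> (\<lambda>y. f y - g y) -` (- {0}) = U" by (auto simp: U_def)
  ultimately have "open U" by simp
  have "AE y in lborel. y \<notin> U" using ae by eventually_elim (auto simp: U_def)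
  then have "emeasure lborel U = 0"
    using \<open>open U\<close> by (subst (asm) AE_iff_measurable[of U]) auto
  then have "negligible U"
    using \<open>open U\<close> by (simp add: negligible_iff_null_sets null_setsI null_sets_completionI)
  moreover have "U \<noteq> {}" using ne x by (auto simp: U_def)
  ultimately show False using open_not_negligible[OF \<open>open U\<close>] by simp
qed

section \<open>Poisson point processes\<close>

text \<open>The function exp (- x) on [0, infinity] with value 0 at infinity. Being real-valued and
  bounded by 1, it makes every Laplace functional a Bochner integral, whether or not the random sums
  are finite.\<close>

definition expm :: "ennreal \<Rightarrow> real" where
  "expm x = (if x = \<top> then 0 else exp (- enn2real x))"

lemma expm_ennreal [simp]: "0 \<le> r \<Longrightarrow> expm (ennreal r) = exp (- r)"
  by (simp add: expm_def)

lemma expm_top [simp]: "expm \<top> = 0" and expm_0 [simp]: "expm 0 = 1"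
  by (auto simp: expm_def)

lemma expm_nonneg [simp]: "0 \<le> expm x" and expm_le_1 [simp]: "expm x \<le> 1"
  by (auto simp: expm_def)

lemma expm_add: "expm (x + y) = expm x * expm y"
  by (cases x; cases y) (auto simp: expm_def enn2real_plus exp_diff exp_minus field_simps simp flip: ennreal_plus)

lemma expm_sum: "expm (\<Sum>i\<in>I. f i) = (\<Prod>i\<in>I. expm (f i))"
  by (induction I rule: infinite_finite_induct) (auto simp: expm_add)

lemma expm_antimono: "x \<le> y \<Longrightarrow> expm y \<le> expm x"
  by (cases x; cases y) (auto simp: expm_def top_unique)

lemma measurable_expm [measurable]: "expm \<in> borel_measurable borel"
  unfolding expm_def by measurable

lemma tendsto_expm:
  assumes "(f \<longlongrightarrow> x) F"
  shows "((\<lambda>i. expm (f i)) \<longlongrightarrow> expm x) F"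
proof (cases x)
  case (real r)
  have "\<forall>\<^sub>F i in F. f i < \<top>" using assms real by (intro order_tendstoD(2)[OF assms]) auto
  then have ev: "\<forall>\<^sub>F i in F. exp (- enn2real (f i)) = expm (f i)"
    by eventually_elim (auto simp: expm_def)
  have "((\<lambda>i. exp (- enn2real (f i))) \<longlongrightarrow> exp (- r)) F"
    by (intro tendsto_intros) (use assms real in auto)
  then show ?thesis using real tendsto_cong[OF ev] by simp
next
  case top
  show ?thesis unfolding top expm_top
  proof (rule tendstoI)
    fix e :: real assume e: "e > 0"
    define r where "r = max 0 (- ln e) + 1"
    have "\<forall>\<^sub>F i in F. f i > ennreal r" using assms top by (intro order_tendstoD(1)[OF assms]) auto
    then show "\<forall>\<^sub>F i in F. dist (expm (f i)) 0 < e"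
    proof eventually_elim
      case (elim i)
      have "expm (f i) \<le> expm (ennreal r)" using elim by (intro expm_antimono) auto
      also have "\<dots> = exp (- r)" by (rule expm_ennreal) (simp add: r_def)
      also have "\<dots> < exp (ln e)" unfolding r_def by (subst exp_less_cancel_iff) auto
      finally show ?case using e by simp
    qed
  qed
qed

lemma (in prob_space) nonneg_distribution_distr:
  assumes X: "X \<in> borel_measurable M" and "AE \<omega> in M. 0 \<le> X \<omega>"
  shows "nonneg_distribution (distr M borel X)"
proof (intro nonneg_distribution.intro nonneg_distribution_axioms.intro)
  show "real_distribution (distr M borel X)" by (rule real_distribution_distr) fact
  show "AE x in distr M borel X. 0 \<le> x" using assms by (subst AE_distr_iff) auto
qed

lemma (in prob_space) integrable_expm [simp]:
  "S \<in> borel_measurable M \<Longrightarrow> integrable M (\<lambda>\<omega>. expm (S \<omega>))"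
  by (rule integrable_const_bound[of _ 1]) auto

text \<open>By dominated convergence the integrals tend to the probability that S is finite.\<close>

lemma (in prob_space) AE_finite_of_expm:
  assumes [measurable]: "S \<in> borel_measurable M"
    and lim: "(\<lambda>n. \<integral>\<omega>. expm (ennreal (1 / real (Suc n)) * S \<omega>) \<partial>M) \<longlonglongrightarrow> 1"
  shows "AE \<omega> in M. S \<omega> < \<top>"
proof -
  have "(\<lambda>n. \<integral>\<omega>. expm (ennreal (1 / real (Suc n)) * S \<omega>) \<partial>M) \<longlonglongrightarrow> (\<integral>\<omega>. indicator {\<omega>\<in>space M. S \<omega> < \<top>} \<omega> \<partial>M)"
  proof (rule integral_dominated_convergence[where w="\<lambda>_. 1"])
    show "AE \<omega> in M. (\<lambda>n. expm (ennreal (1 / real (Suc n)) * S \<omega>)) \<longlonglongrightarrow> indicator {\<omega>\<in>space M. S \<omega> < \<top>} \<omega>"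
    proof (rule AE_I2)
      fix \<omega> assume w: "\<omega> \<in> space M"
      show "(\<lambda>n. expm (ennreal (1 / real (Suc n)) * S \<omega>)) \<longlonglongrightarrow> indicator {\<omega>\<in>space M. S \<omega> < \<top>} \<omega>"
      proof (cases "S \<omega>")
        case (real r)
        have "expm (ennreal (1 / real (Suc n)) * S \<omega>) = exp (- (r / real (Suc n)))" for n
          using real by (simp add: ennreal_mult[symmetric])
        moreover have "(\<lambda>n. exp (- (r / real (Suc n)))) \<longlonglongrightarrow> 1" by real_asymp
        ultimately show ?thesis using real w by simp
      next
        case top
        then show ?thesis by (simp add: ennreal_mult_top)
      qed
    qed
  qed auto
  then have "(\<integral>\<omega>. indicator {\<omega>\<in>space M. S \<omega> < \<top>} \<omega> \<partial>M) = (1::real)"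
    using lim LIMSEQ_unique by blast
  then have "prob {\<omega>\<in>space M. S \<omega> < \<top>} = 1" by simp
  then show ?thesis by (subst (asm) prob_Collect_eq_1) auto
qed

lemma (in prob_space) integral_poisson:
  fixes N :: "'a \<Rightarrow> nat" and c m :: real
  assumes [measurable]: "N \<in> measurable M (count_space UNIV)" and c: "c \<ge> 0" and m: "m \<ge> 0"
    and N: "\<And>j. prob {\<omega>\<in>space M. N \<omega> = j} = exp (- m) * m ^ j / fact j"
  shows "(\<integral>\<omega>. exp (- (c * real (N \<omega>))) \<partial>M) = exp (- (m * (1 - exp (- c))))"
proof -
  have int: "integrable M (\<lambda>\<omega>. exp (- (c * real (N \<omega>))))"
    by (rule integrable_const_bound[of _ 1]) (use c in auto)
  have "ennreal (\<integral>\<omega>. exp (- (c * real (N \<omega>))) \<partial>M) = (\<integral>\<^sup>+\<omega>. ennreal (exp (- (c * real (N \<omega>)))) \<partial>M)"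
    using int by (intro nn_integral_eq_integral[symmetric]) auto
  also have "\<dots> = (\<integral>\<^sup>+\<omega>. (\<Sum>j. ennreal (exp (- (c * real j))) * indicator {\<omega>\<in>space M. N \<omega> = j} \<omega>) \<partial>M)"
  proof (rule nn_integral_cong)
    fix \<omega> assume w: "\<omega> \<in> space M"
    have "(\<Sum>j. ennreal (exp (- (c * real j))) * indicator {\<omega>\<in>space M. N \<omega> = j} \<omega>)
      = (\<Sum>j\<in>{N \<omega>}. ennreal (exp (- (c * real j))) * indicator {\<omega>\<in>space M. N \<omega> = j} \<omega>)"
      by (rule suminf_finite) auto
    then show "ennreal (exp (- (c * real (N \<omega>)))) = (\<Sum>j. ennreal (exp (- (c * real j))) * indicator {\<omega>\<in>space M. N \<omega> = j} \<omega>)"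
      using w by simp
  qed
  also have "\<dots> = (\<Sum>j. ennreal (exp (- (c * real j))) * ennreal (exp (- m) * m ^ j / fact j))"
    by (subst nn_integral_suminf) (auto simp: nn_integral_cmult_indicator emeasure_eq_measure N)
  also have "\<dots> = (\<Sum>j. ennreal (exp (- m) * (inverse (fact j) * (m * exp (- c)) ^ j)))"
    using m by (intro suminf_cong) (simp add: ennreal_mult[symmetric] field_simps exp_of_nat_mult[symmetric] power_mult_distrib)
  also have "\<dots> = ennreal (exp (- m) * exp (m * exp (- c)))"
    using sums_mult[OF exp_converges[of "m * exp (- c)"], of "exp (- m)"] m
    by (intro suminf_ennreal_eq) (auto simp: scaleR_conv_of_real)
  also have "exp (- m) * exp (m * exp (- c)) = exp (- (m * (1 - exp (- c))))"
    by (simp add: exp_add[symmetric] algebra_simps)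
  finally show ?thesis by (simp add: integral_nonneg)
qed

section \<open>Laplace functional of a planar Poisson process\<close>

abbreviation quadrant :: "(real \<times> real) set" where
  "quadrant \<equiv> {0<..} \<times> {0<..}"

lemma sets_quadrant: "quadrant \<in> sets borel"
  by (intro borel_open open_Times) auto

lemma suminf_indicator_card:
  "finite {k. P k} \<Longrightarrow> (\<Sum>k. if P k then c else 0) = of_nat (card {k. P k}) * (c :: ennreal)" for P :: "nat \<Rightarrow> bool"
  by (subst suminf_finite[of "{k. P k}"]) (auto)

text \<open>A step function with disjoint level sets sums to a linear combination of independent
  Poisson counts, so the expectation factorises.\<close>

lemma ppp_laplace_simple:
  assumes "prob_space M" and X: "is_PPP_leb M X"
    and A: "\<And>i. i < m \<Longrightarrow> A i \<in> sets borel" "\<And>i. i < m \<Longrightarrow> A i \<subseteq> quadrant"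
      "\<And>i. i < m \<Longrightarrow> emeasure lborel (A i) < \<infinity>" "disjoint_family_on A {..<m}"
    and c: "\<And>i. i < m \<Longrightarrow> c i \<ge> 0"
  shows "(\<integral>\<omega>. expm (\<Sum>k. \<Sum>i<(m::nat). ennreal (c i) * indicator (A i) (X k \<omega>)) \<partial>M)
    = exp (- (\<Sum>i<m. measure lborel (A i) * (1 - exp (- c i))))"
proof -
  interpret prob_space M by fact
  define N where "N i \<omega> = card {k. X k \<omega> \<in> A i}" for i \<omega>
  have Xm [measurable]: "X k \<in> borel_measurable M" for k using X by (simp add: is_PPP_leb_def)
  have hyp: "(\<forall>i<m. A i \<in> sets borel \<and> A i \<subseteq> {0<..} \<times> {0<..} \<and> emeasure lborel (A i) < \<infinity>) \<and>
        disjoint_family_on A {..<m}" using A by auto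
  have P: "prob {\<omega>\<in>space M. finite {k. X k \<omega> \<in> A i} \<and> N i \<omega> = j}
              = exp (- measure lborel (A i)) * measure lborel (A i) ^ j / fact j" if "i < m" for i j
    using X hyp that unfolding is_PPP_leb_def N_def by blast
  have ind: "indep_vars (\<lambda>_. count_space UNIV) N {..<m}"
    using X hyp unfolding is_PPP_leb_def N_def by blast
  have Nm [measurable]: "N i \<in> measurable M (count_space UNIV)" if "i < m" for i
    using ind that by (auto simp: indep_vars_def)
  \<comment> \<open>\<open>card\<close> of an infinite set is 0, so finiteness of the counts must be
    obtained first: the Poisson weights of the finite counts already add up to 1.\<close>
  have fin: "AE \<omega> in M. finite {k. X k \<omega> \<in> A i}" if i: "i < m" for i
  proof -
    define F where "F j = {\<omega>\<in>space M. finite {k. X k \<omega> \<in> A i} \<and> N i \<omega> = j}" for j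
    have [measurable]: "A i \<in> sets borel" using A i by auto
    \<comment> \<open>An extended sum of indicators is finite exactly when the index set is; this
      makes the event measurable.\<close>
    have eq: "{\<omega>\<in>space M. finite {k. X k \<omega> \<in> A i}} = {\<omega>\<in>space M. (\<Sum>k. indicator (A i) (X k \<omega>)) < (\<top>::ennreal)}" 
    proof -
      have "finite {k. X k \<omega> \<in> A i} \<longleftrightarrow> (\<Sum>k. indicator (A i) (X k \<omega>)) < (\<top>::ennreal)" for \<omega>
      proof -
        have "(\<Sum>k. indicator (A i) (X k \<omega>)) = (\<integral>\<^sup>+k. indicator {k. X k \<omega> \<in> A i} k \<partial>count_space UNIV)"
          by (subst nn_integral_count_space_nat) (auto intro!: suminf_cong simp: indicator_def)
        also have "\<dots> = emeasure (count_space UNIV) {k. X k \<omega> \<in> A i}" by simp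
        finally show ?thesis by (auto simp: emeasure_count_space of_nat_less_top)
      qed
      then show ?thesis by auto
    qed
    have Fin [measurable]: "{\<omega>\<in>space M. finite {k. X k \<omega> \<in> A i}} \<in> sets M"
      unfolding eq by measurable
    have Fm: "F j \<in> sets M" for j
    proof -
      have "F j = {\<omega>\<in>space M. finite {k. X k \<omega> \<in> A i}} \<inter> (N i -` {j} \<inter> space M)" by (auto simp: F_def)
      then show ?thesis using Fin Nm[OF i] by (auto intro!: sets.Int measurable_sets)
    qed
    have "(\<lambda>j. prob (F j)) sums prob (\<Union>j. F j)"
      by (rule finite_measure_UNION) (use Fm in \<open>auto simp: disjoint_family_on_def F_def\<close>)
    moreover have "(\<Union>j. F j) = {\<omega>\<in>space M. finite {k. X k \<omega> \<in> A i}}" by (auto simp: F_def)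
    moreover have "(\<lambda>j. prob (F j)) sums (exp (- measure lborel (A i)) * exp (measure lborel (A i)))"
      unfolding F_def P[OF i]
      using sums_mult[OF exp_converges[of "measure lborel (A i)"], of "exp (- measure lborel (A i))"]
      by (simp add: field_simps)
    ultimately have "prob {\<omega>\<in>space M. finite {k. X k \<omega> \<in> A i}} = 1"
      by (metis exp_minus_inverse mult.commute sums_unique2)
    then show ?thesis by (subst (asm) prob_Collect_eq_1) (use Fin in auto)
  qed
  have allfin: "AE \<omega> in M. \<forall>i\<in>{..<m}. finite {k. X k \<omega> \<in> A i}"
    using fin by (subst AE_finite_all) auto
  have P': "prob {\<omega>\<in>space M. N i \<omega> = j} = exp (- measure lborel (A i)) * measure lborel (A i) ^ j / fact j" if i: "i < m" for i j
  proof -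
    have "{\<omega>\<in>space M. N i \<omega> = j} \<in> events" using Nm[OF i] by measurable
    moreover have "{\<omega>\<in>space M. finite {k. X k \<omega> \<in> A i} \<and> N i \<omega> = j} \<in> events" 
    proof -
      have [measurable]: "A i \<in> sets borel" using A i by auto
      have "{\<omega>\<in>space M. finite {k. X k \<omega> \<in> A i} \<and> N i \<omega> = j} = 
         {\<omega>\<in>space M. (\<Sum>k. indicator (A i) (X k \<omega>)) = (of_nat j::ennreal)}"
      proof -
        have "(finite {k. X k \<omega> \<in> A i} \<and> N i \<omega> = j) \<longleftrightarrow> (\<Sum>k. indicator (A i) (X k \<omega>)) = (of_nat j::ennreal)" for \<omega>
        proof -
          have "(\<Sum>k. indicator (A i) (X k \<omega>)) = (\<integral>\<^sup>+k. indicator {k. X k \<omega> \<in> A i} k \<partial>count_space UNIV)"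
            by (subst nn_integral_count_space_nat) (auto intro!: suminf_cong simp: indicator_def)
          also have "\<dots> = emeasure (count_space UNIV) {k. X k \<omega> \<in> A i}" by simp
          finally show ?thesis by (auto simp: emeasure_count_space N_def split: if_splits)
        qed
        then show ?thesis by auto
      qed
      then show ?thesis by simp
    qed
    ultimately have "prob {\<omega>\<in>space M. finite {k. X k \<omega> \<in> A i} \<and> N i \<omega> = j} = prob {\<omega>\<in>space M. N i \<omega> = j}"
      by (intro finite_measure_eq_AE) (use fin[OF i] in auto)
    then show ?thesis using P[OF i] by simp
  qed
  have "(\<integral>\<omega>. expm (\<Sum>k. \<Sum>i<m. ennreal (c i) * indicator (A i) (X k \<omega>)) \<partial>M)
    = (\<integral>\<omega>. (\<Prod>i<m. exp (- (c i * real (N i \<omega>)))) \<partial>M)"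
  proof (rule integral_cong_AE)
    show "AE \<omega> in M. expm (\<Sum>k. \<Sum>i<m. ennreal (c i) * indicator (A i) (X k \<omega>)) = (\<Prod>i<m. exp (- (c i * real (N i \<omega>))))"
      using allfin
    proof eventually_elim
      case (elim \<omega>)
      have "(\<Sum>k. \<Sum>i<m. ennreal (c i) * indicator (A i) (X k \<omega>)) = (\<Sum>i<m. \<Sum>k. ennreal (c i) * indicator (A i) (X k \<omega>))"
        by (rule suminf_sum) auto
      also have "\<dots> = (\<Sum>i<m. \<Sum>k. if X k \<omega> \<in> A i then ennreal (c i) else 0)"
        by (intro sum.cong suminf_cong) (auto simp: indicator_def)
      also have "\<dots> = (\<Sum>i<m. of_nat (N i \<omega>) * ennreal (c i))"
        unfolding N_def by (intro sum.cong suminf_indicator_card refl) (use elim in auto)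
      also have "\<dots> = (\<Sum>i<m. ennreal (c i * real (N i \<omega>)))"
        using c by (intro sum.cong) (auto simp: ennreal_mult ennreal_of_nat_eq_real_of_nat mult.commute)
      finally show ?case using c by (simp add: expm_sum)
    qed
    have [measurable]: "i < m \<Longrightarrow> A i \<in> sets borel" for i using A by auto
    show "(\<lambda>\<omega>. expm (\<Sum>k. \<Sum>i<m. ennreal (c i) * indicator (A i) (X k \<omega>))) \<in> borel_measurable M"
      by measurable
    show "(\<lambda>\<omega>. \<Prod>i<m. exp (- (c i * real (N i \<omega>)))) \<in> borel_measurable M"
      by (intro borel_measurable_prod) (use Nm in measurable)
  qed
  also have "\<dots> = (\<Prod>i<m. (\<integral>\<omega>. exp (- (c i * real (N i \<omega>))) \<partial>M))"
  proof (rule indep_vars_lebesgue_integral)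
    show "indep_vars (\<lambda>_. borel) (\<lambda>i \<omega>. exp (- (c i * real (N i \<omega>)))) {..<m}"
      by (rule indep_vars_compose2[OF ind, of "\<lambda>i n. exp (- (c i * real n))"]) auto
    show "integrable M (\<lambda>\<omega>. exp (- (c i * real (N i \<omega>))))" if "i \<in> {..<m}" for i
      using that c Nm by (intro integrable_const_bound[of _ 1]) auto
  qed auto
  also have "\<dots> = (\<Prod>i<m. exp (- (measure lborel (A i) * (1 - exp (- c i)))))"
    by (intro prod.cong refl integral_poisson) (use Nm c P' in auto)
  also have "\<dots> = exp (- (\<Sum>i<m. measure lborel (A i) * (1 - exp (- c i))))"
    by (simp add: exp_sum sum_negf[symmetric])
  finally show ?thesis .
qed

text \<open>G is approximated from below by simple functions cut down to bounded boxes, so that the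
  level sets have finite measure. As \<open>expm\<close> is continuous up to infinity, both limits
  are legitimate even when the sum or the intensity integral is infinite.\<close>

theorem ppp_laplace:
  assumes "prob_space M" and X: "is_PPP_leb M X" and G [measurable]: "G \<in> borel_measurable borel"
  shows "(\<integral>\<omega>. expm (\<Sum>k. G (X k \<omega>)) \<partial>M)
    = expm (\<integral>\<^sup>+z. ennreal (1 - expm (G z)) * indicator quadrant z \<partial>lborel)"
proof -
  interpret prob_space M by fact
  have Xm [measurable]: "X k \<in> borel_measurable M" for k using X by (simp add: is_PPP_leb_def)
  have XQ: "X k \<omega> \<in> quadrant" if "\<omega> \<in> space M" for k \<omega> using X that by (auto simp: is_PPP_leb_def)
  obtain f where f: "\<And>i. simple_function (borel::(real\<times>real) measure) (f i)" "incseq f"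
    "\<And>i x. f i x < top" "\<And>x. (SUP i. f i x) = G x"
    using borel_measurable_implies_simple_function_sequence'[OF G] by blast
  have fm [measurable]: "f n \<in> borel_measurable borel" for n
    using f(1) borel_measurable_simple_function by blast
  define B where "B n = {0<..<real n} \<times> {0<..<real n}" for n :: nat
  have Bm [measurable]: "B n \<in> sets borel" for n unfolding B_def by (intro borel_open open_Times) auto
  have BQ: "B n \<subseteq> quadrant" for n by (auto simp: B_def)
  define g where "g n z = f n z * indicator (B n) z" for n z
  have gm [measurable]: "g n \<in> borel_measurable borel" for n unfolding g_def by measurable
  have fin: "(\<integral>\<omega>. expm (\<Sum>k. g n (X k \<omega>)) \<partial>M) = expm (\<integral>\<^sup>+z. ennreal (1 - expm (g n z)) \<partial>lborel)" for n
  proof -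
    have "finite (range (f n))" using f(1)[of n] by (simp add: simple_function_def)
    then obtain b m where b: "bij_betw b {..<m::nat} (range (f n))"
      using ex_bij_betw_nat_finite[of "range (f n)"] by (auto simp: atLeast0LessThan)
    define A where "A i = {z\<in>B n. f n z = b i}" for i
    define c where "c i = enn2real (b i)" for i
    have bc: "b i = ennreal (c i)" if "i < m" for i
    proof -
      have "b i \<in> range (f n)" using b that bij_betwE by blast
      then have "b i < \<top>" using f(3) by auto
      then show ?thesis by (simp add: c_def)
    qed
    have A: "A i \<in> sets borel" for i unfolding A_def by measurable
    have Afin: "emeasure lborel (A i) < \<infinity>" for i
    proof -
      have "bounded (B n)" unfolding B_def by (intro bounded_Times) auto
      then show ?thesis by (intro emeasure_bounded_finite) (auto intro: bounded_subset simp: A_def)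
    qed
    have AQ: "A i \<subseteq> quadrant" for i using BQ by (auto simp: A_def)
    have disj: "disjoint_family_on A {..<m}"
      using b by (auto simp: disjoint_family_on_def A_def bij_betw_def inj_on_def)
    \<comment> \<open>The map h is arbitrary so that the decomposition serves twice: h = id for the
      sum over the atoms and h = 1 - \<open>expm\<close> for the intensity integral. The condition h
      0 = 0 covers points off the box.\<close>
    have geq: "h (g n z) = (\<Sum>i<m. h (ennreal (c i)) * indicator (A i) z)" if h0: "h 0 = 0" for z and h :: "ennreal \<Rightarrow> ennreal"
    proof (cases "z \<in> B n")
      case True
      obtain i0 where i0: "i0 < m" "b i0 = f n z" using b by (metis bij_betw_iff_bijections lessThan_iff rangeI)
      have "(\<Sum>i<m. h (ennreal (c i)) * indicator (A i) z) = (\<Sum>i\<in>{i0}. h (ennreal (c i)) * indicator (A i) z)"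
        using b i0 by (intro sum.mono_neutral_right) (auto simp: A_def indicator_def bij_betw_def inj_on_def)
      then show ?thesis using True i0 bc by (simp add: g_def A_def)
    qed (auto simp: g_def A_def h0)
    have "(\<integral>\<omega>. expm (\<Sum>k. g n (X k \<omega>)) \<partial>M) = (\<integral>\<omega>. expm (\<Sum>k. \<Sum>i<m. ennreal (c i) * indicator (A i) (X k \<omega>)) \<partial>M)"
      using geq[of "\<lambda>x. x"] by simp
    also have "\<dots> = exp (- (\<Sum>i<m. measure lborel (A i) * (1 - exp (- c i))))"
      by (rule ppp_laplace_simple[OF assms(1) X]) (use A Afin disj AQ in \<open>auto simp: c_def\<close>)
    also have "\<dots> = expm (\<Sum>i<m. ennreal (1 - exp (- c i)) * emeasure lborel (A i))"
    proof -
      have "(\<Sum>i<m. ennreal (1 - exp (- c i)) * emeasure lborel (A i)) = (\<Sum>i<m. ennreal (measure lborel (A i) * (1 - exp (- c i))))"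
      proof (rule sum.cong)
        fix i
        have "emeasure lborel (A i) = ennreal (measure lborel (A i))"
          using Afin[of i] by (intro emeasure_eq_ennreal_measure) auto
        moreover have "ennreal (measure lborel (A i) * (1 - exp (- c i))) = ennreal (measure lborel (A i)) * ennreal (1 - exp (- c i))"
          by (rule ennreal_mult) (auto simp: c_def)
        ultimately show "ennreal (1 - exp (- c i)) * emeasure lborel (A i) = ennreal (measure lborel (A i) * (1 - exp (- c i)))"
          by (simp only: mult.commute)
      qed simp
      also have "\<dots> = ennreal (\<Sum>i<m. measure lborel (A i) * (1 - exp (- c i)))"
        by (rule sum_ennreal) (auto simp: c_def)
      finally show ?thesis by (simp add: sum_nonneg c_def)
    qed
    also have "(\<Sum>i<m. ennreal (1 - exp (- c i)) * emeasure lborel (A i)) = (\<integral>\<^sup>+z. (\<Sum>i<m. ennreal (1 - exp (- c i)) * indicator (A i) z) \<partial>lborel)"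
      using A by (subst nn_integral_sum) (auto simp: nn_integral_cmult_indicator)
    also have "\<dots> = (\<integral>\<^sup>+z. ennreal (1 - expm (g n z)) \<partial>lborel)"
      using geq[of "\<lambda>x. ennreal (1 - expm x)"] by (simp add: c_def)
    finally show ?thesis .
  qed
  have ginc: "incseq (\<lambda>n. g n z)" for z
  proof (rule incseq_SucI)
    fix n
    have "f n z \<le> f (Suc n) z" using incseq_SucD[OF f(2), of n] by (rule le_funD)
    then show "g n z \<le> g (Suc n) z" by (auto simp: g_def B_def indicator_def)
  qed
  have glim: "(\<lambda>n. g n z) \<longlonglongrightarrow> G z" if z: "z \<in> quadrant" for z
  proof -
    have "\<forall>\<^sub>F n in sequentially. real n > max (fst z) (snd z)" by real_asymp
    then have "\<forall>\<^sub>F n in sequentially. f n z = g n z"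
      by eventually_elim (use z in \<open>auto simp: g_def B_def indicator_def\<close>)
    moreover have "(\<lambda>n. f n z) \<longlonglongrightarrow> G z"
      using LIMSEQ_SUP[of "\<lambda>n. f n z"] incseq_SucI[of "\<lambda>n. f n z", OF le_funD[OF incseq_SucD[OF f(2)]]]
      by (simp only: f(4))
    ultimately show ?thesis using tendsto_cong by force
  qed
  have "(\<lambda>n. \<integral>\<omega>. expm (\<Sum>k. g n (X k \<omega>)) \<partial>M) \<longlonglongrightarrow> (\<integral>\<omega>. expm (\<Sum>k. G (X k \<omega>)) \<partial>M)"
  proof (rule integral_dominated_convergence[where w="\<lambda>_. 1"])
    show "AE \<omega> in M. (\<lambda>n. expm (\<Sum>k. g n (X k \<omega>))) \<longlonglongrightarrow> expm (\<Sum>k. G (X k \<omega>))"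
    proof (rule AE_I2)
      fix \<omega> assume w: "\<omega> \<in> space M"
      have "G (X k \<omega>) = (SUP n. g n (X k \<omega>))" for k
        using glim[OF XQ[OF w]] LIMSEQ_SUP[OF ginc] LIMSEQ_unique by blast
      then have "(\<Sum>k. G (X k \<omega>)) = (SUP n. \<Sum>k. g n (X k \<omega>))"
        using ennreal_suminf_SUP_eq[of "\<lambda>n k. g n (X k \<omega>)"] ginc by simp
      moreover have "incseq (\<lambda>n. \<Sum>k. g n (X k \<omega>))"
        using ginc by (intro monoI suminf_le) (auto simp: incseq_def)
      ultimately have "(\<lambda>n. \<Sum>k. g n (X k \<omega>)) \<longlonglongrightarrow> (\<Sum>k. G (X k \<omega>))"
        using LIMSEQ_SUP by metis
      then show "(\<lambda>n. expm (\<Sum>k. g n (X k \<omega>))) \<longlonglongrightarrow> expm (\<Sum>k. G (X k \<omega>))"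
        by (rule tendsto_expm)
    qed
  qed auto
  moreover have "(\<lambda>n. expm (\<integral>\<^sup>+z. ennreal (1 - expm (g n z)) \<partial>lborel)) \<longlonglongrightarrow>
      expm (\<integral>\<^sup>+z. ennreal (1 - expm (G z)) * indicator quadrant z \<partial>lborel)"
  proof (rule tendsto_expm, rule nn_integral_LIMSEQ)
    show "incseq (\<lambda>n z. ennreal (1 - expm (g n z)))"
      using ginc by (auto simp: incseq_def le_fun_def intro!: ennreal_leI expm_antimono)
    show "(\<lambda>i. ennreal (1 - expm (g i z))) \<longlonglongrightarrow> ennreal (1 - expm (G z)) * indicator quadrant z" for z
    proof (cases "z \<in> quadrant")
      case True
      then show ?thesis by (auto intro!: tendsto_ennrealI tendsto_intros tendsto_expm glim)
    next
      case False
      then have "g i z = 0" for i using BQ by (auto simp: g_def indicator_def)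
      then show ?thesis using False by simp
    qed
  qed measurable
  ultimately show ?thesis unfolding fin using LIMSEQ_unique by blast
qed

text \<open>The displacements under the graph of a jump density j are the jumps of an infinitely
  divisible variable, realised on the given space by projecting to the first coordinate.\<close>
lemma ex_infinitely_divisible:
  fixes j :: "real \<Rightarrow> real"
  assumes "prob_space M" and X: "is_PPP_leb M X" and j [measurable]: "j \<in> borel_measurable borel"
    and j0: "\<And>z. 0 \<le> j z" and fin: "(\<integral>\<^sup>+z. ennreal (z * j z) * indicator {0<..} z \<partial>lborel) < \<top>"
  shows "\<exists>nu. nonneg_distribution nu \<and>
    (\<forall>s\<ge>0. laplace nu s = expm (\<integral>\<^sup>+z. ennreal ((1 - exp (- (s * z))) * j z) * indicator {0<..} z \<partial>lborel))"
proof -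
  interpret prob_space M by fact
  have Xm [measurable]: "X k \<in> borel_measurable M" for k using X by (simp add: is_PPP_leb_def)
  define G where "G p = ennreal (fst p) * indicator {p. snd p < j (fst p)} p" for p :: "real \<times> real"
  have Gm [measurable]: "G \<in> borel_measurable borel"
  proof -
    have "{p \<in> space (borel \<Otimes>\<^sub>M borel). snd p < j (fst p)} \<in> sets (borel \<Otimes>\<^sub>M borel)" by measurable
    then have "{p::real\<times>real. snd p < j (fst p)} \<in> sets (borel \<Otimes>\<^sub>M borel)" by (simp add: space_pair_measure)
    moreover have [measurable]: "fst \<in> borel_measurable (borel :: (real \<times> real) measure)"
      by (intro borel_measurable_continuous_onI continuous_intros)
    ultimately show ?thesis unfolding G_def borel_prod by (intro borel_measurable_times_ennreal) auto
  qed
  define S where "S \<omega> = (\<Sum>k. G (X k \<omega>))" for \<omega>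
  have Sm [measurable]: "S \<in> borel_measurable M" unfolding S_def by measurable
  define I where "I s = (\<integral>\<^sup>+z. ennreal ((1 - exp (- (s * z))) * j z) * indicator {0<..} z \<partial>lborel)" for s
  have E: "(\<integral>\<omega>. expm (ennreal s * S \<omega>) \<partial>M) = expm (I s)" if s: "s \<ge> 0" for s
  proof -
    have "(\<integral>\<omega>. expm (ennreal s * S \<omega>) \<partial>M) = (\<integral>\<omega>. expm (\<Sum>k. ennreal s * G (X k \<omega>)) \<partial>M)"
      by (simp add: S_def)
    also have "\<dots> = expm (\<integral>\<^sup>+z. ennreal (1 - expm (ennreal s * G z)) * indicator quadrant z \<partial>lborel)"
      by (rule ppp_laplace[OF assms(1) X]) measurable
    also have "(\<integral>\<^sup>+z. ennreal (1 - expm (ennreal s * G z)) * indicator quadrant z \<partial>lborel)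
       = (\<integral>\<^sup>+z. ennreal (1 - expm (ennreal s * G z)) * indicator quadrant z \<partial>(lborel \<Otimes>\<^sub>M lborel))"
      by (simp add: lborel_prod)
    also have "\<dots> = (\<integral>\<^sup>+z. \<integral>\<^sup>+r. ennreal (1 - expm (ennreal s * G (z, r))) * indicator quadrant (z, r) \<partial>lborel \<partial>lborel)"
    proof (rule lborel.nn_integral_fst[symmetric])
      have "(\<lambda>z. ennreal (1 - expm (ennreal s * G z))) \<in> borel_measurable lborel" by measurable
      moreover have "quadrant \<in> sets lborel" using sets_quadrant by simp
      ultimately show "(\<lambda>z. ennreal (1 - expm (ennreal s * G z)) * indicator quadrant z) \<in> borel_measurable (lborel \<Otimes>\<^sub>M lborel)"
        unfolding lborel_prod by (intro borel_measurable_times_ennreal borel_measurable_indicator)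
    qed
    also have "\<dots> = I s" unfolding I_def
    proof (rule nn_integral_cong)
      fix z :: real
      have "(\<integral>\<^sup>+r. ennreal (1 - expm (ennreal s * G (z, r))) * indicator quadrant (z, r) \<partial>lborel)
        = (\<integral>\<^sup>+r. (ennreal (1 - exp (- (s * z))) * indicator {0<..} z) * indicator {0<..<j z} r \<partial>lborel)"
      proof (rule nn_integral_cong)
        fix r
        consider "z > 0 \<and> 0 < r \<and> r < j z" | "z > 0 \<and> \<not> r < j z" | "\<not> z > 0 \<or> \<not> r > 0" by linarith
        then show "ennreal (1 - expm (ennreal s * G (z, r))) * indicator quadrant (z, r) =
          (ennreal (1 - exp (- (s * z))) * indicator {0<..} z) * indicator {0<..<j z} r"
          using s by cases (auto simp: G_def ennreal_mult[symmetric])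
      qed
      also have "\<dots> = ennreal (1 - exp (- (s * z))) * indicator {0<..} z * ennreal (j z)"
        using j0[of z] by (subst nn_integral_cmult_indicator) auto
      also have "\<dots> = ennreal ((1 - exp (- (s * z))) * j z) * indicator {0<..} z"
        using j0[of z] s by (auto simp: indicator_def ennreal_mult[symmetric])
      finally show "(\<integral>\<^sup>+r. ennreal (1 - expm (ennreal s * G (z, r))) * indicator quadrant (z, r) \<partial>lborel)
        = ennreal ((1 - exp (- (s * z))) * j z) * indicator {0<..} z" .
    qed
    finally show ?thesis .
  qed
  define C where "C = enn2real (\<integral>\<^sup>+z. ennreal (z * j z) * indicator {0<..} z \<partial>lborel)"
  have C: "C \<ge> 0" "(\<integral>\<^sup>+z. ennreal (z * j z) * indicator {0<..} z \<partial>lborel) = ennreal C"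
    using fin by (simp_all add: C_def)
  \<comment> \<open>Since 1 - exp (- s z) <= s z, the exponent vanishes as s tends to 0, and this is
    what makes S finite almost surely.\<close>
  have Ile: "I s \<le> ennreal (s * C)" if s: "s \<ge> 0" for s
  proof -
    have "I s \<le> (\<integral>\<^sup>+z. ennreal s * (ennreal (z * j z) * indicator {0<..} z) \<partial>lborel)"
      unfolding I_def
    proof (rule nn_integral_mono)
      fix z :: real
      have "1 - exp (- (s * z)) \<le> s * z" using exp_ge_add_one_self[of "- (s * z)"] by linarith
      then have "(1 - exp (- (s * z))) * j z \<le> s * (z * j z)" if "z > 0"
        using j0[of z] by (metis mult.assoc mult_right_mono)
      then show "ennreal ((1 - exp (- (s * z))) * j z) * indicator {0<..} z \<le> ennreal s * (ennreal (z * j z) * indicator {0<..} z)"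
        using s j0[of z] by (auto simp: indicator_def ennreal_mult[symmetric] intro!: ennreal_leI)
    qed
    also have "\<dots> = ennreal (s * C)"
      using s C by (subst nn_integral_cmult) (auto simp: ennreal_mult)
    finally show ?thesis .
  qed
  have SF: "AE \<omega> in M. S \<omega> < \<top>"
  proof (rule AE_finite_of_expm)
    show "(\<lambda>n. \<integral>\<omega>. expm (ennreal (1 / real (Suc n)) * S \<omega>) \<partial>M) \<longlonglongrightarrow> 1"
    proof (rule tendsto_sandwich)
      show "(\<lambda>n. exp (- (1 / real (Suc n) * C))) \<longlonglongrightarrow> 1" by real_asymp
      show "\<forall>\<^sub>F n in sequentially. exp (- (1 / real (Suc n) * C)) \<le> (\<integral>\<omega>. expm (ennreal (1 / real (Suc n)) * S \<omega>) \<partial>M)"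
      proof (intro always_eventually allI)
        fix n
        have "expm (ennreal (1 / real (Suc n) * C)) \<le> expm (I (1 / real (Suc n)))"
          by (intro expm_antimono Ile) auto
        then show "exp (- (1 / real (Suc n) * C)) \<le> (\<integral>\<omega>. expm (ennreal (1 / real (Suc n)) * S \<omega>) \<partial>M)"
          using C by (subst E) auto
      qed
      show "\<forall>\<^sub>F n in sequentially. (\<integral>\<omega>. expm (ennreal (1 / real (Suc n)) * S \<omega>) \<partial>M) \<le> 1"
        by (subst E) auto
    qed auto
  qed measurable
  define nu where "nu = distr M borel (\<lambda>\<omega>. enn2real (S \<omega>))"
  have nd: "nonneg_distribution nu"
    unfolding nu_def by (rule nonneg_distribution_distr) auto
  moreover have "laplace nu s = expm (I s)" if s: "s \<ge> 0" for s
  proof -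
    have "laplace nu s = (\<integral>\<omega>. exp (- (s * enn2real (S \<omega>))) \<partial>M)"
      unfolding laplace_def nu_def by (subst integral_distr) auto
    also have "\<dots> = (\<integral>\<omega>. expm (ennreal s * S \<omega>) \<partial>M)"
    proof (rule integral_cong_AE)
      show "AE \<omega> in M. exp (- (s * enn2real (S \<omega>))) = expm (ennreal s * S \<omega>)"
        using SF
      proof eventually_elim
        case (elim \<omega>)
        then obtain r where "r \<ge> 0" "S \<omega> = ennreal r" by (cases "S \<omega>") auto
        then show ?case using s by (simp add: ennreal_mult[symmetric])
      qed
    qed measurable
    finally show ?thesis using E[OF s] by simp
  qed
  ultimately show ?thesis unfolding I_def by blast
qed

text \<open>Independence turns the joint law into a product, and Fubini integrates the second
  variable with the first one held fixed. With X the displacements of all other individuals and Y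
  those of a single one, this is conditioning on the rest of the tree.\<close>

lemma (in prob_space) indep_var_integral_freeze:
  fixes \<Phi> :: "'b \<times> 'b \<Rightarrow> real"
  assumes ind: "indep_var S X T Y" and [measurable]: "\<Phi> \<in> borel_measurable (S \<Otimes>\<^sub>M T)"
    and bound: "\<And>p. \<bar>\<Phi> p\<bar> \<le> 1"
  shows "(\<integral>\<omega>. \<Phi> (X \<omega>, Y \<omega>) \<partial>M) = (\<integral>\<omega>. (\<integral>\<omega>'. \<Phi> (X \<omega>, Y \<omega>') \<partial>M) \<partial>M)"
proof -
  have [measurable]: "random_variable S X" "random_variable T Y"
    and eq: "distr M S X \<Otimes>\<^sub>M distr M T Y = distr M (S \<Otimes>\<^sub>M T) (\<lambda>x. (X x, Y x))"
    using ind by (auto simp: indep_var_distribution_eq)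
  interpret D1: prob_space "distr M S X" by (rule prob_space_distr) measurable
  interpret D2: prob_space "distr M T Y" by (rule prob_space_distr) measurable
  interpret P: pair_prob_space "distr M S X" "distr M T Y" ..
  have "(\<integral>\<omega>. \<Phi> (X \<omega>, Y \<omega>) \<partial>M) = integral\<^sup>L (distr M S X \<Otimes>\<^sub>M distr M T Y) \<Phi>"
    unfolding eq by (subst integral_distr) auto
  also have "\<dots> = (\<integral>x. (\<integral>y. \<Phi> (x, y) \<partial>distr M T Y) \<partial>distr M S X)"
    by (rule P.integral_fst'[symmetric], rule P.integrable_const_bound[of _ 1]) (use bound in auto)
  also have "\<dots> = (\<integral>\<omega>. (\<integral>y. \<Phi> (X \<omega>, y) \<partial>distr M T Y) \<partial>M)"
    by (subst integral_distr) auto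
  also have "\<dots> = (\<integral>\<omega>. (\<integral>\<omega>'. \<Phi> (X \<omega>, Y \<omega>') \<partial>M) \<partial>M)"
  proof (rule Bochner_Integration.integral_cong)
    fix \<omega> assume "\<omega> \<in> space M"
    then have "X \<omega> \<in> space S" by (rule measurable_space[rotated]) measurable
    then have "(\<lambda>y. \<Phi> (X \<omega>, y)) \<in> borel_measurable T" by measurable
    then show "(\<integral>y. \<Phi> (X \<omega>, y) \<partial>distr M T Y) = (\<integral>\<omega>'. \<Phi> (X \<omega>, Y \<omega>') \<partial>M)"
      by (subst integral_distr) auto
  qed simp
  finally show ?thesis .
qed

section \<open>The branching property\<close>

definition generation :: "nat \<Rightarrow> nat list set" where
  "generation n = {u. length u = n}"

text \<open>By \<open>ppp_laplace\<close>, \<open>expm (offspring_op G y)\<close> is the expectation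
  of \<open>expm\<close> of the sum of G over the children of an individual at y.\<close>

definition offspring_op :: "(real \<times> real \<Rightarrow> ennreal) \<Rightarrow> real \<times> real \<Rightarrow> ennreal" where
  "offspring_op G y = (\<integral>\<^sup>+z. ennreal (1 - expm (G (y + z))) * indicator quadrant z \<partial>lborel)"

lemma measurable_offspring_op [measurable]:
  assumes [measurable]: "G \<in> borel_measurable borel"
  shows "offspring_op G \<in> borel_measurable borel"
proof -
  have Q [measurable]: "indicator quadrant \<in> borel_measurable (borel :: (real \<times> real) measure)"
    by (intro borel_measurable_indicator sets_quadrant)
  have "(\<lambda>p. ennreal (1 - expm (G (fst p + snd p))) * indicator quadrant (snd p)) \<in> borel_measurable (borel \<Otimes>\<^sub>M lborel)"
    by (intro borel_measurable_times_ennreal measurable_compose[OF measurable_snd] measurable_compose[OF _ measurable_ennreal] borel_measurable_diff)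
       (use Q in measurable)
  then have "(\<lambda>y. \<integral>\<^sup>+z. ennreal (1 - expm (G (y + z))) * indicator quadrant z \<partial>lborel) \<in> borel_measurable borel"
    by (intro lborel.borel_measurable_nn_integral) (simp add: split_beta')
  then show ?thesis unfolding offspring_op_def[abs_def] .
qed

text \<open>Positions as a function of the bare family of displacements, so that they can be
  evaluated on a restricted family and seen to be measurable with respect to it.\<close>

abbreviation posf :: "(nat list \<Rightarrow> nat \<Rightarrow> real \<times> real) \<Rightarrow> nat list \<Rightarrow> real \<times> real" where
  "posf \<theta> u \<equiv> brw_pos (\<lambda>u k \<theta>. \<theta> u k) \<theta> u"

lemma posf_eq_brw_pos: "posf (\<lambda>u k. xi u k \<omega>) u = brw_pos xi \<omega> u"
  by (induction u) auto

text \<open>The position of u is built from the offspring of its proper ancestors, whose labels are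
  strictly shorter than u and hence different from v.\<close>

lemma posf_restrict: "length u \<le> length v \<Longrightarrow> posf (restrict \<theta> (- {v})) u = posf \<theta> u"
  by (induction u) auto

lemma measurable_component_twice:
  assumes "u \<in> I"
  shows "(\<lambda>\<theta>. \<theta> u k) \<in> borel_measurable (PiM I (\<lambda>_. PiM UNIV (\<lambda>_. borel)))"
proof -
  have "(\<lambda>\<theta>. \<theta> u) \<in> measurable (PiM I (\<lambda>_. PiM UNIV (\<lambda>_. borel))) (PiM UNIV (\<lambda>_. borel))"
    by (rule measurable_component_singleton) fact
  moreover have "(\<lambda>f. f k) \<in> measurable (PiM UNIV (\<lambda>_. borel)) borel"
    by (rule measurable_component_singleton) simp
  ultimately show ?thesis by (rule measurable_compose)
qed

lemma measurable_posf:
  "length u \<le> length v \<Longrightarrow> (\<lambda>\<theta>. posf \<theta> u) \<in> borel_measurable (PiM (- {v}) (\<lambda>_. PiM UNIV (\<lambda>_. borel)))"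
proof (induction u)
  case (Cons k u)
  then have "u \<in> - {v}" by auto
  then have "(\<lambda>\<theta>. \<theta> u k) \<in> borel_measurable (PiM (- {v}) (\<lambda>_. PiM UNIV (\<lambda>_. borel :: (real \<times> real) measure)))"
    by (rule measurable_component_twice)
  then show ?case using Cons by (simp add: borel_measurable_add)
qed simp

text \<open>Partial sums along \<open>to_nat\<close> increase to the full sum. They reduce
  statements on an infinite generation to finite products.\<close>

lemma LIMSEQ_count_space_enum:
  "(\<lambda>m. \<Sum>u\<in>{u\<in>A. to_nat u < m}. h u) \<longlonglongrightarrow> (\<integral>\<^sup>+u. h u \<partial>count_space A)"
  for A :: "'c::countable set" and h :: "'c \<Rightarrow> ennreal"
proof -
  have fin: "finite {u\<in>A. to_nat u < m}" for m
    by (rule finite_imageD[of to_nat]) (auto intro: finite_subset[of _ "{..<m}"] inj_on_subset[OF inj_to_nat])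
  have "(\<lambda>m. \<integral>\<^sup>+u. h u * indicator {u\<in>A. to_nat u < m} u \<partial>count_space A) \<longlonglongrightarrow> (\<integral>\<^sup>+u. h u * indicator A u \<partial>count_space A)"
  proof (rule nn_integral_LIMSEQ)
    show "incseq (\<lambda>m u. h u * indicator {u\<in>A. to_nat u < m} u)"
      by (auto simp: incseq_def le_fun_def indicator_def)
    show "(\<lambda>m. h u * indicator {u\<in>A. to_nat u < m} u) \<longlonglongrightarrow> h u * indicator A u" for u
    proof (rule tendsto_eventually)
      show "\<forall>\<^sub>F m in sequentially. h u * indicator {u\<in>A. to_nat u < m} u = h u * indicator A u"
        using eventually_gt_at_top[of "to_nat u"] by eventually_elim (auto simp: indicator_def)
    qed
  qed auto
  moreover have "(\<integral>\<^sup>+u. h u * indicator {u\<in>A. to_nat u < m} u \<partial>count_space A) = (\<Sum>u\<in>{u\<in>A. to_nat u < m}. h u)" for m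
    by (subst nn_integral_count_space'[OF fin[of m]]) (auto intro!: sum.cong)
  moreover have "(\<integral>\<^sup>+u. h u * indicator A u \<partial>count_space A) = (\<integral>\<^sup>+u. h u \<partial>count_space A)"
    by (rule nn_integral_cong) simp
  ultimately show ?thesis by simp
qed

locale brw = prob_space M for M :: "'a measure" +
  fixes xi :: "nat list \<Rightarrow> nat \<Rightarrow> 'a \<Rightarrow> real \<times> real"
  assumes offspring: "brw_offspring M xi"
begin

lemma ppp: "is_PPP_leb M (xi u)"
  using offspring by (simp add: brw_offspring_def)

lemma measurable_xi [measurable]: "xi u k \<in> borel_measurable M"
  using ppp by (simp add: is_PPP_leb_def)

lemma measurable_brw_pos [measurable]: "(\<lambda>\<omega>. brw_pos xi \<omega> u) \<in> borel_measurable M"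
  by (induction u) auto

lemma measurable_generation_sum [measurable]:
  "G \<in> borel_measurable borel \<Longrightarrow> (\<lambda>\<omega>. \<integral>\<^sup>+u. G (brw_pos xi \<omega> u) \<partial>count_space (generation n)) \<in> borel_measurable M"
proof -
  assume [measurable]: "G \<in> borel_measurable borel"
  show ?thesis
    by (rule borel_measurable_LIMSEQ_order[OF LIMSEQ_count_space_enum]) measurable
qed

text \<open>The offspring process of v affects neither the positions of generation n nor the
  children of the individuals in S. Freezing everything else leaves the children of v, whose Laplace
  functional is given by \<open>ppp_laplace\<close>.\<close>

lemma freeze_one:
  fixes G :: "real \<times> real \<Rightarrow> ennreal"
  assumes [measurable]: "G \<in> borel_measurable borel" and S: "finite S" "S \<subseteq> generation n" and T: "finite T" "T \<subseteq> generation n"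
    and v: "v \<in> generation n" "v \<notin> S"
  defines "a \<equiv> \<lambda>u \<omega>. expm (\<Sum>k. G (brw_pos xi \<omega> u + xi u k \<omega>))" and "b \<equiv> \<lambda>u \<omega>. expm (offspring_op G (brw_pos xi \<omega> u))"
  shows "(\<integral>\<omega>. a v \<omega> * ((\<Prod>u\<in>S. a u \<omega>) * (\<Prod>u\<in>T. b u \<omega>)) \<partial>M) = (\<integral>\<omega>. b v \<omega> * ((\<Prod>u\<in>S. a u \<omega>) * (\<Prod>u\<in>T. b u \<omega>)) \<partial>M)"
proof -
  let ?P = "PiM UNIV (\<lambda>_::nat. borel :: (real\<times>real) measure)"
  let ?Q = "PiM (- {v}) (\<lambda>_. ?P)"
  let ?V = "PiM {v} (\<lambda>_. ?P)"
  define X where "X \<omega> = restrict (\<lambda>u k. xi u k \<omega>) (- {v})" for \<omega>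
  define Y where "Y \<omega> = restrict (\<lambda>u k. xi u k \<omega>) {v}" for \<omega>
  define R where "R \<theta> = (\<Prod>u\<in>S. expm (\<Sum>k. G (posf \<theta> u + \<theta> u k))) * (\<Prod>u\<in>T. expm (offspring_op G (posf \<theta> u)))" for \<theta>
  have "indep_vars (\<lambda>_. ?P) (\<lambda>u \<omega>. \<lambda>k. xi u k \<omega>) UNIV"
    using offspring by (simp add: brw_offspring_def)
  then have "indep_var (PiM (-{v}) (\<lambda>_. ?P)) (\<lambda>\<omega>. restrict (\<lambda>u. \<lambda>k. xi u k \<omega>) (-{v})) (PiM {v} (\<lambda>_. ?P)) (\<lambda>\<omega>. restrict (\<lambda>u. \<lambda>k. xi u k \<omega>) {v})"
    by (rule indep_var_restrict) auto
  then have ind: "indep_var ?Q X ?V Y"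
    by (simp add: X_def[abs_def] Y_def[abs_def])
  have len: "length u = length v" if "u \<in> S \<union> T \<union> {v}" for u using that S T v by (auto simp: generation_def)
  have pos: "posf (X \<omega>) u = brw_pos xi \<omega> u" if "u \<in> S \<union> T \<union> {v}" for u \<omega>
    using posf_restrict[of u v] len[OF that] posf_eq_brw_pos[of xi \<omega> u] by (simp add: X_def)
  have RX: "R (X \<omega>) = (\<Prod>u\<in>S. a u \<omega>) * (\<Prod>u\<in>T. b u \<omega>)" for \<omega>
  proof -
    have "X \<omega> u k = xi u k \<omega>" if "u \<in> S" for u k using that v by (auto simp: X_def)
    then show ?thesis unfolding R_def a_def b_def by (simp add: pos)
  qed
  have mpos: "(\<lambda>\<theta>. posf \<theta> u) \<in> borel_measurable ?Q" if "u \<in> S \<union> T \<union> {v}" for u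
    using len[OF that] by (intro measurable_posf) simp
  have mcomp: "(\<lambda>\<theta>. \<theta> u k) \<in> borel_measurable ?Q" if "u \<in> S" for u k
    by (rule measurable_component_twice) (use that v in auto)
  have mY: "(\<lambda>y. y v k) \<in> borel_measurable ?V" for k
    by (rule measurable_component_twice) auto
  have RM [measurable]: "R \<in> borel_measurable ?Q" unfolding R_def
  proof (intro borel_measurable_times borel_measurable_prod)
    fix u assume u: "u \<in> S"
    have [measurable]: "(\<lambda>\<theta>. posf \<theta> u) \<in> borel_measurable ?Q" "\<And>k. (\<lambda>\<theta>. \<theta> u k) \<in> borel_measurable ?Q"
      using u mpos mcomp by auto
    show "(\<lambda>\<theta>. expm (\<Sum>k. G (posf \<theta> u + \<theta> u k))) \<in> borel_measurable ?Q" by measurable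
  next
    fix u assume u: "u \<in> T"
    have [measurable]: "(\<lambda>\<theta>. posf \<theta> u) \<in> borel_measurable ?Q" using u mpos by auto
    show "(\<lambda>\<theta>. expm (offspring_op G (posf \<theta> u))) \<in> borel_measurable ?Q" by measurable
  qed
  have Rb: "0 \<le> R \<theta> \<and> R \<theta> \<le> 1" for \<theta>
    unfolding R_def by (auto intro!: mult_le_one prod_le_1 prod_nonneg mult_nonneg_nonneg)
  have [measurable]: "(\<lambda>\<theta>. posf \<theta> v) \<in> borel_measurable ?Q" "\<And>k. (\<lambda>y. y v k) \<in> borel_measurable ?V"
    using mpos mY by auto
  have "(\<integral>\<omega>. a v \<omega> * ((\<Prod>u\<in>S. a u \<omega>) * (\<Prod>u\<in>T. b u \<omega>)) \<partial>M)
     = (\<integral>\<omega>. (\<lambda>(\<theta>, y). expm (\<Sum>k. G (posf \<theta> v + y v k)) * R \<theta>) (X \<omega>, Y \<omega>) \<partial>M)"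
    using pos[of v] by (simp add: RX a_def Y_def)
  also have "\<dots> = (\<integral>\<omega>. (\<integral>\<omega>'. (\<lambda>(\<theta>, y). expm (\<Sum>k. G (posf \<theta> v + y v k)) * R \<theta>) (X \<omega>, Y \<omega>') \<partial>M) \<partial>M)"
  proof (rule indep_var_integral_freeze[OF ind])
    show "(\<lambda>(\<theta>, y). expm (\<Sum>k. G (posf \<theta> v + y v k)) * R \<theta>) \<in> borel_measurable (?Q \<Otimes>\<^sub>M ?V)" by measurable
    show "\<bar>case p of (\<theta>, y) \<Rightarrow> expm (\<Sum>k. G (posf \<theta> v + y v k)) * R \<theta>\<bar> \<le> 1" for p
      using Rb by (auto simp: split_beta' abs_mult intro!: mult_le_one)
  qed
  also have "\<dots> = (\<integral>\<omega>. b v \<omega> * ((\<Prod>u\<in>S. a u \<omega>) * (\<Prod>u\<in>T. b u \<omega>)) \<partial>M)"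
  proof (rule Bochner_Integration.integral_cong)
    fix \<omega>
    have "(\<integral>\<omega>'. expm (\<Sum>k. G (posf (X \<omega>) v + xi v k \<omega>')) \<partial>M) = expm (offspring_op G (posf (X \<omega>) v))"
      unfolding offspring_op_def
      by (rule ppp_laplace[OF prob_space_axioms ppp, of "\<lambda>z. G (posf (X \<omega>) v + z)"]) measurable
    then show "(\<integral>\<omega>'. (\<lambda>(\<theta>, y). expm (\<Sum>k. G (posf \<theta> v + y v k)) * R \<theta>) (X \<omega>, Y \<omega>') \<partial>M)
       = b v \<omega> * ((\<Prod>u\<in>S. a u \<omega>) * (\<Prod>u\<in>T. b u \<omega>))"
      using pos[of v] by (simp add: RX Y_def b_def)
  qed simp
  finally show ?thesis .
qed

text \<open>Individuals are moved one at a time from S, where their children still appear, to T,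
  where the children are averaged out; T is general to carry the induction.\<close>

lemma freeze_finite:
  fixes G :: "real \<times> real \<Rightarrow> ennreal"
  assumes [measurable]: "G \<in> borel_measurable borel" and S: "finite S" "S \<subseteq> generation n"
  shows "finite T \<Longrightarrow> T \<subseteq> generation n \<Longrightarrow> S \<inter> T = {} \<Longrightarrow>
   (\<integral>\<omega>. (\<Prod>u\<in>S. expm (\<Sum>k. G (brw_pos xi \<omega> u + xi u k \<omega>))) * (\<Prod>u\<in>T. expm (offspring_op G (brw_pos xi \<omega> u))) \<partial>M)
    = (\<integral>\<omega>. (\<Prod>u\<in>S \<union> T. expm (offspring_op G (brw_pos xi \<omega> u))) \<partial>M)"
  using S
proof (induction S arbitrary: T rule: finite_induct)
  case (insert v S)
  let ?a = "\<lambda>u \<omega>. expm (\<Sum>k. G (brw_pos xi \<omega> u + xi u k \<omega>))" and ?b = "\<lambda>u \<omega>. expm (offspring_op G (brw_pos xi \<omega> u))"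
  have "(\<integral>\<omega>. (\<Prod>u\<in>insert v S. ?a u \<omega>) * (\<Prod>u\<in>T. ?b u \<omega>) \<partial>M) = (\<integral>\<omega>. ?a v \<omega> * ((\<Prod>u\<in>S. ?a u \<omega>) * (\<Prod>u\<in>T. ?b u \<omega>)) \<partial>M)"
    using insert by (simp add: mult.assoc)
  also have "\<dots> = (\<integral>\<omega>. ?b v \<omega> * ((\<Prod>u\<in>S. ?a u \<omega>) * (\<Prod>u\<in>T. ?b u \<omega>)) \<partial>M)"
    by (rule freeze_one[of G S n T v]) (use insert in auto)
  also have "\<dots> = (\<integral>\<omega>. (\<Prod>u\<in>S. ?a u \<omega>) * (\<Prod>u\<in>insert v T. ?b u \<omega>) \<partial>M)"
    using insert by (intro Bochner_Integration.integral_cong) (auto simp: mult.left_commute)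
  also have "\<dots> = (\<integral>\<omega>. (\<Prod>u\<in>S \<union> insert v T. ?b u \<omega>) \<partial>M)"
    by (rule insert.IH) (use insert in auto)
  finally show ?case by simp
qed simp

lemma generation_Suc_sum:
  "(\<integral>\<^sup>+v. H v \<partial>count_space (generation (Suc n))) = (\<integral>\<^sup>+u. (\<Sum>k. H (k # u)) \<partial>count_space (generation n))" for H :: "nat list \<Rightarrow> ennreal"
proof -
  have bij: "bij_betw (\<lambda>(u, k). k # u) (generation n \<times> UNIV) (generation (Suc n))"
    by (rule bij_betwI'[of _ _ _]) (auto simp: generation_def length_Suc_conv)
  have "(\<integral>\<^sup>+v. H v \<partial>count_space (generation (Suc n))) = (\<integral>\<^sup>+p. H ((\<lambda>(u, k). k # u) p) \<partial>count_space (generation n \<times> UNIV))"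
    by (rule nn_integral_bij_count_space[OF bij, symmetric])
  also have "\<dots> = (\<integral>\<^sup>+p. (case p of (u, k) \<Rightarrow> H (k # u) * indicator (generation n) u) \<partial>count_space UNIV)"
    by (subst nn_integral_count_space_indicator) (auto intro!: nn_integral_cong simp: indicator_def)
  also have "\<dots> = (\<integral>\<^sup>+u. \<integral>\<^sup>+k. H (k # u) * indicator (generation n) u \<partial>count_space UNIV \<partial>count_space UNIV)"
    by (subst nn_integral_fst_count_space[symmetric]) simp
  also have "\<dots> = (\<integral>\<^sup>+u. (\<Sum>k. H (k # u)) * indicator (generation n) u \<partial>count_space UNIV)"
    by (intro nn_integral_cong) (auto simp: nn_integral_count_space_nat indicator_def)
  finally show ?thesis by (subst nn_integral_count_space_indicator) auto
qed

text \<open>For finitely many individuals this is \<open>freeze_finite\<close> with T empty; all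
  factors lie in [0,1], so dominated convergence extends it to the whole generation.\<close>

lemma branching:
  fixes G :: "real \<times> real \<Rightarrow> ennreal"
  assumes [measurable]: "G \<in> borel_measurable borel"
  shows "(\<integral>\<omega>. expm (\<integral>\<^sup>+u. G (brw_pos xi \<omega> u) \<partial>count_space (generation (Suc n))) \<partial>M)
   = (\<integral>\<omega>. expm (\<integral>\<^sup>+u. offspring_op G (brw_pos xi \<omega> u) \<partial>count_space (generation n)) \<partial>M)"
proof -
  define A where "A m = {u\<in>generation n. to_nat u < m}" for m
  have fin: "finite (A m)" for m unfolding A_def
    by (rule finite_imageD[of to_nat]) (auto intro: finite_subset[of _ "{..<m}"] inj_on_subset[OF inj_to_nat])
  have lim: "(\<lambda>m. \<integral>\<omega>. (\<Prod>u\<in>A m. expm (h u \<omega>)) \<partial>M) \<longlonglongrightarrow> (\<integral>\<omega>. expm (\<integral>\<^sup>+u. h u \<omega> \<partial>count_space (generation n)) \<partial>M)"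
    if [measurable]: "\<And>u. h u \<in> borel_measurable M" for h
  proof (rule integral_dominated_convergence[where w="\<lambda>_. 1"])
    show "AE \<omega> in M. (\<lambda>m. \<Prod>u\<in>A m. expm (h u \<omega>)) \<longlonglongrightarrow> expm (\<integral>\<^sup>+u. h u \<omega> \<partial>count_space (generation n))"
      unfolding A_def expm_sum[symmetric]
      by (intro AE_I2 tendsto_expm LIMSEQ_count_space_enum)
    show "AE \<omega> in M. norm (\<Prod>u\<in>A m. expm (h u \<omega>)) \<le> 1" for m
      by (intro AE_I2) (auto simp: abs_prod intro!: prod_le_1)
    show "(\<lambda>\<omega>. expm (\<integral>\<^sup>+u. h u \<omega> \<partial>count_space (generation n))) \<in> borel_measurable M"
    proof (rule borel_measurable_LIMSEQ_real)
      show "(\<lambda>m. \<Prod>u\<in>A m. expm (h u \<omega>)) \<longlonglongrightarrow> expm (\<integral>\<^sup>+u. h u \<omega> \<partial>count_space (generation n))" for \<omega>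
        unfolding A_def expm_sum[symmetric] by (intro tendsto_expm LIMSEQ_count_space_enum)
    qed measurable
  qed auto
  have "(\<integral>\<omega>. (\<Prod>u\<in>A m. expm (\<Sum>k. G (brw_pos xi \<omega> u + xi u k \<omega>))) \<partial>M) = (\<integral>\<omega>. (\<Prod>u\<in>A m. expm (offspring_op G (brw_pos xi \<omega> u))) \<partial>M)" for m
    using freeze_finite[of G "A m" n "{}"] fin by (auto simp: A_def)
  moreover have "(\<lambda>m. \<integral>\<omega>. (\<Prod>u\<in>A m. expm (\<Sum>k. G (brw_pos xi \<omega> u + xi u k \<omega>))) \<partial>M) \<longlonglongrightarrow>
      (\<integral>\<omega>. expm (\<integral>\<^sup>+u. (\<Sum>k. G (brw_pos xi \<omega> u + xi u k \<omega>)) \<partial>count_space (generation n)) \<partial>M)"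
    by (rule lim) measurable
  moreover have "(\<lambda>m. \<integral>\<omega>. (\<Prod>u\<in>A m. expm (offspring_op G (brw_pos xi \<omega> u))) \<partial>M) \<longlonglongrightarrow>
      (\<integral>\<omega>. expm (\<integral>\<^sup>+u. offspring_op G (brw_pos xi \<omega> u) \<partial>count_space (generation n)) \<partial>M)"
    by (rule lim) measurable
  ultimately have "(\<integral>\<omega>. expm (\<integral>\<^sup>+u. (\<Sum>k. G (brw_pos xi \<omega> u + xi u k \<omega>)) \<partial>count_space (generation n)) \<partial>M)
     = (\<integral>\<omega>. expm (\<integral>\<^sup>+u. offspring_op G (brw_pos xi \<omega> u) \<partial>count_space (generation n)) \<partial>M)"
    using LIMSEQ_unique by simp
  then show ?thesis by (simp add: generation_Suc_sum)
qed

end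

section \<open>Integrals over the quadrant and the recursion for the Laplace exponents\<close>

lemma nn_integral_exp_half_line:
  assumes "c > 0"
  shows "(\<integral>\<^sup>+t. ennreal (exp (- (c * t))) * indicator {0<..} t \<partial>lborel) = ennreal (1 / c)"
proof -
  have "(\<integral>\<^sup>+t. ennreal (exp (- (c * t))) * indicator {0<..} t \<partial>lborel) = (\<integral>\<^sup>+t. ennreal (exp (- (c * t))) * indicator {0..} t \<partial>lborel)"
    by (rule nn_integral_cong_AE) (use AE_lborel_singleton[of "0::real"] in \<open>auto elim!: eventually_mono simp: indicator_def\<close>)
  also have "\<dots> = ennreal (0 - (- (exp (- (c * 0)) / c)))"
  proof (rule nn_integral_FTC_atLeast)
    show "((\<lambda>t. - (exp (- (c * t)) / c)) has_real_derivative exp (- (c * x))) (at x)" for x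
      using assms by (auto intro!: derivative_eq_intros)
    show "((\<lambda>t. - (exp (- (c * t)) / c)) \<longlongrightarrow> 0) at_top"
      using assms by real_asymp
  qed auto
  finally show ?thesis by simp
qed

text \<open>The weight exp (- t - x) depends on the sum of the coordinates only, so the intensity
  integrals of the random walk all have this form.\<close>

definition quad_integral :: "(real \<Rightarrow> ennreal) \<Rightarrow> ennreal" where
  "quad_integral g = (\<integral>\<^sup>+t. (\<integral>\<^sup>+x. g (t + x) * indicator {0<..} x \<partial>lborel) * indicator {0<..} t \<partial>lborel)"

lemma nn_integral_quadrant:
  fixes g :: "real \<Rightarrow> ennreal"
  assumes [measurable]: "g \<in> borel_measurable borel"
  shows "(\<integral>\<^sup>+z. g (fst z + snd z) * indicator quadrant z \<partial>lborel) = quad_integral g"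
proof -
  have "(\<integral>\<^sup>+z. g (fst z + snd z) * indicator quadrant z \<partial>lborel)
     = (\<integral>\<^sup>+z. g (fst z + snd z) * indicator {0<..} (fst z) * indicator {0<..} (snd z) \<partial>(lborel \<Otimes>\<^sub>M lborel))"
    unfolding lborel_prod by (rule nn_integral_cong) (auto simp: indicator_def)
  also have "\<dots> = (\<integral>\<^sup>+t. \<integral>\<^sup>+x. g (t + x) * indicator {0<..} t * indicator {0<..} x \<partial>lborel \<partial>lborel)"
    by (subst lborel.nn_integral_fst[symmetric]) simp_all
  also have "\<dots> = quad_integral g"
    unfolding quad_integral_def
    by (intro nn_integral_cong, subst nn_integral_multc[symmetric]) (auto simp: mult_ac)
  finally show ?thesis .
qed

lemma quad_integral_mono: "(\<And>t. t > 0 \<Longrightarrow> g t \<le> h t) \<Longrightarrow> quad_integral g \<le> quad_integral h"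
proof -
  assume *: "\<And>t. t > 0 \<Longrightarrow> g t \<le> h t"
  have "(\<integral>\<^sup>+x. g (t + x) * indicator {0<..} x \<partial>lborel) \<le> (\<integral>\<^sup>+x. h (t + x) * indicator {0<..} x \<partial>lborel)" if "t > 0" for t
    by (intro nn_integral_mono) (use * that in \<open>auto simp: indicator_def\<close>)
  then show ?thesis
    unfolding quad_integral_def by (intro nn_integral_mono) (auto simp: indicator_def)
qed

lemma quad_integral_add:
  assumes [measurable]: "g \<in> borel_measurable borel" "h \<in> borel_measurable borel"
  shows "quad_integral (\<lambda>t. g t + h t) = quad_integral g + quad_integral h"
  by (simp add: quad_integral_def distrib_right nn_integral_add)

lemma quad_integral_exp:
  assumes "c > 0" "a \<ge> 0"
  shows "quad_integral (\<lambda>t. ennreal (a * exp (- (c * t)))) = ennreal (a / c\<^sup>2)"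
proof -
  have "(\<integral>\<^sup>+x. ennreal (a * exp (- (c * (t + x)))) * indicator {0<..} x \<partial>lborel) = ennreal (a * exp (- (c * t)) / c)" for t
  proof -
    have "(\<integral>\<^sup>+x. ennreal (a * exp (- (c * (t + x)))) * indicator {0<..} x \<partial>lborel)
      = (\<integral>\<^sup>+x. ennreal (a * exp (- (c * t))) * (ennreal (exp (- (c * x))) * indicator {0<..} x) \<partial>lborel)"
      using assms by (intro nn_integral_cong) (auto simp: indicator_def ennreal_mult[symmetric] exp_add[symmetric] algebra_simps)
    also have "\<dots> = ennreal (a * exp (- (c * t))) * ennreal (1 / c)"
      by (subst nn_integral_cmult) (auto simp: nn_integral_exp_half_line assms)
    finally show ?thesis using assms by (simp add: ennreal_mult[symmetric])
  qed
  then have "quad_integral (\<lambda>t. ennreal (a * exp (- (c * t)))) = (\<integral>\<^sup>+t. ennreal (a / c) * (ennreal (exp (- (c * t))) * indicator {0<..} t) \<partial>lborel)"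
    unfolding quad_integral_def using assms
    by (intro nn_integral_cong) (auto simp: indicator_def ennreal_mult[symmetric])
  also have "\<dots> = ennreal (a / c) * ennreal (1 / c)"
    by (subst nn_integral_cmult) (auto simp: nn_integral_exp_half_line assms)
  finally show ?thesis using assms by (simp add: ennreal_mult[symmetric] power2_eq_square)
qed

lemma (in nonneg_distribution) measurable_laplace [measurable]: "laplace N \<in> borel_measurable borel"
proof -
  have "(\<lambda>(s, x). exp (- (s * x))) \<in> borel_measurable (borel \<Otimes>\<^sub>M N)"
    by (subst measurable_cong_sets[OF sets_pair_measure_cong[OF refl events_eq_borel] refl]) measurable
  then show ?thesis unfolding laplace_def[abs_def]
    by (rule borel_measurable_lebesgue_integral)
qed

text \<open>One generation of the random walk on the level of laws: if N is the law of W_n, then N'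
  is that of W_(n+1). The case N' = N is the fixed point equation of the limit.\<close>

definition smoothing :: "real measure \<Rightarrow> real measure \<Rightarrow> bool" where
  "smoothing N N' \<longleftrightarrow> (\<forall>s\<ge>0. laplace N' s = expm (quad_integral (\<lambda>t. ennreal (1 - laplace N (s * exp (- t))))))"

text \<open>Mean 1 together with second order control, in a form that is closed under pointwise
  limits of Laplace transforms.\<close>

definition normalized :: "real measure \<Rightarrow> bool" where
  "normalized N \<longleftrightarrow> nonneg_distribution N \<and>
     (\<forall>s\<ge>0. exp (- s) \<le> laplace N s \<and> laplace N s \<le> exp (- (s - s\<^sup>2 / 6)))"

text \<open>The extended-valued function -log E exp (- s W_n); the recursion starts from W_0 =
  1.\<close>

fun brw_exponent :: "nat \<Rightarrow> real \<Rightarrow> ennreal" where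
  "brw_exponent 0 s = ennreal s"
| "brw_exponent (Suc n) s = quad_integral (\<lambda>t. ennreal (1 - expm (brw_exponent n (s * exp (- t)))))"

lemma measurable_brw_exponent [measurable]: "brw_exponent n \<in> borel_measurable borel"
proof (induction n)
  case (Suc n)
  note Suc[measurable]
  have "(\<lambda>s. quad_integral (\<lambda>t. ennreal (1 - expm (brw_exponent n (s * exp (- t)))))) \<in> borel_measurable borel"
    unfolding quad_integral_def by measurable
  then show ?case by (simp add: fun_eq_iff[symmetric] cong: measurable_cong)
qed (auto simp: fun_eq_iff[symmetric] cong: measurable_cong)

lemma one_minus_exp_ge: "r \<ge> 0 \<Longrightarrow> 1 - exp (- r) \<ge> r - r\<^sup>2 / 2" for r :: real
proof -
  assume r: "r \<ge> 0"
  define h where "h x = 1 - exp (- x) - x + x\<^sup>2 / 2" for x :: real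
  have "h 0 \<le> h r"
  proof (rule DERIV_nonneg_imp_nondecreasing[OF r])
    fix x :: real
    have "(h has_real_derivative (exp (- x) - 1 + x)) (at x)"
      unfolding h_def by (auto intro!: derivative_eq_intros)
    moreover have "exp (- x) - 1 + x \<ge> 0" using exp_ge_add_one_self[of "- x"] by linarith
    ultimately show "\<exists>y. (h has_real_derivative y) (at x) \<and> 0 \<le> y" by blast
  qed
  then show ?thesis by (simp add: h_def)
qed

lemma one_minus_exp_le: "1 - exp (- r) \<le> r" for r :: real
  using exp_ge_add_one_self[of "- r"] by linarith

text \<open>Let a = s exp (- t). If the n-th exponent at a is r >= a - a^2/6, then 1 - exp (- r) >=
  r - r^2/2 >= a - (2/3) a^2, and exp (- 2 t) integrates to 1/4 over the quadrant, so the
  coefficient 1/6 = (2/3)/4 reproduces itself. The bound is written additively because subtraction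
  on extended reals truncates.\<close>

lemma brw_exponent_bounds:
  assumes "s \<ge> 0"
  shows "brw_exponent n s \<le> ennreal s \<and> ennreal s \<le> brw_exponent n s + ennreal (s\<^sup>2 / 6)"
  using assms
proof (induction n arbitrary: s)
  case (Suc n)
  have fin: "\<exists>r. brw_exponent n (s * exp (- t)) = ennreal r \<and> 0 \<le> r \<and> r \<le> s * exp (- t) \<and> s * exp (- t) \<le> r + (s * exp (- t))\<^sup>2 / 6" for t
  proof -
    have b: "brw_exponent n (s * exp (- t)) \<le> ennreal (s * exp (- t)) \<and> ennreal (s * exp (- t)) \<le> brw_exponent n (s * exp (- t)) + ennreal ((s * exp (- t))\<^sup>2 / 6)"
      using Suc.prems by (intro Suc.IH) auto
    then obtain r where r: "brw_exponent n (s * exp (- t)) = ennreal r" "0 \<le> r"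
      by (cases "brw_exponent n (s * exp (- t))") (auto simp: top_unique)
    then show ?thesis using b Suc.prems by (auto simp: ennreal_plus[symmetric] simp del: ennreal_plus intro!: exI[of _ r])
  qed
  have "brw_exponent (Suc n) s \<le> quad_integral (\<lambda>t. ennreal (s * exp (- (1 * t))))"
    unfolding brw_exponent.simps
  proof (rule quad_integral_mono)
    fix t :: real
    obtain r where r: "brw_exponent n (s * exp (- t)) = ennreal r" "0 \<le> r" "r \<le> s * exp (- t)" using fin by blast
    then show "ennreal (1 - expm (brw_exponent n (s * exp (- t)))) \<le> ennreal (s * exp (- (1 * t)))"
      using one_minus_exp_le[of r] by (auto intro!: ennreal_leI)
  qed
  also have "\<dots> = ennreal s" using Suc.prems by (subst quad_integral_exp) auto
  finally have 1: "brw_exponent (Suc n) s \<le> ennreal s" .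
  have "ennreal s = quad_integral (\<lambda>t. ennreal (s * exp (- (1 * t))))" using Suc.prems by (subst quad_integral_exp) auto
  also have "\<dots> \<le> quad_integral (\<lambda>t. ennreal (1 - expm (brw_exponent n (s * exp (- t)))) + ennreal (2 / 3 * s\<^sup>2 * exp (- (2 * t))))"
  proof (rule quad_integral_mono)
    fix t :: real
    obtain r where r: "brw_exponent n (s * exp (- t)) = ennreal r" "0 \<le> r" "r \<le> s * exp (- t)" "s * exp (- t) \<le> r + (s * exp (- t))\<^sup>2 / 6"
      using fin by blast
    have sq: "(s * exp (- t))\<^sup>2 = s\<^sup>2 * exp (- (2 * t))"
      by (simp add: power_mult_distrib exp_double[symmetric])
    have "r\<^sup>2 \<le> (s * exp (- t))\<^sup>2" using r by (intro power_mono) auto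
    then have "s * exp (- t) \<le> (1 - exp (- r)) + 2 / 3 * s\<^sup>2 * exp (- (2 * t))"
      using one_minus_exp_ge[OF r(2)] r(4) unfolding sq by linarith
    then show "ennreal (s * exp (- (1 * t))) \<le> ennreal (1 - expm (brw_exponent n (s * exp (- t)))) + ennreal (2 / 3 * s\<^sup>2 * exp (- (2 * t)))"
      using r by (simp add: ennreal_plus[symmetric] ennreal_leI del: ennreal_plus)
  qed
  also have "\<dots> = brw_exponent (Suc n) s + ennreal (s\<^sup>2 / 6)"
    using quad_integral_exp[of 2 "2 / 3 * s\<^sup>2"] by (subst quad_integral_add) simp_all
  finally show ?case using 1 by simp
qed auto

context brw
begin

text \<open>Each use of \<open>branching\<close> lowers the generation by one and raises the index
  of the exponent by one; m is arbitrary to absorb this, and m = 0 is the case of interest.\<close>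

lemma expm_brw_exponent:
  "(\<integral>\<omega>. expm (\<integral>\<^sup>+u. brw_exponent m (s * exp (- (fst (brw_pos xi \<omega> u) + snd (brw_pos xi \<omega> u)))) \<partial>count_space (generation n)) \<partial>M)
    = expm (brw_exponent (n + m) s)"
proof (induction n arbitrary: m)
  case 0
  have "generation 0 = {[]}" by (auto simp: generation_def)
  then have "(\<integral>\<^sup>+u. brw_exponent m (s * exp (- (fst (brw_pos xi \<omega> u) + snd (brw_pos xi \<omega> u)))) \<partial>count_space (generation 0)) = brw_exponent m s" for \<omega>
    by (simp add: nn_integral_count_space_finite)
  then show ?case by (simp add: prob_space)
next
  case (Suc n)
  define G where "G y = brw_exponent m (s * exp (- (fst y + snd y)))" for y :: "real \<times> real"
  have fs [measurable]: "fst \<in> borel_measurable (borel :: (real \<times> real) measure)" "snd \<in> borel_measurable (borel :: (real \<times> real) measure)"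
    by (intro borel_measurable_continuous_onI continuous_intros)+
  have [measurable]: "G \<in> borel_measurable borel" unfolding G_def by measurable
  have "offspring_op G y = brw_exponent (Suc m) (s * exp (- (fst y + snd y)))" for y
  proof -
    have "offspring_op G y = (\<integral>\<^sup>+z. ennreal (1 - expm (brw_exponent m (s * exp (- (fst y + snd y)) * exp (- (fst z + snd z))))) * indicator quadrant z \<partial>lborel)"
      unfolding offspring_op_def G_def
      by (intro nn_integral_cong) (simp add: exp_add[symmetric] mult.assoc algebra_simps)
    also have "\<dots> = brw_exponent (Suc m) (s * exp (- (fst y + snd y)))"
      unfolding brw_exponent.simps by (rule nn_integral_quadrant) measurable
    finally show ?thesis .
  qed
  then show ?case using branching[of G n] Suc.IH[of "Suc m"] by (simp add: G_def)
qed

definition Z :: "nat \<Rightarrow> 'a \<Rightarrow> ennreal" where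
  "Z n \<omega> = (\<integral>\<^sup>+u. ennreal (exp (- (fst (brw_pos xi \<omega> u) + snd (brw_pos xi \<omega> u)))) \<partial>count_space (generation n))"

lemma measurable_Z [measurable]: "Z n \<in> borel_measurable M"
proof -
  have [measurable]: "fst \<in> borel_measurable (borel :: (real \<times> real) measure)" "snd \<in> borel_measurable (borel :: (real \<times> real) measure)"
    by (intro borel_measurable_continuous_onI continuous_intros)+
  show ?thesis unfolding Z_def by (rule measurable_generation_sum) measurable
qed

lemma brw_W_eq: "brw_W xi n \<omega> = enn2real (Z n \<omega>)"
  by (simp add: brw_W_def Z_def generation_def algebra_simps)

lemma measurable_brw_W [measurable]: "brw_W xi n \<in> borel_measurable M"
  unfolding brw_W_eq[abs_def] by measurable

lemma expm_Z: "s \<ge> 0 \<Longrightarrow> (\<integral>\<omega>. expm (ennreal s * Z n \<omega>) \<partial>M) = expm (brw_exponent n s)"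
  using expm_brw_exponent[where m=0 and s=s and n=n]
  by (simp add: Z_def nn_integral_cmult[symmetric] ennreal_mult)

lemma expm_brw_exponent_bounds:
  assumes "s \<ge> 0" shows "exp (- s) \<le> expm (brw_exponent n s)" "expm (brw_exponent n s) \<le> exp (- (s - s\<^sup>2 / 6))"
proof -
  have b: "brw_exponent n s \<le> ennreal s" "ennreal s \<le> brw_exponent n s + ennreal (s\<^sup>2 / 6)"
    using brw_exponent_bounds[OF assms] by auto
  then obtain r where r: "brw_exponent n s = ennreal r" "0 \<le> r"
    by (cases "brw_exponent n s") (auto simp: top_unique)
  then show "exp (- s) \<le> expm (brw_exponent n s)" "expm (brw_exponent n s) \<le> exp (- (s - s\<^sup>2 / 6))"
    using b assms by (auto simp: ennreal_plus[symmetric] simp del: ennreal_plus)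
qed

text \<open>\<open>brw_W\<close> reads an infinite sum as 0, so the identity for its Laplace
  transform rests on finiteness.\<close>

lemma AE_Z_finite: "AE \<omega> in M. Z n \<omega> < \<top>"
proof (rule AE_finite_of_expm)
  show "(\<lambda>k. \<integral>\<omega>. expm (ennreal (1 / real (Suc k)) * Z n \<omega>) \<partial>M) \<longlonglongrightarrow> 1"
  proof (rule tendsto_sandwich)
    show "(\<lambda>k. exp (- (1 / real (Suc k)))) \<longlonglongrightarrow> 1" by real_asymp
    show "\<forall>\<^sub>F k in sequentially. exp (- (1 / real (Suc k))) \<le> (\<integral>\<omega>. expm (ennreal (1 / real (Suc k)) * Z n \<omega>) \<partial>M)"
      by (intro always_eventually allI) (subst expm_Z, auto intro!: expm_brw_exponent_bounds)
    show "\<forall>\<^sub>F k in sequentially. (\<integral>\<omega>. expm (ennreal (1 / real (Suc k)) * Z n \<omega>) \<partial>M) \<le> 1"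
      by (subst expm_Z) auto
  qed auto
qed measurable

definition law :: "nat \<Rightarrow> real measure" where
  "law n = distr M borel (brw_W xi n)"

lemma nonneg_distribution_law: "nonneg_distribution (law n)"
  unfolding law_def by (rule nonneg_distribution_distr) (auto simp: brw_W_eq)

lemma laplace_law: "s \<ge> 0 \<Longrightarrow> laplace (law n) s = expm (brw_exponent n s)"
proof -
  assume s: "s \<ge> 0"
  have "laplace (law n) s = (\<integral>\<omega>. exp (- (s * brw_W xi n \<omega>)) \<partial>M)"
    unfolding laplace_def law_def by (subst integral_distr) auto
  also have "\<dots> = (\<integral>\<omega>. expm (ennreal s * Z n \<omega>) \<partial>M)"
  proof (rule integral_cong_AE)
    show "AE \<omega> in M. exp (- (s * brw_W xi n \<omega>)) = expm (ennreal s * Z n \<omega>)"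
      using AE_Z_finite[of n]
    proof eventually_elim
      case (elim \<omega>)
      then obtain r where "r \<ge> 0" "Z n \<omega> = ennreal r" by (cases "Z n \<omega>") auto
      then show ?case using s by (simp add: brw_W_eq ennreal_mult[symmetric])
    qed
  qed measurable
  finally show ?thesis using expm_Z[OF s] by simp
qed

lemma normalized_law: "normalized (law n)"
  unfolding normalized_def using nonneg_distribution_law expm_brw_exponent_bounds by (simp add: laplace_law)

lemma smoothing_law: "smoothing (law n) (law (Suc n))"
  unfolding smoothing_def by (simp add: laplace_law)

lemma law_0: "(\<integral>\<^sup>+x. ennreal (exp (s * x)) \<partial>law 0) = ennreal (exp s)"
proof -
  have "generation 0 = {[]}" by (auto simp: generation_def)
  then have "brw_W xi 0 \<omega> = 1" for \<omega>
    by (simp add: brw_W_eq Z_def nn_integral_count_space_finite)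
  then show ?thesis unfolding law_def
    by (subst nn_integral_distr) (auto simp: emeasure_space_1)
qed

end

section \<open>Passage to the almost sure limit\<close>

locale brw_limit = brw +
  fixes W :: "'a \<Rightarrow> real"
  assumes measurable_W [measurable]: "W \<in> borel_measurable M"
    and W_lim: "AE \<omega> in M. (\<lambda>n. brw_W xi n \<omega>) \<longlonglongrightarrow> W \<omega>"
begin

definition mu :: "real measure" where
  "mu = distr M borel W"

lemma nonneg_distribution_mu: "nonneg_distribution mu"
  unfolding mu_def
proof (rule nonneg_distribution_distr)
  show "AE \<omega> in M. 0 \<le> W \<omega>" using W_lim
    by eventually_elim (erule LIMSEQ_le_const, auto simp: brw_W_eq)
qed measurable

lemma laplace_law_lim: "s \<ge> 0 \<Longrightarrow> (\<lambda>n. laplace (law n) s) \<longlonglongrightarrow> laplace mu s"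
proof -
  assume s: "s \<ge> 0"
  have "(\<lambda>n. \<integral>\<omega>. exp (- (s * brw_W xi n \<omega>)) \<partial>M) \<longlonglongrightarrow> (\<integral>\<omega>. exp (- (s * W \<omega>)) \<partial>M)"
  proof (rule integral_dominated_convergence[where w="\<lambda>_. 1"])
    show "AE \<omega> in M. (\<lambda>n. exp (- (s * brw_W xi n \<omega>))) \<longlonglongrightarrow> exp (- (s * W \<omega>))"
      using W_lim by eventually_elim (intro tendsto_intros)
    show "AE \<omega> in M. norm (exp (- (s * brw_W xi n \<omega>))) \<le> 1" for n
      using s by (auto simp: brw_W_eq intro!: AE_I2)
  qed auto
  then show ?thesis unfolding law_def mu_def laplace_def
    by (subst (1 2) integral_distr) auto
qed

text \<open>Both bounds are uniform in n and survive the pointwise limit of the Laplace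
  transforms.\<close>

lemma normalized_mu: "normalized mu"
  unfolding normalized_def
proof (intro conjI allI impI nonneg_distribution_mu)
  fix s :: real assume s: "s \<ge> 0"
  have "exp (- s) \<le> laplace (law n) s" "laplace (law n) s \<le> exp (- (s - s\<^sup>2 / 6))" for n
    using normalized_law[of n] s unfolding normalized_def by auto
  then show "exp (- s) \<le> laplace mu s" "laplace mu s \<le> exp (- (s - s\<^sup>2 / 6))"
    by (auto intro!: LIMSEQ_le_const[OF laplace_law_lim[OF s]] LIMSEQ_le_const2[OF laplace_law_lim[OF s]])
qed

text \<open>The integrands of the recursion are dominated by s exp (- t - x), whose integral is s,
  so the recursion for the exponents passes to the limit.\<close>

lemma smoothing_mu: "smoothing mu mu"
  unfolding smoothing_def
proof (intro allI impI)
  fix s :: real assume s: "s \<ge> 0"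
  have [measurable]: "laplace mu \<in> borel_measurable borel"
    by (rule nonneg_distribution.measurable_laplace[OF nonneg_distribution_mu])
  have fs [measurable]: "fst \<in> borel_measurable (borel :: (real \<times> real) measure)" "snd \<in> borel_measurable (borel :: (real \<times> real) measure)"
    by (intro borel_measurable_continuous_onI continuous_intros)+
  have Q [measurable]: "indicator quadrant \<in> borel_measurable (borel :: (real \<times> real) measure)"
    by (intro borel_measurable_indicator sets_quadrant)
  let ?e = "\<lambda>z :: real \<times> real. s * exp (- (fst z + snd z))"
  have "(\<lambda>n. \<integral>\<^sup>+z. ennreal (1 - expm (brw_exponent n (?e z))) * indicator quadrant z \<partial>lborel) \<longlonglongrightarrow>
     (\<integral>\<^sup>+z. ennreal (1 - laplace mu (?e z)) * indicator quadrant z \<partial>lborel)"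
  proof (rule nn_integral_dominated_convergence[where w="\<lambda>z. ennreal (?e z) * indicator quadrant z"])
    show "(\<lambda>z. ennreal (1 - expm (brw_exponent n (?e z))) * indicator quadrant z) \<in> borel_measurable lborel" for n
      by (intro borel_measurable_times_ennreal) (use Q in measurable)
    show "(\<lambda>z. ennreal (1 - laplace mu (?e z)) * indicator quadrant z) \<in> borel_measurable lborel"
      by (intro borel_measurable_times_ennreal) (use Q in measurable)
    show "(\<lambda>z. ennreal (?e z) * indicator quadrant z) \<in> borel_measurable lborel"
      by (intro borel_measurable_times_ennreal) (use Q in measurable)
    have "(\<integral>\<^sup>+z. ennreal (?e z) * indicator quadrant z \<partial>lborel) = quad_integral (\<lambda>t. ennreal (s * exp (- t)))"
      by (rule nn_integral_quadrant) measurable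
    also have "\<dots> = ennreal s" using quad_integral_exp[of 1 s] s by simp
    finally show "(\<integral>\<^sup>+z. ennreal (?e z) * indicator quadrant z \<partial>lborel) < \<infinity>" by simp
    show "AE z in lborel. ennreal (1 - expm (brw_exponent n (?e z))) * indicator quadrant z \<le> ennreal (?e z) * indicator quadrant z" for n
    proof (intro AE_I2 mult_right_mono ennreal_leI)
      fix z
      have "exp (- (?e z)) \<le> expm (brw_exponent n (?e z))" using s by (intro expm_brw_exponent_bounds) auto
      then show "1 - expm (brw_exponent n (?e z)) \<le> ?e z" using one_minus_exp_le[of "?e z"] by linarith
    qed auto
    show "AE z in lborel. (\<lambda>n. ennreal (1 - expm (brw_exponent n (?e z))) * indicator quadrant z) \<longlonglongrightarrow> ennreal (1 - laplace mu (?e z)) * indicator quadrant z"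
    proof (rule AE_I2)
      fix z :: "real \<times> real"
      have "(\<lambda>n. expm (brw_exponent n (?e z))) \<longlonglongrightarrow> laplace mu (?e z)"
        using laplace_law_lim[of "?e z"] s by (simp add: laplace_law)
      then have "(\<lambda>n. ennreal (1 - expm (brw_exponent n (?e z)))) \<longlonglongrightarrow> ennreal (1 - laplace mu (?e z))"
        by (intro tendsto_ennrealI tendsto_intros)
      then show "(\<lambda>n. ennreal (1 - expm (brw_exponent n (?e z))) * indicator quadrant z) \<longlonglongrightarrow> ennreal (1 - laplace mu (?e z)) * indicator quadrant z"
        by (cases "z \<in> quadrant") auto
    qed
  qed
  also have "(\<integral>\<^sup>+z. ennreal (1 - laplace mu (?e z)) * indicator quadrant z \<partial>lborel) = quad_integral (\<lambda>t. ennreal (1 - laplace mu (s * exp (- t))))"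
    by (rule nn_integral_quadrant) measurable
  also have "(\<lambda>n. \<integral>\<^sup>+z. ennreal (1 - expm (brw_exponent n (?e z))) * indicator quadrant z \<partial>lborel) = (\<lambda>n. brw_exponent (Suc n) s)"
    unfolding brw_exponent.simps by (rule ext, rule nn_integral_quadrant) measurable
  finally have "(\<lambda>n. expm (brw_exponent (Suc n) s)) \<longlonglongrightarrow> expm (quad_integral (\<lambda>t. ennreal (1 - laplace mu (s * exp (- t)))))"
    by (rule tendsto_expm)
  moreover have "(\<lambda>n. expm (brw_exponent (Suc n) s)) \<longlonglongrightarrow> laplace mu s"
    using LIMSEQ_Suc[OF laplace_law_lim[OF s]] s by (simp add: laplace_law del: brw_exponent.simps)
  ultimately show "laplace mu s = expm (quad_integral (\<lambda>t. ennreal (1 - laplace mu (s * exp (- t)))))"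
    using LIMSEQ_unique by blast
qed

text \<open>Fatou's lemma along the generations.\<close>

lemma exp_moment_le:
  assumes "\<And>n. (\<integral>\<^sup>+x. ennreal (exp (s * x)) \<partial>law n) \<le> C"
  shows "(\<integral>\<^sup>+x. ennreal (exp (s * x)) \<partial>mu) \<le> C"
proof -
  have "(\<integral>\<^sup>+x. ennreal (exp (s * x)) \<partial>mu) = (\<integral>\<^sup>+\<omega>. ennreal (exp (s * W \<omega>)) \<partial>M)"
    unfolding mu_def by (subst nn_integral_distr) auto
  also have "\<dots> = (\<integral>\<^sup>+\<omega>. liminf (\<lambda>n. ennreal (exp (s * brw_W xi n \<omega>))) \<partial>M)"
  proof (rule nn_integral_cong_AE)
    show "AE \<omega> in M. ennreal (exp (s * W \<omega>)) = liminf (\<lambda>n. ennreal (exp (s * brw_W xi n \<omega>)))"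
      using W_lim
    proof eventually_elim
      case (elim \<omega>)
      then have "(\<lambda>n. ennreal (exp (s * brw_W xi n \<omega>))) \<longlonglongrightarrow> ennreal (exp (s * W \<omega>))"
        by (intro tendsto_ennrealI tendsto_intros)
      then show ?case by (rule lim_imp_Liminf[OF sequentially_bot, symmetric])
    qed
  qed
  also have "\<dots> \<le> liminf (\<lambda>n. \<integral>\<^sup>+\<omega>. ennreal (exp (s * brw_W xi n \<omega>)) \<partial>M)"
    by (rule nn_integral_liminf) measurable
  also have "\<dots> \<le> C"
  proof -
    have "(\<integral>\<^sup>+\<omega>. ennreal (exp (s * brw_W xi n \<omega>)) \<partial>M) \<le> C" for n
      using assms[of n] unfolding law_def by (subst (asm) nn_integral_distr) auto
    then have "liminf (\<lambda>n. \<integral>\<^sup>+\<omega>. ennreal (exp (s * brw_W xi n \<omega>)) \<partial>M) \<le> liminf (\<lambda>n::nat. C)"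
      by (intro Liminf_mono) auto
    then show ?thesis by (simp add: Liminf_const)
  qed
  finally show ?thesis .
qed

end

section \<open>The size-bias equation\<close>

lemma AE_lborel_neq: "AE x in lborel. x \<noteq> (c::real)"
  using AE_lborel_singleton[of c] by auto

lemma nn_integral_Ioo_FTC:
  assumes [measurable]: "f \<in> borel_measurable borel"
  assumes f: "\<And>x. x \<in> {a..b} \<Longrightarrow> DERIV F x :> f x" "\<And>x. x \<in> {a..b} \<Longrightarrow> 0 \<le> f x" and "a \<le> b"
  shows "(\<integral>\<^sup>+x. ennreal (f x) * indicator {a<..<b} x \<partial>lborel) = ennreal (F b - F a)"
proof -
  have "(\<integral>\<^sup>+x. ennreal (f x) * indicator {a<..<b} x \<partial>lborel) = (\<integral>\<^sup>+x. ennreal (f x) * indicator {a..b} x \<partial>lborel)"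
    by (rule nn_integral_cong_AE) (use AE_lborel_neq[of a] AE_lborel_neq[of b] in \<open>eventually_elim, auto simp: indicator_def\<close>)
  then show ?thesis using nn_integral_FTC_Icc[of f a b F] assms by simp
qed

definition tail :: "real measure \<Rightarrow> real \<Rightarrow> real" where
  "tail N z = measure N {z<..}"

definition levy_nn :: "real measure \<Rightarrow> real \<Rightarrow> ennreal" where
  "levy_nn N y = (\<integral>\<^sup>+z. ennreal (tail N z / z) * indicator {y<..} z \<partial>lborel)"

text \<open>The Levy density of the smoothed law is \<open>levy N z / z\<close>. The value 0 on the
  nonpositive half line spares integrals over \<open>lborel\<close> an indicator;
  \<open>levy_nn\<close> is the extended version on which Tonelli operates.\<close>

definition levy :: "real measure \<Rightarrow> real \<Rightarrow> real" where
  "levy N y = (if y > 0 then enn2real (levy_nn N y) else 0)"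

context nonneg_distribution
begin

lemma tail_nonneg [simp]: "0 \<le> tail N z" and tail_le_1: "tail N z \<le> 1"
  by (auto simp: tail_def)

lemma tail_antimono: "z \<le> z' \<Longrightarrow> tail N z' \<le> tail N z"
  unfolding tail_def by (intro finite_measure_mono) auto

lemma measurable_tail [measurable]: "tail N \<in> borel_measurable borel"
proof -
  have "mono (\<lambda>z. - tail N z)" by (auto simp: mono_def tail_antimono)
  then have "(\<lambda>z. - tail N z) \<in> borel_measurable borel" by (rule borel_measurable_mono)
  then show ?thesis by simp
qed

lemma tail_eq_nn: "ennreal (tail N z) = (\<integral>\<^sup>+x. indicator {z<..} x \<partial>N)"
  by (simp add: tail_def emeasure_eq_measure)

sublocale PL: pair_sigma_finite lborel N ..

lemma layer_cake:
  assumes [measurable]: "w \<in> borel_measurable borel"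
  shows "(\<integral>\<^sup>+x. (\<integral>\<^sup>+z. w z * indicator {0<..<x} z \<partial>lborel) \<partial>N) = (\<integral>\<^sup>+z. w z * indicator {0<..} z * ennreal (tail N z) \<partial>lborel)"
proof -
  have "(\<lambda>(z, x). w z * indicator {0<..} z * (if z < x then 1 else 0 :: ennreal)) \<in> borel_measurable (lborel \<Otimes>\<^sub>M N)"
    by measurable
  then have m: "(\<lambda>(z, x). w z * indicator {0<..} z * indicator {z<..} x) \<in> borel_measurable (lborel \<Otimes>\<^sub>M N)"
    by (simp add: indicator_def)
  have "(\<integral>\<^sup>+x. (\<integral>\<^sup>+z. w z * indicator {0<..<x} z \<partial>lborel) \<partial>N) = (\<integral>\<^sup>+x. \<integral>\<^sup>+z. w z * indicator {0<..} z * indicator {z<..} x \<partial>lborel \<partial>N)"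
    by (intro nn_integral_cong) (auto split: split_indicator)
  also have "\<dots> = (\<integral>\<^sup>+z. (\<integral>\<^sup>+x. w z * indicator {0<..} z * indicator {z<..} x \<partial>N) \<partial>lborel)"
    by (rule PL.Fubini'[OF m])
  also have "\<dots> = (\<integral>\<^sup>+z. w z * indicator {0<..} z * ennreal (tail N z) \<partial>lborel)"
    by (intro nn_integral_cong) (simp add: nn_integral_cmult tail_eq_nn)
  finally show ?thesis .
qed

lemma levy_tonelli:
  assumes [measurable]: "w \<in> borel_measurable borel"
  shows "(\<integral>\<^sup>+y. w y * indicator {0<..} y * levy_nn N y \<partial>lborel)
    = (\<integral>\<^sup>+z. ennreal (tail N z / z) * indicator {0<..} z * (\<integral>\<^sup>+y. w y * indicator {0<..<z} y \<partial>lborel) \<partial>lborel)"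
proof -
  have "(\<integral>\<^sup>+y. w y * indicator {0<..} y * levy_nn N y \<partial>lborel)
     = (\<integral>\<^sup>+y. \<integral>\<^sup>+z. w y * indicator {0<..} y * (ennreal (tail N z / z) * indicator {y<..} z) \<partial>lborel \<partial>lborel)"
    unfolding levy_nn_def by (intro nn_integral_cong nn_integral_cmult[symmetric]) measurable
  also have "\<dots> = (\<integral>\<^sup>+z. \<integral>\<^sup>+y. w y * indicator {0<..} y * (ennreal (tail N z / z) * indicator {y<..} z) \<partial>lborel \<partial>lborel)"
  proof (rule lborel_pair.Fubini')
    have "(\<lambda>(z, y). w y * indicator {0<..} y * (ennreal (tail N z / z) * (if y < z then 1 else 0 :: ennreal))) \<in> borel_measurable (lborel \<Otimes>\<^sub>M lborel)"
      by measurable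
    then show "(\<lambda>(z, y). w y * indicator {0<..} y * (ennreal (tail N z / z) * indicator {y<..} z)) \<in> borel_measurable (lborel \<Otimes>\<^sub>M lborel)"
      by (simp add: indicator_def)
  qed
  also have "\<dots> = (\<integral>\<^sup>+z. ennreal (tail N z / z) * indicator {0<..} z * (\<integral>\<^sup>+y. w y * indicator {0<..<z} y \<partial>lborel) \<partial>lborel)"
  proof (rule nn_integral_cong)
    fix z
    have "(\<integral>\<^sup>+y. w y * indicator {0<..} y * (ennreal (tail N z / z) * indicator {y<..} z) \<partial>lborel)
      = (\<integral>\<^sup>+y. ennreal (tail N z / z) * indicator {0<..} z * (w y * indicator {0<..<z} y) \<partial>lborel)"
      by (rule nn_integral_cong) (auto split: split_indicator simp: mult_ac)
    then show "(\<integral>\<^sup>+y. w y * indicator {0<..} y * (ennreal (tail N z / z) * indicator {y<..} z) \<partial>lborel)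
      = ennreal (tail N z / z) * indicator {0<..} z * (\<integral>\<^sup>+y. w y * indicator {0<..<z} y \<partial>lborel)"
      by (simp add: nn_integral_cmult)
  qed
  finally show ?thesis .
qed

lemma one_minus_laplace:
  assumes s: "s > 0"
  shows "ennreal (1 - laplace N s) = (\<integral>\<^sup>+z. ennreal (s * exp (- (s * z))) * indicator {0<..} z * ennreal (tail N z) \<partial>lborel)"
proof -
  have "ennreal (1 - laplace N s) = ennreal (\<integral>x. 1 - exp (- (s * x)) \<partial>N)"
    unfolding laplace_def using s by (subst Bochner_Integration.integral_diff) (auto intro: integrable_exp_neg)
  also have "\<dots> = (\<integral>\<^sup>+x. ennreal (1 - exp (- (s * x))) \<partial>N)"
    using s by (intro nn_integral_eq_integral[symmetric]) (use AE_nonneg in \<open>auto intro!: Bochner_Integration.integrable_diff integrable_exp_neg elim!: eventually_mono\<close>)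
  also have "\<dots> = (\<integral>\<^sup>+x. (\<integral>\<^sup>+z. ennreal (s * exp (- (s * z))) * indicator {0<..<x} z \<partial>lborel) \<partial>N)"
  proof (rule nn_integral_cong_AE)
    show "AE x in N. ennreal (1 - exp (- (s * x))) = (\<integral>\<^sup>+z. ennreal (s * exp (- (s * z))) * indicator {0<..<x} z \<partial>lborel)"
      using AE_nonneg
    proof eventually_elim
      case (elim x)
      show ?case using s elim
        by (subst nn_integral_Ioo_FTC[where F="\<lambda>z. - exp (- (s * z))"]) (auto intro!: derivative_eq_intros)
    qed
  qed
  finally show ?thesis by (simp add: layer_cake)
qed

lemma exp_moment_eq:
  assumes s: "s > 0"
  shows "(\<integral>\<^sup>+x. ennreal (exp (s * x)) \<partial>N) = 1 + (\<integral>\<^sup>+z. ennreal (s * exp (s * z)) * indicator {0<..} z * ennreal (tail N z) \<partial>lborel)"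
proof -
  have "(\<integral>\<^sup>+x. ennreal (exp (s * x)) \<partial>N) = (\<integral>\<^sup>+x. 1 + ennreal (exp (s * x) - 1) \<partial>N)"
  proof (rule nn_integral_cong_AE)
    show "AE x in N. ennreal (exp (s * x)) = 1 + ennreal (exp (s * x) - 1)"
      using AE_nonneg by eventually_elim (use s in \<open>simp add: ennreal_1[symmetric] ennreal_plus[symmetric] del: ennreal_1 ennreal_plus\<close>)
  qed
  also have "\<dots> = 1 + (\<integral>\<^sup>+x. ennreal (exp (s * x) - 1) \<partial>N)"
    using emeasure_space_1 by (subst nn_integral_add) auto
  also have "(\<integral>\<^sup>+x. ennreal (exp (s * x) - 1) \<partial>N) = (\<integral>\<^sup>+x. (\<integral>\<^sup>+z. ennreal (s * exp (s * z)) * indicator {0<..<x} z \<partial>lborel) \<partial>N)"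
  proof (rule nn_integral_cong_AE)
    show "AE x in N. ennreal (exp (s * x) - 1) = (\<integral>\<^sup>+z. ennreal (s * exp (s * z)) * indicator {0<..<x} z \<partial>lborel)"
      using AE_nonneg
    proof eventually_elim
      case (elim x)
      show ?case using s elim
        by (subst nn_integral_Ioo_FTC[where F="\<lambda>z. exp (s * z)"]) (auto intro!: derivative_eq_intros)
    qed
  qed
  finally show ?thesis by (simp add: layer_cake)
qed

end

text \<open>The inner integrand is the t-derivative of exp (- s exp (- t) y) / y. Each of the two
  half-line integrations behind \<open>quad_integral\<close> is one application: with \<rho> the
  tail, and then with \<rho> = \<open>levy_nn N\<close>.\<close>

lemma exp_half_line_tonelli:
  fixes \<rho> :: "real \<Rightarrow> ennreal"
  assumes [measurable]: "\<rho> \<in> borel_measurable borel" and s: "s > 0"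
  shows "(\<integral>\<^sup>+t. (\<integral>\<^sup>+y. ennreal (s * exp (- t) * exp (- (s * exp (- t) * y))) * indicator {0<..} y * \<rho> y \<partial>lborel) * indicator {0<..} t \<partial>lborel)
    = (\<integral>\<^sup>+y. ennreal ((1 - exp (- (s * y))) / y) * indicator {0<..} y * \<rho> y \<partial>lborel)"
proof -
  have "(\<integral>\<^sup>+t. (\<integral>\<^sup>+y. ennreal (s * exp (- t) * exp (- (s * exp (- t) * y))) * indicator {0<..} y * \<rho> y \<partial>lborel) * indicator {0<..} t \<partial>lborel)
   = (\<integral>\<^sup>+t. (\<integral>\<^sup>+y. ennreal (s * exp (- t) * exp (- (s * exp (- t) * y))) * indicator {0<..} y * \<rho> y * indicator {0<..} t \<partial>lborel) \<partial>lborel)"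
    by (intro nn_integral_cong nn_integral_multc[symmetric]) measurable
  also have "\<dots> = (\<integral>\<^sup>+y. (\<integral>\<^sup>+t. ennreal (s * exp (- t) * exp (- (s * exp (- t) * y))) * indicator {0<..} y * \<rho> y * indicator {0<..} t \<partial>lborel) \<partial>lborel)"
    by (rule lborel_pair.Fubini') measurable
  also have "\<dots> = (\<integral>\<^sup>+y. ennreal ((1 - exp (- (s * y))) / y) * indicator {0<..} y * \<rho> y \<partial>lborel)"
  proof (rule nn_integral_cong)
    fix y :: real
    show "(\<integral>\<^sup>+t. ennreal (s * exp (- t) * exp (- (s * exp (- t) * y))) * indicator {0<..} y * \<rho> y * indicator {0<..} t \<partial>lborel)
      = ennreal ((1 - exp (- (s * y))) / y) * indicator {0<..} y * \<rho> y"
    proof (cases "y > 0")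
      case True
      have "(\<integral>\<^sup>+t. ennreal (s * exp (- t) * exp (- (s * exp (- t) * y))) * indicator {0<..} y * \<rho> y * indicator {0<..} t \<partial>lborel)
        = (\<integral>\<^sup>+t. ennreal (s * exp (- t) * exp (- (s * exp (- t) * y))) * indicator {0..} t * \<rho> y \<partial>lborel)"
        by (rule nn_integral_cong_AE) (use AE_lborel_neq[of 0] True in \<open>auto elim!: eventually_mono simp: indicator_def\<close>)
      also have "\<dots> = (\<integral>\<^sup>+t. ennreal (s * exp (- t) * exp (- (s * exp (- t) * y))) * indicator {0..} t \<partial>lborel) * \<rho> y"
        by (rule nn_integral_multc) measurable
      also have "(\<integral>\<^sup>+t. ennreal (s * exp (- t) * exp (- (s * exp (- t) * y))) * indicator {0..} t \<partial>lborel)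
         = ennreal (1 / y - exp (- (s * exp (- 0) * y)) / y)"
      proof (rule nn_integral_FTC_atLeast)
        show "((\<lambda>t. exp (- (s * exp (- t) * y)) / y) has_real_derivative s * exp (- x) * exp (- (s * exp (- x) * y))) (at x)" for x
          using True by (auto intro!: derivative_eq_intros)
        have "((\<lambda>t. exp (- (s * exp (- t) * y))) \<longlongrightarrow> 1) at_top"
          using True s by real_asymp
        then show "((\<lambda>t. exp (- (s * exp (- t) * y)) / y) \<longlongrightarrow> 1 / y) at_top"
          using True by (intro tendsto_divide tendsto_const) auto
      qed (use s in auto)
      finally have fin: "(\<integral>\<^sup>+t. ennreal (s * exp (- t) * exp (- (s * exp (- t) * y))) * indicator {0<..} y * \<rho> y * indicator {0<..} t \<partial>lborel)
        = ennreal (1 / y - exp (- (s * exp (- 0) * y)) / y) * \<rho> y" .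
      have "1 / y - exp (- (s * exp (- 0) * y)) / y = (1 - exp (- (s * y))) / y" by (simp add: diff_divide_distrib)
      moreover have "indicator {0<..} y = (1::ennreal)" using True by simp
      ultimately show ?thesis using fin by (simp only: mult_1_right)
    qed simp
  qed
  finally show ?thesis .
qed

locale normalized_distribution = nonneg_distribution N for N +
  assumes norm_lower: "s \<ge> 0 \<Longrightarrow> exp (- s) \<le> laplace N s"
    and norm_upper: "s \<ge> 0 \<Longrightarrow> laplace N s \<le> exp (- (s - s\<^sup>2 / 6))"
begin

text \<open>The quotients (1 - \<open>laplace N s\<close>) / s at s = 1/(n+1) increase to this
  integral, and the two normalisation bounds squeeze them to 1.\<close>

lemma mean_tail: "(\<integral>\<^sup>+z. indicator {0<..} z * ennreal (tail N z) \<partial>lborel) = 1"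
proof -
  define f where "f n z = ennreal (exp (- (1 / real (Suc n) * z))) * indicator {0<..} z * ennreal (tail N z)" for n z
  have eq: "(\<integral>\<^sup>+z. f n z \<partial>lborel) = ennreal (real (Suc n) * (1 - laplace N (1 / real (Suc n))))" for n
  proof -
    have "ennreal (real (Suc n)) * ennreal (1 - laplace N (1 / real (Suc n)))
      = (\<integral>\<^sup>+z. ennreal (real (Suc n)) * (ennreal (1 / real (Suc n) * exp (- (1 / real (Suc n) * z))) * indicator {0<..} z * ennreal (tail N z)) \<partial>lborel)"
      by (subst one_minus_laplace, simp, subst nn_integral_cmult) auto
    also have "\<dots> = (\<integral>\<^sup>+z. f n z \<partial>lborel)"
      unfolding f_def mult.assoc[symmetric] by (intro nn_integral_cong) (simp add: ennreal_mult[symmetric] del: of_nat_Suc)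
    finally show ?thesis using laplace_le_1[of "1 / real (Suc n)"] by (simp add: ennreal_mult[symmetric] del: of_nat_Suc)
  qed
  have "(\<lambda>n. \<integral>\<^sup>+z. f n z \<partial>lborel) \<longlonglongrightarrow> (\<integral>\<^sup>+z. indicator {0<..} z * ennreal (tail N z) \<partial>lborel)"
  proof (rule nn_integral_LIMSEQ)
    show "incseq f"
    proof (intro incseq_SucI le_funI)
      fix n z
      show "f n z \<le> f (Suc n) z"
      proof (cases "z > 0")
        case True
        have "1 / real (Suc (Suc n)) * z \<le> 1 / real (Suc n) * z"
          using True by (intro mult_right_mono divide_left_mono) auto
        then show ?thesis using True unfolding f_def by (intro mult_right_mono ennreal_leI) auto
      qed (simp add: f_def)
    qed
    show "(\<lambda>n. f n z) \<longlonglongrightarrow> indicator {0<..} z * ennreal (tail N z)" for z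
    proof -
      have "(\<lambda>n. exp (- (1 / real (Suc n) * z))) \<longlonglongrightarrow> 1" by real_asymp
      then have "(\<lambda>n. ennreal (exp (- (1 / real (Suc n) * z)) * (indicator {0<..} z * tail N z))) \<longlonglongrightarrow> ennreal (1 * (indicator {0<..} z * tail N z))"
        by (intro tendsto_ennrealI tendsto_mult tendsto_const)
      moreover have "ennreal (exp (- (1 / real (Suc n) * z)) * (indicator {0<..} z * tail N z)) = f n z" for n
        by (auto simp: f_def indicator_def ennreal_mult)
      ultimately have "(\<lambda>n. f n z) \<longlonglongrightarrow> ennreal (indicator {0<..} z * tail N z)"
        by (simp only: mult_1)
      then show ?thesis by (cases "z > 0") auto
    qed
  qed (auto simp: f_def)
  moreover have "(\<lambda>n. \<integral>\<^sup>+z. f n z \<partial>lborel) \<longlonglongrightarrow> ennreal 1"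
    unfolding eq
  proof (rule tendsto_ennrealI, rule tendsto_sandwich)
    show "(\<lambda>n. real (Suc n) * (1 - exp (- (1 / real (Suc n) - (1 / real (Suc n))\<^sup>2 / 6)))) \<longlonglongrightarrow> 1" by real_asymp
    show "\<forall>\<^sub>F n in sequentially. real (Suc n) * (1 - exp (- (1 / real (Suc n) - (1 / real (Suc n))\<^sup>2 / 6))) \<le> real (Suc n) * (1 - laplace N (1 / real (Suc n)))"
      by (intro always_eventually allI mult_left_mono diff_left_mono norm_upper) auto
    show "\<forall>\<^sub>F n in sequentially. real (Suc n) * (1 - laplace N (1 / real (Suc n))) \<le> 1"
    proof (intro always_eventually allI)
      fix n
      have "1 - laplace N (1 / real (Suc n)) \<le> 1 / real (Suc n)"
        using norm_lower[of "1 / real (Suc n)"] one_minus_exp_le[of "1 / real (Suc n)"] by simp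
      then have "real (Suc n) * (1 - laplace N (1 / real (Suc n))) \<le> real (Suc n) * (1 / real (Suc n))"
        by (intro mult_left_mono) auto
      then show "real (Suc n) * (1 - laplace N (1 / real (Suc n))) \<le> 1" by simp
    qed
  qed auto
  ultimately have "(\<integral>\<^sup>+z. indicator {0<..} z * ennreal (tail N z) \<partial>lborel) = ennreal 1"
    by (rule LIMSEQ_unique)
  then show ?thesis by simp
qed

lemma mean: "(\<integral>\<^sup>+x. ennreal x \<partial>N) = 1"
proof -
  have "(\<integral>\<^sup>+x. ennreal x \<partial>N) = (\<integral>\<^sup>+x. (\<integral>\<^sup>+z. 1 * indicator {0<..<x} z \<partial>lborel) \<partial>N)"
    by (rule nn_integral_cong_AE) (use AE_nonneg in \<open>auto elim!: eventually_mono\<close>)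
  also have "\<dots> = 1" using layer_cake[of "\<lambda>_. 1"] mean_tail by simp
  finally show ?thesis .
qed

lemma levy_nn_finite: "y > 0 \<Longrightarrow> levy_nn N y < \<top>"
proof -
  assume y: "y > 0"
  have "levy_nn N y \<le> (\<integral>\<^sup>+z. ennreal (1 / y) * (indicator {0<..} z * ennreal (tail N z)) \<partial>lborel)"
    unfolding levy_nn_def
  proof (rule nn_integral_mono)
    fix z :: real
    have "tail N z / z \<le> 1 / y * tail N z" if "y < z"
      using y that by (simp add: field_simps mult_right_mono)
    then show "ennreal (tail N z / z) * indicator {y<..} z \<le> ennreal (1 / y) * (indicator {0<..} z * ennreal (tail N z))"
      using y by (auto simp: indicator_def ennreal_mult[symmetric] intro!: ennreal_leI)
  qed
  also have "\<dots> = ennreal (1 / y)" by (subst nn_integral_cmult) (auto simp: mean_tail)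
  finally show ?thesis by (simp add: le_less_trans)
qed

lemma levy_nonneg [simp]: "0 \<le> levy N y" by (simp add: levy_def)

lemma levy_eq: "y > 0 \<Longrightarrow> ennreal (levy N y) = levy_nn N y"
  using levy_nn_finite by (simp add: levy_def)

lemma measurable_levy_nn [measurable]: "levy_nn N \<in> borel_measurable borel"
proof -
  have "(\<lambda>y. \<integral>\<^sup>+z. ennreal (tail N z / z) * (if y < z then 1 else 0) \<partial>lborel) \<in> borel_measurable borel"
    by measurable
  then show ?thesis unfolding levy_nn_def[abs_def] by (simp add: indicator_def)
qed

lemma measurable_levy [measurable]: "levy N \<in> borel_measurable borel"
  unfolding levy_def[abs_def] by measurable

lemma levy_nn_eq: "indicator {0<..} y * levy_nn N y = ennreal (levy N y)"
  by (cases "y > 0") (auto simp: levy_eq, simp add: levy_def)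

lemma levy_antimono: "0 < y \<Longrightarrow> y \<le> y' \<Longrightarrow> levy N y' \<le> levy N y"
proof -
  assume y: "0 < y" "y \<le> y'"
  have "levy_nn N y' \<le> levy_nn N y" unfolding levy_nn_def
    by (intro nn_integral_mono) (use y in \<open>auto simp: indicator_def\<close>)
  then have "ennreal (levy N y') \<le> ennreal (levy N y)" using y by (simp add: levy_eq)
  then show ?thesis by (simp add: ennreal_le_iff)
qed

text \<open>By Tonelli the integral of \<open>levy N\<close> equals that of the tail, which is the
  mean. So \<open>levy N\<close> is a probability density, and the size-bias equation becomes a
  convolution of laws.\<close>

lemma levy_integral: "(\<integral>\<^sup>+y. ennreal (levy N y) \<partial>lborel) = 1"
proof -
  have "(\<integral>\<^sup>+y. ennreal (levy N y) \<partial>lborel) = (\<integral>\<^sup>+y. 1 * indicator {0<..} y * levy_nn N y \<partial>lborel)"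
    by (simp add: levy_nn_eq)
  also have "\<dots> = (\<integral>\<^sup>+z. ennreal (tail N z / z) * indicator {0<..} z * (\<integral>\<^sup>+y. 1 * indicator {0<..<z} y \<partial>lborel) \<partial>lborel)"
    by (rule levy_tonelli) simp
  also have "\<dots> = (\<integral>\<^sup>+z. indicator {0<..} z * ennreal (tail N z) \<partial>lborel)"
  proof (rule nn_integral_cong)
    fix z :: real
    show "ennreal (tail N z / z) * indicator {0<..} z * (\<integral>\<^sup>+y. 1 * indicator {0<..<z} y \<partial>lborel) = indicator {0<..} z * ennreal (tail N z)"
      by (cases "z > 0") (simp_all add: ennreal_mult[symmetric])
  qed
  finally show ?thesis using mean_tail by simp
qed

lemma levy_exp_integral:
  assumes s: "s > 0"
  shows "(\<integral>\<^sup>+y. ennreal (s * exp (s * y)) * ennreal (levy N y) \<partial>lborel)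
    = (\<integral>\<^sup>+z. ennreal ((exp (s * z) - 1) / z) * indicator {0<..} z * ennreal (tail N z) \<partial>lborel)"
proof -
  have "(\<integral>\<^sup>+y. ennreal (s * exp (s * y)) * ennreal (levy N y) \<partial>lborel) = (\<integral>\<^sup>+y. ennreal (s * exp (s * y)) * indicator {0<..} y * levy_nn N y \<partial>lborel)"
    by (simp add: levy_nn_eq mult.assoc)
  also have "\<dots> = (\<integral>\<^sup>+z. ennreal (tail N z / z) * indicator {0<..} z * (\<integral>\<^sup>+y. ennreal (s * exp (s * y)) * indicator {0<..<z} y \<partial>lborel) \<partial>lborel)"
    by (rule levy_tonelli) measurable
  also have "\<dots> = (\<integral>\<^sup>+z. ennreal ((exp (s * z) - 1) / z) * indicator {0<..} z * ennreal (tail N z) \<partial>lborel)"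
  proof (rule nn_integral_cong)
    fix z :: real
    show "ennreal (tail N z / z) * indicator {0<..} z * (\<integral>\<^sup>+y. ennreal (s * exp (s * y)) * indicator {0<..<z} y \<partial>lborel)
       = ennreal ((exp (s * z) - 1) / z) * indicator {0<..} z * ennreal (tail N z)"
    proof (cases "z > 0")
      case True
      then have "(\<integral>\<^sup>+y. ennreal (s * exp (s * y)) * indicator {0<..<z} y \<partial>lborel) = ennreal (exp (s * z) - exp (s * 0))"
        using s by (intro nn_integral_Ioo_FTC) (auto intro!: derivative_eq_intros)
      then show ?thesis using True s by (simp add: ennreal_mult[symmetric])
    qed simp
  qed
  finally show ?thesis .
qed

text \<open>This is the Levy-Khintchine form: the exponent of the smoothed law belongs to the Levy
  density \<open>levy N y / y\<close>. The first half-line integration turns the tail into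
  \<open>levy_nn\<close>, the second one divides by y.\<close>

lemma quad_integral_laplace:
  assumes s: "s > 0"
  shows "quad_integral (\<lambda>t. ennreal (1 - laplace N (s * exp (- t)))) = (\<integral>\<^sup>+y. ennreal ((1 - exp (- (s * y))) / y * levy N y) \<partial>lborel)"
proof -
  have inner: "(\<integral>\<^sup>+x. ennreal (1 - laplace N (s' * exp (- x))) * indicator {0<..} x \<partial>lborel)
     = (\<integral>\<^sup>+y. ennreal (s' * exp (- (s' * y))) * indicator {0<..} y * levy_nn N y \<partial>lborel)" if s': "s' > 0" for s'
  proof -
    have "(\<integral>\<^sup>+x. ennreal (1 - laplace N (s' * exp (- x))) * indicator {0<..} x \<partial>lborel)
      = (\<integral>\<^sup>+x. (\<integral>\<^sup>+y. ennreal (s' * exp (- x) * exp (- (s' * exp (- x) * y))) * indicator {0<..} y * ennreal (tail N y) \<partial>lborel) * indicator {0<..} x \<partial>lborel)"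
      using s' by (intro nn_integral_cong) (simp add: one_minus_laplace)
    also have "\<dots> = (\<integral>\<^sup>+y. ennreal ((1 - exp (- (s' * y))) / y) * indicator {0<..} y * ennreal (tail N y) \<partial>lborel)"
      by (rule exp_half_line_tonelli) (use s' in auto)
    also have "\<dots> = (\<integral>\<^sup>+z. ennreal (tail N z / z) * indicator {0<..} z * (\<integral>\<^sup>+y. ennreal (s' * exp (- (s' * y))) * indicator {0<..<z} y \<partial>lborel) \<partial>lborel)"
    proof (rule nn_integral_cong)
      fix z :: real
      show "ennreal ((1 - exp (- (s' * z))) / z) * indicator {0<..} z * ennreal (tail N z)
        = ennreal (tail N z / z) * indicator {0<..} z * (\<integral>\<^sup>+y. ennreal (s' * exp (- (s' * y))) * indicator {0<..<z} y \<partial>lborel)"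
      proof (cases "z > 0")
        case True
        then have "(\<integral>\<^sup>+y. ennreal (s' * exp (- (s' * y))) * indicator {0<..<z} y \<partial>lborel) = ennreal ((- exp (- (s' * z))) - (- exp (- (s' * 0))))"
          using s' by (intro nn_integral_Ioo_FTC) (auto intro!: derivative_eq_intros)
        then show ?thesis using True s' by (simp add: ennreal_mult[symmetric])
      qed simp
    qed
    also have "\<dots> = (\<integral>\<^sup>+y. ennreal (s' * exp (- (s' * y))) * indicator {0<..} y * levy_nn N y \<partial>lborel)"
      by (rule levy_tonelli[symmetric]) measurable
    finally show ?thesis .
  qed
  have "quad_integral (\<lambda>t. ennreal (1 - laplace N (s * exp (- t))))
     = (\<integral>\<^sup>+t. (\<integral>\<^sup>+y. ennreal (s * exp (- t) * exp (- (s * exp (- t) * y))) * indicator {0<..} y * levy_nn N y \<partial>lborel) * indicator {0<..} t \<partial>lborel)"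
  proof -
    have "(\<integral>\<^sup>+x. ennreal (1 - laplace N (s * exp (- (t + x)))) * indicator {0<..} x \<partial>lborel)
      = (\<integral>\<^sup>+y. ennreal (s * exp (- t) * exp (- (s * exp (- t) * y))) * indicator {0<..} y * levy_nn N y \<partial>lborel)" for t
    proof -
      have "s * exp (- (t + x)) = (s * exp (- t)) * exp (- x)" for x
        by (simp add: exp_add[symmetric] mult.assoc)
      then show ?thesis using inner[of "s * exp (- t)"] s by (simp only:) simp
    qed
    then show ?thesis unfolding quad_integral_def by simp
  qed
  also have "\<dots> = (\<integral>\<^sup>+y. ennreal ((1 - exp (- (s * y))) / y) * indicator {0<..} y * levy_nn N y \<partial>lborel)"
    by (rule exp_half_line_tonelli) (use s in auto)
  also have "\<dots> = (\<integral>\<^sup>+y. ennreal ((1 - exp (- (s * y))) / y * levy N y) \<partial>lborel)"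
  proof (intro nn_integral_cong)
    fix y :: real
    show "ennreal ((1 - exp (- (s * y))) / y) * indicator {0<..} y * levy_nn N y = ennreal ((1 - exp (- (s * y))) / y * levy N y)"
    proof (cases "y > 0")
      case True
      then show ?thesis using s by (subst ennreal_mult) (auto simp: levy_eq)
    qed (auto simp: levy_def)
  qed
  finally show ?thesis .
qed

definition levy_measure :: "real measure" where
  "levy_measure = density lborel (\<lambda>y. ennreal (levy N y))"

lemma nonneg_distribution_levy: "nonneg_distribution levy_measure"
proof (intro nonneg_distribution.intro nonneg_distribution_axioms.intro real_distribution.intro real_distribution_axioms.intro)
  show "prob_space levy_measure"
    by (rule prob_spaceI) (simp add: levy_measure_def emeasure_density levy_integral)
  show "AE y in levy_measure. 0 \<le> y"
    unfolding levy_measure_def by (subst AE_density) (auto simp: levy_def split: if_splits)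
qed (simp add: levy_measure_def)

lemma laplace_levy_measure: "laplace levy_measure s = (\<integral>y. exp (- (s * y)) * levy N y \<partial>lborel)"
  unfolding laplace_def levy_measure_def by (subst integral_density) (auto simp: mult.commute)

definition size_biased :: "real measure" where
  "size_biased = density N (\<lambda>x. ennreal x)"

lemma nonneg_distribution_size_biased: "nonneg_distribution size_biased"
proof (intro nonneg_distribution.intro nonneg_distribution_axioms.intro real_distribution.intro real_distribution_axioms.intro)
  have "(\<integral>\<^sup>+x. ennreal x * indicator UNIV x \<partial>N) = 1" using mean by simp
  then show "prob_space size_biased"
    by (intro prob_spaceI) (simp add: size_biased_def emeasure_density)
  show "AE y in size_biased. 0 \<le> y"
    unfolding size_biased_def by (subst AE_density) (auto simp: ennreal_neg split: if_splits)
qed (simp add: size_biased_def)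

lemma laplace_size_biased: "laplace size_biased s = (\<integral>x. x * exp (- (s * x)) \<partial>N)"
proof -
  have "size_biased = density N (\<lambda>x. ennreal (max 0 x))"
    unfolding size_biased_def by (intro density_cong) (auto simp: max_def ennreal_neg)
  then have "laplace size_biased s = (\<integral>x. exp (- (s * x)) \<partial>density N (\<lambda>x. ennreal (max 0 x)))"
    by (simp add: laplace_def)
  also have "\<dots> = (\<integral>x. max 0 x * exp (- (s * x)) \<partial>N)"
    by (subst integral_density) auto
  also have "\<dots> = (\<integral>x. x * exp (- (s * x)) \<partial>N)"
    by (rule integral_cong_AE) (use AE_nonneg in \<open>auto elim!: eventually_mono\<close>)
  finally show ?thesis .
qed

lemma integrable_id: "integrable N (\<lambda>x. x)"
proof (rule integrableI_bounded)
  have "(\<integral>\<^sup>+x. ennreal (norm x) \<partial>N) = (\<integral>\<^sup>+x. ennreal x \<partial>N)"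
    by (rule nn_integral_cong_AE) (use AE_nonneg in \<open>auto elim!: eventually_mono\<close>)
  then show "(\<integral>\<^sup>+x. ennreal (norm x) \<partial>N) < \<infinity>" using mean by simp
qed simp

lemma integrable_levy: "integrable lborel (levy N)"
  by (rule integrableI_nonneg) (auto simp: levy_integral)

lemma has_derivative_laplace:
  "s > 0 \<Longrightarrow> (laplace N has_real_derivative - laplace size_biased s) (at s)"
proof -
  assume s: "s > 0"
  have "((\<lambda>s. \<integral>x. exp (- (s * x)) \<partial>N) has_real_derivative (\<integral>x. - (x * exp (- (s * x))) \<partial>N)) (at s)"
  proof (rule has_real_derivative_integral[where S="{0<..}" and w="\<lambda>x. \<bar>x\<bar>"])
    show "AE y in N. \<forall>x\<in>{0<..}. ((\<lambda>x. exp (- (x * y))) has_real_derivative - (y * exp (- (x * y)))) (at x) \<and> \<bar>- (y * exp (- (x * y)))\<bar> \<le> \<bar>y\<bar>"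
      using AE_nonneg
      by eventually_elim (auto intro!: derivative_eq_intros simp: abs_mult mult_left_le)
    show "integrable N (\<lambda>x. \<bar>x\<bar>)" by (intro integrable_abs integrable_id)
  qed (use s integrable_exp_neg in auto)
  then show ?thesis unfolding laplace_size_biased unfolding laplace_def[abs_def] by simp
qed

lemma integrable_one_minus_exp_levy:
  assumes "s \<ge> 0" shows "integrable lborel (\<lambda>y. (1 - exp (- (s * y))) / y * levy N y)"
proof (rule Bochner_Integration.integrable_bound)
  show "integrable lborel (\<lambda>y. s * levy N y)" using integrable_levy by simp
  show "AE y in lborel. norm ((1 - exp (- (s * y))) / y * levy N y) \<le> norm (s * levy N y)"
  proof (rule AE_I2)
    fix y :: real
    show "norm ((1 - exp (- (s * y))) / y * levy N y) \<le> norm (s * levy N y)"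
    proof (cases "y > 0")
      case True
      then have "(1 - exp (- (s * y))) / y \<ge> 0" using assms by simp
      then have "\<bar>(1 - exp (- (s * y))) / y\<bar> \<le> s"
        using one_minus_exp_le[of "s * y"] assms True by (simp add: divide_le_eq)
      then have "\<bar>(1 - exp (- (s * y))) / y\<bar> * levy N y \<le> s * levy N y"
        by (intro mult_right_mono) auto
      then show ?thesis using assms by (simp only: real_norm_def abs_mult abs_of_nonneg levy_nonneg)
    qed (simp add: levy_def)
  qed
qed measurable

lemma has_derivative_exponent:
  assumes s: "s > 0"
  shows "((\<lambda>s. \<integral>y. (1 - exp (- (s * y))) / y * levy N y \<partial>lborel) has_real_derivative laplace levy_measure s) (at s)"
  unfolding laplace_levy_measure
proof (rule has_real_derivative_integral[where S="{0<..}" and w="levy N"])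
  show "AE y in lborel. \<forall>x\<in>{0<..}. ((\<lambda>x. (1 - exp (- (x * y))) / y * levy N y) has_real_derivative exp (- (x * y)) * levy N y) (at x) \<and> \<bar>exp (- (x * y)) * levy N y\<bar> \<le> levy N y"
  proof (intro AE_I2 ballI)
    fix y x :: real assume x: "x \<in> {0<..}"
    show "((\<lambda>x. (1 - exp (- (x * y))) / y * levy N y) has_real_derivative exp (- (x * y)) * levy N y) (at x) \<and> \<bar>exp (- (x * y)) * levy N y\<bar> \<le> levy N y"
    proof (cases "y > 0")
      case True
      then show ?thesis using x by (auto intro!: derivative_eq_intros simp: abs_mult intro: mult_left_le_one_le)
    qed (simp add: levy_def)
  qed
qed (use s integrable_one_minus_exp_levy integrable_levy in auto)

end

lemma normalized_iff: "normalized N \<longleftrightarrow> normalized_distribution N"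
  by (auto simp: normalized_def normalized_distribution_def normalized_distribution_axioms_def)

text \<open>The factor c covers plain convolution (c = 1) and the scaled copy with c = exp (- s) in
  self-decomposability.\<close>

lemma
  assumes "nonneg_distribution N1" "nonneg_distribution N2" "c \<ge> 0"
  shows nonneg_distribution_convolution: "nonneg_distribution (distr (N1 \<Otimes>\<^sub>M N2) borel (\<lambda>(x, y). c * x + y))"
    and laplace_convolution: "s \<ge> 0 \<Longrightarrow> laplace (distr (N1 \<Otimes>\<^sub>M N2) borel (\<lambda>(x, y). c * x + y)) s = laplace N1 (c * s) * laplace N2 s"
proof -
  interpret N1: nonneg_distribution N1 by fact
  interpret N2: nonneg_distribution N2 by fact
  interpret P: pair_prob_space N1 N2 ..
  have [measurable]: "(\<lambda>(x, y). c * x + y) \<in> borel_measurable (N1 \<Otimes>\<^sub>M N2)"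
    by (subst measurable_cong_sets[OF sets_pair_measure_cong[OF N1.events_eq_borel N2.events_eq_borel] refl]) measurable
  have ae: "AE p in N1 \<Otimes>\<^sub>M N2. 0 \<le> fst p \<and> 0 \<le> snd p"
  proof -
    have fs: "fst \<in> borel_measurable (N1 \<Otimes>\<^sub>M N2)" "snd \<in> borel_measurable (N1 \<Otimes>\<^sub>M N2)"
      by (subst measurable_cong_sets[OF sets_pair_measure_cong[OF N1.events_eq_borel N2.events_eq_borel] refl], measurable)+
    have "AE p in N1 \<Otimes>\<^sub>M N2. 0 \<le> fst p"
    proof (rule P.AE_pair_measure)
      show "{p \<in> space (N1 \<Otimes>\<^sub>M N2). 0 \<le> fst p} \<in> sets (N1 \<Otimes>\<^sub>M N2)"
        by (rule borel_measurable_le) (use fs in simp_all)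
    qed (use N1.AE_nonneg in simp)
    moreover have "AE p in N1 \<Otimes>\<^sub>M N2. 0 \<le> snd p"
    proof (rule P.AE_pair_measure)
      show "{p \<in> space (N1 \<Otimes>\<^sub>M N2). 0 \<le> snd p} \<in> sets (N1 \<Otimes>\<^sub>M N2)"
        by (rule borel_measurable_le) (use fs in simp_all)
    qed (use N2.AE_nonneg in simp)
    ultimately show ?thesis by auto
  qed
  show "nonneg_distribution (distr (N1 \<Otimes>\<^sub>M N2) borel (\<lambda>(x, y). c * x + y))"
  proof (rule P.nonneg_distribution_distr)
    show "AE p in N1 \<Otimes>\<^sub>M N2. 0 \<le> (case p of (x, y) \<Rightarrow> c * x + y)"
      using ae by eventually_elim (use assms(3) in \<open>auto simp: split_beta'\<close>)
  qed measurable
  show "laplace (distr (N1 \<Otimes>\<^sub>M N2) borel (\<lambda>(x, y). c * x + y)) s = laplace N1 (c * s) * laplace N2 s" if "s \<ge> 0"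
  proof -
    have "laplace (distr (N1 \<Otimes>\<^sub>M N2) borel (\<lambda>(x, y). c * x + y)) s = (\<integral>p. exp (- (c * s * fst p)) * exp (- (s * snd p)) \<partial>(N1 \<Otimes>\<^sub>M N2))"
      unfolding laplace_def by (subst integral_distr) (auto simp: split_beta' exp_add[symmetric] algebra_simps)
    also have "\<dots> = (\<integral>x. (\<integral>y. exp (- (c * s * x)) * exp (- (s * y)) \<partial>N2) \<partial>N1)"
    proof (subst P.integral_fst'[symmetric])
      show "integrable (N1 \<Otimes>\<^sub>M N2) (\<lambda>p. exp (- (c * s * fst p)) * exp (- (s * snd p)))"
      proof (rule P.integrable_const_bound[of _ 1])
        show "AE p in N1 \<Otimes>\<^sub>M N2. norm (exp (- (c * s * fst p)) * exp (- (s * snd p))) \<le> 1"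
          using ae by eventually_elim (use that assms(3) in \<open>auto intro!: mult_le_one\<close>)
        show "(\<lambda>p. exp (- (c * s * fst p)) * exp (- (s * snd p))) \<in> borel_measurable (N1 \<Otimes>\<^sub>M N2)"
          by (subst measurable_cong_sets[OF sets_pair_measure_cong[OF N1.events_eq_borel N2.events_eq_borel] refl]) measurable
      qed
    qed simp
    also have "\<dots> = laplace N1 (c * s) * laplace N2 s"
      unfolding laplace_def by simp
    finally show ?thesis .
  qed
qed

section \<open>Size bias of the smoothed law\<close>

locale smoothed = N: normalized_distribution N + N': normalized_distribution N' for N N' +
  assumes smoothing: "smoothing N N'"
begin

lemma laplace_eq: "s \<ge> 0 \<Longrightarrow> laplace N' s = exp (- (\<integral>y. (1 - exp (- (s * y))) / y * levy N y \<partial>lborel))"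
proof (cases "s = 0")
  case False
  assume s: "s \<ge> 0"
  have nn: "0 \<le> (1 - exp (- (s * y))) / y * levy N y" for y
    using s by (cases "y > 0") (auto simp: levy_def)
  have "laplace N' s = expm (\<integral>\<^sup>+y. ennreal ((1 - exp (- (s * y))) / y * levy N y) \<partial>lborel)"
    using smoothing s False by (simp add: smoothing_def N.quad_integral_laplace)
  also have "(\<integral>\<^sup>+y. ennreal ((1 - exp (- (s * y))) / y * levy N y) \<partial>lborel) = ennreal (\<integral>y. (1 - exp (- (s * y))) / y * levy N y \<partial>lborel)"
    using N.integrable_one_minus_exp_levy[OF s] nn by (intro nn_integral_eq_integral) auto
  finally show ?thesis using nn by (simp add: integral_nonneg)
qed (simp add: N'.laplace_0)

text \<open>Differentiating \<open>laplace N' s\<close> = exp (- F s) gives the transform of x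
  N'(dx) on one side and the transform of N' times F' on the other, and F' is the transform of the
  density \<open>levy N\<close>. Uniqueness of Laplace transforms does the rest.\<close>

lemma size_biased_eq:
  "N'.size_biased = distr (N' \<Otimes>\<^sub>M N.levy_measure) borel (\<lambda>(x, y). 1 * x + y)"
proof (rule laplace_unique)
  interpret L: nonneg_distribution N.levy_measure by (rule N.nonneg_distribution_levy)
  interpret B: nonneg_distribution N'.size_biased by (rule N'.nonneg_distribution_size_biased)
  show "nonneg_distribution N'.size_biased" by (rule N'.nonneg_distribution_size_biased)
  show "nonneg_distribution (distr (N' \<Otimes>\<^sub>M N.levy_measure) borel (\<lambda>(x, y). 1 * x + y))"
    by (rule nonneg_distribution_convolution) (auto intro: N'.nonneg_distribution_axioms L.nonneg_distribution_axioms)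
  fix j :: nat
  have "laplace N'.size_biased s = laplace N' s * laplace N.levy_measure s" if s: "s \<ge> 0" for s
  proof (cases "s = 0")
    case True
    then show ?thesis by (simp add: N'.laplace_0 L.laplace_0 B.laplace_0)
  next
    case False
    then have s: "s > 0" using s by simp
    have "((\<lambda>s. exp (- (\<integral>y. (1 - exp (- (s * y))) / y * levy N y \<partial>lborel))) has_real_derivative
      exp (- (\<integral>y. (1 - exp (- (s * y))) / y * levy N y \<partial>lborel)) * - laplace N.levy_measure s) (at s)"
      by (rule DERIV_chain2[OF DERIV_exp]) (intro DERIV_minus N.has_derivative_exponent s)
    moreover have "\<forall>\<^sub>F t in nhds s. laplace N' t = exp (- (\<integral>y. (1 - exp (- (t * y))) / y * levy N y \<partial>lborel))"
      using eventually_nhds_in_open[of "{0<..}" s] s by (auto elim!: eventually_mono simp: laplace_eq)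
    ultimately have "(laplace N' has_real_derivative exp (- (\<integral>y. (1 - exp (- (s * y))) / y * levy N y \<partial>lborel)) * - laplace N.levy_measure s) (at s)"
      by (subst DERIV_cong_ev[OF refl _ refl])
    from DERIV_unique[OF this N'.has_derivative_laplace[OF s]] show ?thesis
      using laplace_eq[of s] s by simp
  qed
  then show "laplace N'.size_biased (real j) = laplace (distr (N' \<Otimes>\<^sub>M N.levy_measure) borel (\<lambda>(x, y). 1 * x + y)) (real j)"
    by (subst laplace_convolution) (auto intro: N'.nonneg_distribution_axioms L.nonneg_distribution_axioms)
qed

lemma size_biased_nn_integral:
  assumes [measurable]: "h \<in> borel_measurable borel"
  shows "(\<integral>\<^sup>+x. ennreal x * h x \<partial>N') = (\<integral>\<^sup>+x. (\<integral>\<^sup>+y. ennreal (levy N y) * h (x + y) \<partial>lborel) \<partial>N')"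
proof -
  interpret L: nonneg_distribution N.levy_measure by (rule N.nonneg_distribution_levy)
  interpret P: pair_prob_space N' N.levy_measure ..
  have "(\<integral>\<^sup>+x. ennreal x * h x \<partial>N') = (\<integral>\<^sup>+x. h x \<partial>N'.size_biased)"
    unfolding N'.size_biased_def by (subst nn_integral_density) auto
  also have "\<dots> = (\<integral>\<^sup>+p. h (fst p + snd p) \<partial>(N' \<Otimes>\<^sub>M N.levy_measure))"
    unfolding size_biased_eq by (subst nn_integral_distr) (auto simp: split_beta')
  also have "\<dots> = (\<integral>\<^sup>+x. (\<integral>\<^sup>+y. h (x + y) \<partial>N.levy_measure) \<partial>N')"
    by (subst L.nn_integral_fst[symmetric]) auto
  also have "\<dots> = (\<integral>\<^sup>+x. (\<integral>\<^sup>+y. ennreal (levy N y) * h (x + y) \<partial>lborel) \<partial>N')"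
    unfolding N.levy_measure_def by (subst nn_integral_density) auto
  finally show ?thesis .
qed

end

section \<open>The blow-up time\<close>

text \<open>The zero-energy level of g'' = exp g - 1: an increasing solution whose height and
  velocity vanish at minus infinity satisfies g' = \<open>speed\<close> g.\<close>

definition speed :: "real \<Rightarrow> real" where
  "speed u = sqrt (2 * (exp u - u - 1))"

lemma speed_ge: "0 \<le> u \<Longrightarrow> u \<le> speed u"
  unfolding speed_def using exp_lower_Taylor_quadratic[of u] by (intro real_le_rsqrt) simp

lemma speed_pos: "0 < u \<Longrightarrow> 0 < speed u"
  using speed_ge[of u] by simp

lemma speed_square: "0 \<le> u \<Longrightarrow> (speed u)\<^sup>2 = 2 * (exp u - u - 1)"
proof -
  have "0 \<le> exp u - u - 1" using exp_ge_add_one_self[of u] by linarith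
  then show ?thesis unfolding speed_def by (subst real_sqrt_pow2) auto
qed

lemma has_derivative_speed: "0 < u \<Longrightarrow> (speed has_real_derivative (exp u - 1) / speed u) (at u)"
proof -
  assume u: "0 < u"
  have "2 * (exp u - u - 1) > 0" using speed_pos[OF u] unfolding speed_def by simp
  then show ?thesis unfolding speed_def[abs_def]
    by (auto intro!: derivative_eq_intros simp: field_simps)
qed

lemma continuous_on_speed: "continuous_on A speed"
  unfolding speed_def by (intro continuous_intros)

lemma continuous_on_inverse_speed: "A \<subseteq> {0<..} \<Longrightarrow> continuous_on A (\<lambda>u. 1 / speed u)"
  by (intro continuous_on_divide continuous_on_const continuous_on_speed ballI)
     (metis greaterThan_iff less_irrefl speed_pos subsetD)

lemma measurable_speed [measurable]: "speed \<in> borel_measurable borel"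
  by (intro borel_measurable_continuous_onI continuous_on_speed)

text \<open>Here e < 3 bounds the third order Taylor remainder of exp by u^3/2, hence
  \<open>speed u\<close> - u <= u^2/2. Subtracting 1/u near 0 thus leaves a bounded integrand in the
  definition of \<open>r_star\<close>.\<close>

lemma inverse_speed_near_0:
  assumes "0 < u" "u < 1"
  shows "\<bar>1 / speed u - 1 / u\<bar> \<le> 1 / 2" "1 / speed u \<le> 1 / u"
proof -
  show le: "1 / speed u \<le> 1 / u" using speed_ge[of u] assms by (intro divide_left_mono) auto
  obtain t where t: "\<bar>t\<bar> \<le> \<bar>u\<bar>" "exp u = (\<Sum>m<3. u ^ m / fact m) + exp t / fact 3 * u ^ 3"
    using Maclaurin_exp_le[of u 3] by blast
  have "exp t \<le> exp 1" using t assms by auto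
  also have "\<dots> < 3" using e_less_272 by simp
  finally have "exp t \<le> 3" by simp
  then have "exp t / 6 * u ^ 3 \<le> 3 / 6 * u ^ 3" using assms by (intro mult_right_mono) auto
  then have e: "exp u - u - 1 - u\<^sup>2 / 2 \<le> u ^ 3 / 2"
    using t(2) by (simp add: numeral_3_eq_3 fact_numeral power2_eq_square power3_eq_cube)
  have "(speed u - u) * (speed u + u) = (speed u)\<^sup>2 - u\<^sup>2" by (simp add: power2_eq_square algebra_simps)
  also have "\<dots> \<le> u ^ 3" using e speed_square[of u] assms by simp
  also have "\<dots> = u\<^sup>2 / 2 * (2 * u)" by (simp add: power2_eq_square power3_eq_cube)
  also have "\<dots> \<le> u\<^sup>2 / 2 * (speed u + u)" using speed_ge[of u] assms by (intro mult_left_mono) auto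
  finally have "speed u - u \<le> u\<^sup>2 / 2" using speed_ge[of u] assms by (simp add: mult_le_cancel_right)
  then have "1 / u - 1 / speed u \<le> (u\<^sup>2 / 2) / (u * speed u)"
    using speed_pos[of u] assms by (simp add: diff_divide_eq_iff divide_le_eq field_simps)
  also have "\<dots> \<le> (u\<^sup>2 / 2) / (u * u)" using speed_ge[of u] assms by (intro divide_left_mono mult_left_mono) auto
  also have "\<dots> = 1 / 2" using assms by (simp add: power2_eq_square)
  finally show "\<bar>1 / speed u - 1 / u\<bar> \<le> 1 / 2" using le by simp
qed

lemma inverse_speed_upper: "1 \<le> u \<Longrightarrow> 1 / speed u \<le> 2 * exp (- (1 / 2 * u))"
proof -
  assume u: "1 \<le> u"
  have q: "1 + u + u\<^sup>2 / 2 \<le> exp u" using exp_lower_Taylor_quadratic[of u] u by simp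
  have "u \<le> u\<^sup>2" using u by (simp add: power2_eq_square)
  \<comment> \<open>The generous constant 1/8 makes the quadratic Taylor bound sufficient from u = 1
    on.\<close>
  then have "exp u / 8 \<le> exp u - u - 1" using q u by simp
  then have "(exp (1 / 2 * u) / 2)\<^sup>2 \<le> 2 * (exp u - u - 1)"
    by (simp add: power_divide exp_double[symmetric])
  then have "exp (1 / 2 * u) / 2 \<le> speed u" unfolding speed_def by (rule real_le_rsqrt)
  then have "1 / speed u \<le> 1 / (exp (1 / 2 * u) / 2)" by (intro divide_left_mono mult_pos_pos speed_pos) (use u in auto)
  then show ?thesis by (simp add: exp_minus field_simps)
qed

definition r_integrand :: "real \<Rightarrow> real" where
  "r_integrand u = (1 / speed u - (if u < 1 then 1 / u else 0)) * indicator {0<..} u"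

lemma measurable_r_integrand [measurable]: "r_integrand \<in> borel_measurable borel"
  unfolding r_integrand_def by measurable

lemma integrable_exp_half_line: "c > 0 \<Longrightarrow> integrable lborel (\<lambda>u. exp (- (c * u)) * indicat_real {0<..} u)"
  by (rule integrableI_nonneg) (auto simp: nn_integral_exp_half_line ennreal_mult'' ennreal_indicator)

lemma integrable_r_integrand: "integrable lborel r_integrand"
proof (rule Bochner_Integration.integrable_bound)
  show "integrable lborel (\<lambda>u. 1 / 2 * indicat_real {0<..<1} u + 2 * (exp (- (1 / 2 * u)) * indicat_real {0<..} u))"
    by (intro Bochner_Integration.integrable_add integrable_mult_right integrable_exp_half_line) auto
  show "AE u in lborel. norm (r_integrand u) \<le> norm (1 / 2 * indicator {0<..<1} u + 2 * (exp (- (1 / 2 * u)) * indicator {0<..} u))"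
  proof (rule AE_I2)
    fix u :: real
    consider "u \<le> 0" | "0 < u" "u < 1" | "1 \<le> u" by linarith
    then show "norm (r_integrand u) \<le> norm (1 / 2 * indicator {0<..<1} u + 2 * (exp (- (1 / 2 * u)) * indicator {0<..} u))"
    proof cases
      case 2
      then have "norm (r_integrand u) \<le> 1 / 2" using inverse_speed_near_0[of u] by (simp add: r_integrand_def)
      moreover have "norm (1 / 2 * indicator {0<..<1} u + 2 * (exp (- (1 / 2 * u)) * indicator {0<..} u)) = 1 / 2 + 2 * exp (- (1 / 2 * u))"
        using 2 by (simp add: add_nonneg_nonneg)
      moreover have "0 < exp (- (1 / 2 * u))" by simp
      ultimately show ?thesis by linarith
    next
      case 3
      then have "r_integrand u = 1 / speed u" by (simp add: r_integrand_def)
      moreover have "1 / speed u \<ge> 0" using speed_pos[of u] 3 by simp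
      ultimately show ?thesis using inverse_speed_upper[OF 3] 3 by simp
    qed (simp add: r_integrand_def)
  qed
qed measurable

lemma r_star_eq: "ln r_star = (\<integral>u. r_integrand u \<partial>lborel)"
  unfolding r_star_def set_lebesgue_integral_def r_integrand_def speed_def
  by (simp add: mult.commute)

lemma r_star_pos: "r_star > 0" by (simp add: r_star_def)

text \<open>The time that y' = \<open>speed\<close> y needs to explode from height x.\<close>

definition time_left :: "real \<Rightarrow> real" where
  "time_left x = (\<integral>u. 1 / speed u * indicator {x<..} u \<partial>lborel)"

lemma integrable_inverse_speed: "x > 0 \<Longrightarrow> integrable lborel (\<lambda>u. 1 / speed u * indicator {x<..} u)"
proof (rule Bochner_Integration.integrable_bound)
  assume x: "x > 0"
  show "integrable lborel (\<lambda>u. 1 / x * indicator {0<..<1} u + 2 * (exp (- (1 / 2 * u)) * indicator {0<..} u))"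
    by (intro Bochner_Integration.integrable_add integrable_mult_right integrable_exp_half_line) auto
  show "AE u in lborel. norm (1 / speed u * indicator {x<..} u) \<le> norm (1 / x * indicator {0<..<1} u + 2 * (exp (- (1 / 2 * u)) * indicator {0<..} u))"
  proof (rule AE_I2)
    fix u :: real
    consider "u \<le> x" | "x < u" "u < 1" | "x < u" "1 \<le> u" by linarith
    then show "norm (1 / speed u * indicator {x<..} u) \<le> norm (1 / x * indicator {0<..<1} u + 2 * (exp (- (1 / 2 * u)) * indicator {0<..} u))"
    proof cases
      case 2
      then have "1 / speed u \<le> 1 / x" using speed_ge[of u] x by (intro divide_left_mono mult_pos_pos) auto
      moreover have "norm (1 / x + 2 * exp (- (1 / 2 * u))) = 1 / x + 2 * exp (- (1 / 2 * u))"
        using x by (simp add: add_nonneg_nonneg)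
      moreover have "(0::real) \<le> 2 * exp (- (1 / 2 * u))" by simp
      ultimately have "norm (1 / speed u) \<le> norm (1 / x + 2 * exp (- (1 / 2 * u)))"
        using 2 x speed_pos[of u] by (simp only: real_norm_def abs_of_pos divide_pos_pos zero_less_one order_less_trans[of 0 x u])
      then show ?thesis using 2 x by simp
    next
      case 3
      then show ?thesis using inverse_speed_upper[OF 3(2)] speed_pos[of u] by simp
    qed simp
  qed
qed measurable

lemma time_left_diff:
  assumes "0 < a" "a \<le> b"
  shows "time_left a - time_left b = integral {a..b} (\<lambda>u. 1 / speed u)"
proof -
  have c: "continuous_on {a..b} (\<lambda>u. 1 / speed u)"
    by (rule continuous_on_inverse_speed) (use assms in auto)
  have si: "set_integrable lborel {a..b} (\<lambda>u. 1 / speed u)"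
    using borel_integrable_compact[of "{a..b}" "\<lambda>u. 1 / speed u"] c by (simp add: set_integrable_def)
  have "time_left a - time_left b = (\<integral>u. 1 / speed u * indicator {a<..} u - 1 / speed u * indicator {b<..} u \<partial>lborel)"
    unfolding time_left_def using assms
    by (intro Bochner_Integration.integral_diff[symmetric] integrable_inverse_speed) auto
  also have "\<dots> = (LINT u:{a..b}|lborel. 1 / speed u)"
    unfolding set_lebesgue_integral_def
    by (rule integral_cong_AE) (use AE_lborel_neq[of a] assms in \<open>auto elim!: eventually_mono simp: indicator_def\<close>)
  also have "\<dots> = integral {a..b} (\<lambda>u. 1 / speed u)"
    using set_borel_integral_eq_integral(2)[OF si] .
  finally show ?thesis .
qed

lemma has_derivative_time_left:
  assumes x: "x > 0"
  shows "(time_left has_real_derivative - (1 / speed x)) (at x)"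
proof -
  have c: "continuous_on {x/2..x+1} (\<lambda>u. 1 / speed u)"
    by (rule continuous_on_inverse_speed) (use x in auto)
  have "((\<lambda>y. integral {x/2..y} (\<lambda>u. 1 / speed u)) has_real_derivative 1 / speed x) (at x within {x/2..x+1})"
    by (rule integral_has_real_derivative[OF c]) (use x in auto)
  then have d: "((\<lambda>y. integral {x/2..y} (\<lambda>u. 1 / speed u)) has_real_derivative 1 / speed x) (at x)"
    using x by (subst (asm) at_within_interior) auto
  have "((\<lambda>y. time_left (x/2) - integral {x/2..y} (\<lambda>u. 1 / speed u)) has_real_derivative 0 - 1 / speed x) (at x)"
    by (intro DERIV_diff DERIV_const d)
  moreover have "\<forall>\<^sub>F y in nhds x. time_left y = time_left (x/2) - integral {x/2..y} (\<lambda>u. 1 / speed u)"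
    using eventually_nhds_in_open[of "{x/2<..}" x] x
    by (auto elim!: eventually_mono simp: time_left_diff[symmetric])
  ultimately show ?thesis by (subst DERIV_cong_ev[OF refl _ refl]) auto
qed

text \<open>The reason is \<open>speed u\<close> = sqrt 2 * exp (u/2) * sqrt (1 - (u+1) exp (- u)).
  The last factor is nondecreasing in u, so for u > x it lies between its value at x and 1.\<close>

lemma time_left_bounds:
  assumes x: "x > 0"
  shows "sqrt 2 * exp (- (x / 2)) \<le> time_left x"
    and "time_left x \<le> sqrt 2 * exp (- (x / 2)) / sqrt (1 - (x + 1) * exp (- x))"
proof -
  have i: "integrable lborel (\<lambda>u. exp (- (1 / 2 * u)) * indicator {x<..} u)"
    by (rule Bochner_Integration.integrable_bound[OF integrable_exp_half_line[of "1/2"]])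
       (use x in \<open>auto simp: indicator_def\<close>)
  have v: "(\<integral>u. exp (- (1 / 2 * u)) * indicator {x<..} u \<partial>lborel) = 2 * exp (- (x / 2))"
  proof -
    have "(\<integral>\<^sup>+u. ennreal (exp (- (1 / 2 * u)) * indicator {x<..} u) \<partial>lborel) = (\<integral>\<^sup>+u. ennreal (exp (- (1 / 2 * u))) * indicator {x..} u \<partial>lborel)"
      by (rule nn_integral_cong_AE) (use AE_lborel_neq[of x] in \<open>auto elim!: eventually_mono simp: indicator_def\<close>)
    also have "\<dots> = ennreal (0 - (- (2 * exp (- (1 / 2 * x)))))"
    proof (rule nn_integral_FTC_atLeast)
      show "((\<lambda>u. - (2 * exp (- (1 / 2 * u)))) has_real_derivative exp (- (1 / 2 * y))) (at y)" for y :: real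
        by (auto intro!: derivative_eq_intros)
      show "((\<lambda>u. - (2 * exp (- (1 / 2 * u)))) \<longlongrightarrow> (0::real)) at_top" by real_asymp
    qed auto
    finally show ?thesis using i
      by (subst integral_eq_nn_integral) auto
  qed
  have *: "1 / sqrt 2 * exp (- (1 / 2 * u)) \<le> 1 / speed u \<and> 1 / speed u \<le> 1 / (sqrt 2 * sqrt (1 - (x + 1) * exp (- x))) * exp (- (1 / 2 * u))" if u: "u > x" for u
  proof -
    have sp: "speed u = sqrt 2 * exp (1 / 2 * u) * sqrt (1 - (u + 1) * exp (- u))"
    proof -
      have "2 * (exp u - u - 1) = 2 * exp u * (1 - (u + 1) * exp (- u))"
        using exp_minus_inverse[of u] by algebra
      moreover have "sqrt (exp u) = exp (1 / 2 * u)"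
        by (rule real_sqrt_unique) (simp_all add: exp_double[symmetric])
      ultimately show ?thesis unfolding speed_def by (simp add: real_sqrt_mult)
    qed
    have up: "0 < u" using u x by simp
    have lt1: "(y + 1) * exp (- y) < 1" if "y > 0" for y :: real
      using exp_ge_add_one_self[of y] exp_lower_Taylor_quadratic[of y] that
      by (simp add: exp_minus field_simps) (smt (verit) zero_less_power)
    have dec: "(u + 1) * exp (- u) \<le> (x + 1) * exp (- x)"
    proof (rule DERIV_nonpos_imp_nonincreasing[of x u "\<lambda>y. (y + 1) * exp (- y)"])
      fix y assume "x \<le> y" "y \<le> u"
      have "((\<lambda>y. (y + 1) * exp (- y)) has_real_derivative - (y * exp (- y))) (at y)"
        by (auto intro!: derivative_eq_intros simp: algebra_simps)
      moreover have "- (y * exp (- y)) \<le> 0" using \<open>x \<le> y\<close> x by simp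
      ultimately show "\<exists>d. ((\<lambda>y. (y + 1) * exp (- y)) has_real_derivative d) (at y) \<and> d \<le> 0" by blast
    qed (use u in simp)
    have s1: "0 < sqrt (1 - (x + 1) * exp (- x))" using lt1[OF x] by simp
    have s2: "sqrt (1 - (x + 1) * exp (- x)) \<le> sqrt (1 - (u + 1) * exp (- u))" using dec by simp
    have s3: "sqrt (1 - (u + 1) * exp (- u)) \<le> 1" using up by simp
    have "speed u \<le> sqrt 2 * exp (1 / 2 * u)" unfolding sp using s3 by (simp add: mult_left_le)
    then have "1 / (sqrt 2 * exp (1 / 2 * u)) \<le> 1 / speed u" using speed_pos[OF up] by (intro divide_left_mono) auto
    moreover have "sqrt 2 * exp (1 / 2 * u) * sqrt (1 - (x + 1) * exp (- x)) \<le> speed u" unfolding sp using s2 by simp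
    then have "1 / speed u \<le> 1 / (sqrt 2 * exp (1 / 2 * u) * sqrt (1 - (x + 1) * exp (- x)))"
      using s1 speed_pos[OF up] by (intro divide_left_mono mult_pos_pos) auto
    ultimately show ?thesis by (simp add: exp_minus field_simps)
  qed
  have "sqrt 2 * exp (- (x / 2)) = (\<integral>u. 1 / sqrt 2 * (exp (- (1 / 2 * u)) * indicator {x<..} u) \<partial>lborel)"
    unfolding integral_mult_right_zero v by (simp add: field_simps real_div_sqrt)
  also have "\<dots> \<le> time_left x" unfolding time_left_def
    by (rule integral_mono[OF _ integrable_inverse_speed[OF x]]) (use i * in \<open>auto simp: indicator_def\<close>)
  finally show "sqrt 2 * exp (- (x / 2)) \<le> time_left x" .
  have "time_left x \<le> (\<integral>u. 1 / (sqrt 2 * sqrt (1 - (x + 1) * exp (- x))) * (exp (- (1 / 2 * u)) * indicator {x<..} u) \<partial>lborel)"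
    unfolding time_left_def
    by (rule integral_mono[OF integrable_inverse_speed[OF x]]) (use i * in \<open>auto simp: indicator_def\<close>)
  also have "\<dots> = 1 / (sqrt 2 * sqrt (1 - (x + 1) * exp (- x))) * (2 * exp (- (x / 2)))"
    unfolding integral_mult_right_zero v ..
  also have "\<dots> = 1 / sqrt 2 * (2 * exp (- (x / 2))) / sqrt (1 - (x + 1) * exp (- x))" by simp
  also have "1 / sqrt 2 * (2 * exp (- (x / 2))) = sqrt 2 * exp (- (x / 2))"
    by (simp add: field_simps real_div_sqrt)
  finally show "time_left x \<le> sqrt 2 * exp (- (x / 2)) / sqrt (1 - (x + 1) * exp (- x))" .
qed

text \<open>The travel time to height x of the solution of y' = speed y that behaves like exp t
  at minus infinity; it explodes at time ln r_star.\<close>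
definition log_time :: "real \<Rightarrow> real" where
  "log_time x = ln r_star - time_left x"

lemma has_derivative_log_time: "x > 0 \<Longrightarrow> (log_time has_real_derivative 1 / speed x) (at x)"
  unfolding log_time_def[abs_def] by (auto intro!: derivative_eq_intros has_derivative_time_left)

lemma continuous_on_log_time: "continuous_on {0<..} log_time"
  by (rule DERIV_continuous_on) (auto intro: has_field_derivative_at_within has_derivative_log_time)

lemma log_time_strict_mono: "0 < x \<Longrightarrow> x < y \<Longrightarrow> log_time x < log_time y"
  by (rule DERIV_pos_imp_increasing) (auto intro!: exI[of _ "1 / speed _"] has_derivative_log_time speed_pos divide_pos_pos)

lemma log_time_less: "x > 0 \<Longrightarrow> log_time x < ln r_star"
proof -
  assume x: "x > 0"
  have "0 < sqrt 2 * exp (- (x / 2))" by simp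
  then have "0 < time_left x" using time_left_bounds(1)[OF x] by (rule less_le_trans)
  then show ?thesis by (simp add: log_time_def)
qed

text \<open>Splitting the integral for ln \<open>r_star\<close> at x exhibits
  \<open>log_time x\<close> - ln x as the integral of \<open>r_integrand\<close> over (0, x],
  because 1/u over (x, 1) contributes - ln x. This is the origin of the correction term in
  \<open>r_star\<close>.\<close>

lemma log_time_near_0:
  assumes x: "0 < x" "x < 1"
  shows "\<bar>log_time x - ln x\<bar> \<le> x / 2"
proof -
  have "ln r_star = (\<integral>u. r_integrand u * indicator {0<..x} u + (1 / speed u * indicator {x<..} u - 1 / u * indicator {x<..<1} u) \<partial>lborel)"
    unfolding r_star_eq
    by (rule Bochner_Integration.integral_cong) (use x in \<open>auto simp: r_integrand_def indicator_def\<close>)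
  also have "\<dots> = (\<integral>u. r_integrand u * indicator {0<..x} u \<partial>lborel) + (time_left x - (\<integral>u. 1 / u * indicator {x<..<1} u \<partial>lborel))"
  proof -
    have 1: "integrable lborel (\<lambda>u. r_integrand u * indicator {0<..x} u)"
      by (intro integrable_real_mult_indicator integrable_r_integrand) auto
    have 2: "integrable lborel (\<lambda>u. 1 / u * indicator {x<..<1} u)"
    proof (rule Bochner_Integration.integrable_bound[of _ "\<lambda>u. 1 / x * indicator {x<..<1} u"])
      show "AE u in lborel. norm (1 / u * indicator {x<..<1} u) \<le> norm (1 / x * indicator {x<..<1} u)"
        using x by (intro AE_I2) (auto simp: indicator_def intro!: divide_left_mono)
      show "integrable lborel (\<lambda>u. 1 / x * indicat_real {x<..<1} u)"
        using x by (intro integrable_mult_right integrable_real_indicator) auto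
    qed auto
    show ?thesis unfolding time_left_def
      using 1 2 integrable_inverse_speed[OF x(1)] by simp
  qed
  also have "(\<integral>u. 1 / u * indicator {x<..<1} u \<partial>lborel) = - ln x"
  proof -
    have "(\<integral>u. 1 / u * indicator {x<..<1} u \<partial>lborel) = (\<integral>u. 1 / u * indicator {x..1} u \<partial>lborel)"
      by (rule integral_cong_AE) (use AE_lborel_neq[of x] AE_lborel_neq[of 1] in \<open>auto elim!: eventually_elim2 simp: indicator_def\<close>)
    also have "\<dots> = ln 1 - ln x"
    proof (rule integral_FTC_Icc_nonneg)
      show "(ln has_real_derivative 1 / u) (at u)" if "u \<in> {x..1}" for u
        using that x by (auto intro!: derivative_eq_intros)
    qed (use x in auto)
    finally show ?thesis by simp
  qed
  finally have "log_time x - ln x = (\<integral>u. r_integrand u * indicator {0<..x} u \<partial>lborel)"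
    by (simp add: log_time_def)
  also have "\<bar>\<dots>\<bar> \<le> (\<integral>u. 1 / 2 * indicator {0<..x} u \<partial>lborel)"
  proof (rule integral_abs_bound[THEN order_trans], rule integral_mono)
    show "integrable lborel (\<lambda>u. \<bar>r_integrand u * indicator {0<..x} u\<bar>)"
      by (intro integrable_abs integrable_real_mult_indicator integrable_r_integrand) auto
    show "\<bar>r_integrand u * indicator {0<..x} u\<bar> \<le> 1 / 2 * indicator {0<..x} u" for u
      using inverse_speed_near_0(1)[of u] x by (auto simp: r_integrand_def indicator_def)
    show "integrable lborel (\<lambda>u. 1 / 2 * indicat_real {0<..x} u)"
      using x by (intro integrable_mult_right integrable_real_indicator) auto
  qed
  finally show ?thesis using x by simp
qed

lemma log_time_minus_ln_tendsto: "((\<lambda>x. log_time x - ln x) \<longlongrightarrow> 0) (at_right 0)"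
proof (rule Lim_null_comparison)
  show "\<forall>\<^sub>F x in at_right 0. norm (log_time x - ln x) \<le> x / 2"
  proof -
    have "\<forall>\<^sub>F x in at_right 0. 0 < x \<and> x < (1::real)"
      using eventually_at_right_real[of "0::real" 1] by simp
    then show ?thesis
      by eventually_elim (simp only: real_norm_def, rule log_time_near_0, auto)
  qed
  show "((\<lambda>x::real. x / 2) \<longlongrightarrow> 0) (at_right 0)" by real_asymp
qed

text \<open>As \<open>speed z\<close> >= z, the difference \<open>log_time\<close> - ln is
  nonincreasing, and it tends to 0 at 0.\<close>

lemma log_time_le_ln: "x > 0 \<Longrightarrow> log_time x \<le> ln x"
proof -
  assume x: "x > 0"
  have "log_time x - ln x \<le> y / 2" if y: "0 < y" "y < min 1 x" for y
  proof -
    have "log_time x - ln x \<le> log_time y - ln y"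
    proof (rule DERIV_nonpos_imp_nonincreasing[of y x "\<lambda>x. log_time x - ln x"])
      fix z assume z: "y \<le> z" "z \<le> x"
      then have "((\<lambda>x. log_time x - ln x) has_real_derivative 1 / speed z - 1 / z) (at z)"
        using y by (auto intro!: derivative_eq_intros has_derivative_log_time)
      moreover have "1 / speed z \<le> 1 / z"
        using speed_ge[of z] z y by (intro divide_left_mono mult_pos_pos speed_pos) auto
      ultimately show "\<exists>d. ((\<lambda>x. log_time x - ln x) has_real_derivative d) (at z) \<and> d \<le> 0"
        by (intro exI[of _ "1 / speed z - 1 / z"]) simp
    qed (use y in simp)
    then show ?thesis using abs_le_D1[OF log_time_near_0[of y]] y by linarith
  qed
  then have "\<forall>\<^sub>F y in at_right 0. log_time x - ln x \<le> y / 2"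
    using eventually_at_right_real[of 0 "min 1 x"] x by (auto elim!: eventually_mono)
  moreover have "((\<lambda>y::real. y / 2) \<longlongrightarrow> 0) (at_right 0)" by real_asymp
  ultimately have "log_time x - ln x \<le> 0"
    by (intro tendsto_lowerbound[of "\<lambda>y. y / 2" 0 "at_right 0"]) auto
  then show ?thesis by simp
qed

lemma log_time_tendsto_at_top: "(log_time \<longlongrightarrow> ln r_star) at_top"
proof -
  have "(time_left \<longlongrightarrow> 0) at_top"
  proof (rule tendsto_sandwich)
    show "\<forall>\<^sub>F x in at_top. sqrt 2 * exp (- (x / 2)) \<le> time_left x"
      using eventually_gt_at_top[of 0] by eventually_elim (rule time_left_bounds)
    show "\<forall>\<^sub>F x in at_top. time_left x \<le> sqrt 2 * exp (- (x / 2)) / sqrt (1 - (x + 1) * exp (- x))"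
      using eventually_gt_at_top[of 0] by eventually_elim (rule time_left_bounds)
    show "((\<lambda>x. sqrt 2 * exp (- (x / 2))) \<longlongrightarrow> 0) at_top" by real_asymp
    show "((\<lambda>x. sqrt 2 * exp (- (x / 2)) / sqrt (1 - (x + 1) * exp (- x))) \<longlongrightarrow> 0) at_top" by real_asymp
  qed
  then have "((\<lambda>x. ln r_star - time_left x) \<longlongrightarrow> ln r_star - 0) at_top" by (intro tendsto_intros)
  then show ?thesis by (simp add: log_time_def[abs_def])
qed

lemma ex_log_time:
  assumes th: "0 < th" "th < r_star"
  shows "\<exists>x>0. log_time x = ln th"
proof -
  obtain a where a: "0 < a" "log_time a < ln th"
  proof -
    have "0 < min (1/2) (th / 2)" using th by auto
    moreover have "log_time (min (1/2) (th / 2)) \<le> ln (min (1/2) (th / 2))" using th by (intro log_time_le_ln) auto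
    moreover have "ln (min (1/2) (th / 2)) < ln th" using th by (subst ln_less_cancel_iff) auto
    ultimately show ?thesis using that by (meson le_less_trans)
  qed
  have "ln th < ln r_star" using th by simp
  then have "\<forall>\<^sub>F x in at_top. ln th < log_time x" by (rule order_tendstoD(1)[OF log_time_tendsto_at_top])
  then have "\<forall>\<^sub>F x in at_top. ln th < log_time x \<and> a \<le> x" using eventually_ge_at_top by (rule eventually_conj)
  then obtain b where b: "ln th < log_time b" "a \<le> b" by (metis (mono_tags, lifting) eventually_at_top_linorder order_refl)
  have "\<exists>x\<ge>a. x \<le> b \<and> log_time x = ln th"
    by (rule IVT') (use a b in \<open>auto intro: continuous_on_subset[OF continuous_on_log_time]\<close>)
  then obtain x where "a \<le> x" "log_time x = ln th" by blast
  then show ?thesis using a by (intro exI[of _ x]) auto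
qed

text \<open>The explosive trajectory in the variable th = exp t, that is, the inverse of the map
  from x to exp (\<open>log_time x\<close>). It is specified for 0 < th < \<open>r_star\<close>
  only.\<close>

definition chi :: "real \<Rightarrow> real" where
  "chi th = (SOME x. 0 < x \<and> log_time x = ln th)"

context
  fixes th :: real assumes th: "0 < th" "th < r_star"
begin

lemma chi_pos: "0 < chi th" and log_time_chi: "log_time (chi th) = ln th"
  using someI_ex[OF ex_log_time[OF th, simplified Bex_def]] by (auto simp: chi_def)

end

lemma chi_log_time: "x > 0 \<Longrightarrow> chi (exp (log_time x)) = x"
proof -
  assume x: "x > 0"
  have "exp (log_time x) < r_star" using log_time_less[OF x] r_star_pos by (metis exp_less_cancel_iff exp_ln)
  then have "0 < chi (exp (log_time x))" "log_time (chi (exp (log_time x))) = log_time x"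
    using chi_pos[of "exp (log_time x)"] log_time_chi[of "exp (log_time x)"] by auto
  then show ?thesis using log_time_strict_mono x by (metis less_irrefl linorder_neqE_linordered_idom)
qed

lemma log_time_inj: "0 < x \<Longrightarrow> 0 < y \<Longrightarrow> log_time x = log_time y \<Longrightarrow> x = y"
  by (metis chi_log_time)

text \<open>This is the moment bound for W_0 = 1, where E exp (th W_0) = exp th.\<close>

lemma chi_ge: "0 < th \<Longrightarrow> th < r_star \<Longrightarrow> th \<le> chi th"
  using log_time_le_ln[OF chi_pos] log_time_chi chi_pos by (metis ln_le_cancel_iff)

lemma has_derivative_chi:
  assumes th: "0 < th" "th < r_star"
  shows "(chi has_real_derivative speed (chi th) / th) (at th)"
proof -
  define x where "x = chi th"
  have x: "x > 0" "exp (log_time x) = th" using chi_pos[OF th] log_time_chi[OF th] th by (auto simp: x_def)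
  have d: "((\<lambda>x. exp (log_time x)) has_real_derivative th * (1 / speed y)) (at y)" if "y > 0" "exp (log_time y) = th" for y
    using that by (auto intro!: derivative_eq_intros has_derivative_log_time)
  have "isCont chi (exp (log_time x))"
  proof (rule isCont_inverse_function[where f="\<lambda>x. exp (log_time x)" and x=x and d="x/2"])
    show "chi (exp (log_time z)) = z" if "\<bar>z - x\<bar> \<le> x / 2" for z
      by (rule chi_log_time) (use that x in linarith)
    show "isCont (\<lambda>x. exp (log_time x)) z" if "\<bar>z - x\<bar> \<le> x / 2" for z
    proof -
      have "z > 0" using that x by linarith
      then show ?thesis by (intro isCont_exp' DERIV_isCont[OF has_derivative_log_time])
    qed
  qed (use x in auto)
  then have "isCont chi th" using x by simp
  have "(chi has_real_derivative inverse (th * (1 / speed x))) (at th)"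
  proof (rule DERIV_inverse_function[where f="\<lambda>x. exp (log_time x)" and a=0 and b=r_star])
    show "((\<lambda>x. exp (log_time x)) has_real_derivative th * (1 / speed x)) (at (chi th))"
      using d[of x] x by (simp add: x_def)
    show "th * (1 / speed x) \<noteq> 0" using speed_pos[OF x(1)] th by simp
    show "exp (log_time (chi y)) = y" if "0 < y" "y < r_star" for y
      using log_time_chi[OF that] that by simp
  qed (use th \<open>isCont chi th\<close> in auto)
  then show ?thesis by (simp add: x_def divide_inverse mult.commute)
qed

lemma chi_tendsto_0: "(chi \<longlongrightarrow> 0) (at_right 0)"
proof (rule tendstoI)
  fix e :: real assume e: "e > 0"
  define y where "y = exp (log_time e)"
  have "\<forall>\<^sub>F t in at_right 0. 0 < t \<and> t < min y r_star"
    using eventually_at_right_real[of 0 "min y r_star"] r_star_pos by (auto simp: y_def elim!: eventually_mono)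
  then show "\<forall>\<^sub>F t in at_right 0. dist (chi t) 0 < e"
  proof eventually_elim
    case (elim t)
    then have t: "0 < t" "t < r_star" by auto
    have "\<not> e \<le> chi t"
    proof
      assume "e \<le> chi t"
      then have "log_time e \<le> log_time (chi t)" using log_time_strict_mono[OF e] by (cases "e = chi t") (auto intro: less_imp_le)
      then have "log_time e \<le> ln t" using log_time_chi[OF t] by simp
      then have "exp (log_time e) \<le> t" using t by (metis exp_le_cancel_iff exp_ln)
      then show False using elim by (simp add: y_def)
    qed
    then show ?case using chi_pos[OF t] by simp
  qed
qed

lemma speed_chi_tendsto_0: "((\<lambda>t. speed (chi t)) \<longlongrightarrow> 0) (at_right 0)"
proof -
  have "isCont speed 0" using continuous_on_speed[of UNIV] by (simp add: continuous_on_eq_continuous_at)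
  then have "((\<lambda>t. speed (chi t)) \<longlongrightarrow> speed 0) (at_right 0)"
    by (rule isCont_tendsto_compose) (rule chi_tendsto_0)
  then show ?thesis by (simp add: speed_def)
qed

text \<open>With th * d/dth as time derivative, this is g'' = exp g - 1 for g =
  \<open>chi\<close>.\<close>

lemma has_derivative_speed_chi:
  assumes th: "0 < th" "th < r_star"
  shows "((\<lambda>t. speed (chi t)) has_real_derivative (exp (chi th) - 1) / th) (at th)"
proof -
  have "((\<lambda>t. speed (chi t)) has_real_derivative (exp (chi th) - 1) / speed (chi th) * (speed (chi th) / th)) (at th)"
    by (rule DERIV_chain2[OF has_derivative_speed[OF chi_pos[OF th]] has_derivative_chi[OF th]])
  then show ?thesis using speed_pos[OF chi_pos[OF th]] by simp
qed

lemma nn_integral_FTC_open_left: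
  assumes [measurable]: "f \<in> borel_measurable borel" and b: "0 < b"
    and d: "\<And>r. 0 < r \<Longrightarrow> r \<le> b \<Longrightarrow> DERIV F r :> f r" and nonneg: "\<And>r. 0 < r \<Longrightarrow> r \<le> b \<Longrightarrow> 0 \<le> f r"
    and lim: "(F \<longlongrightarrow> 0) (at_right 0)"
  shows "(\<integral>\<^sup>+r. ennreal (f r) * indicator {0<..<b} r \<partial>lborel) = ennreal (F b)"
proof -
  let ?a = "\<lambda>n. b / real (Suc n)"
  have "(\<lambda>n. \<integral>\<^sup>+r. ennreal (f r) * indicator {?a n..b} r \<partial>lborel) \<longlonglongrightarrow> (\<integral>\<^sup>+r. ennreal (f r) * indicator {0<..b} r \<partial>lborel)"
  proof (rule nn_integral_LIMSEQ)
    show "incseq (\<lambda>n r. ennreal (f r) * indicator {?a n..b} r)"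
    proof (intro incseq_SucI le_funI mult_left_mono)
      fix n r
      have "?a (Suc n) \<le> ?a n" using b by (intro divide_left_mono) auto
      then show "indicator {?a n..b} r \<le> (indicator {?a (Suc n)..b} r :: ennreal)" by (auto simp: indicator_def)
    qed simp
    show "(\<lambda>n. ennreal (f r) * indicator {?a n..b} r) \<longlonglongrightarrow> ennreal (f r) * indicator {0<..b} r" for r
    proof (cases "r > 0")
      case True
      have "(\<lambda>n. ?a n) \<longlonglongrightarrow> 0" by real_asymp
      then have "\<forall>\<^sub>F n in sequentially. ?a n < r" using True by (rule order_tendstoD(2))
      then have "\<forall>\<^sub>F n in sequentially. ennreal (f r) * indicator {?a n..b} r = ennreal (f r) * indicator {0<..b} r"
        by eventually_elim (use True in \<open>auto simp: indicator_def\<close>)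
      then show ?thesis by (rule tendsto_eventually)
    next
      case False
      have "r < ?a n" for n
      proof -
        have "0 < ?a n" using b by simp
        then show ?thesis using False by linarith
      qed
      then have "indicator {?a n..b} r = (0::ennreal)" for n by (simp add: indicator_def not_le)
      then show ?thesis using False by simp
    qed
  qed measurable
  moreover have "(\<integral>\<^sup>+r. ennreal (f r) * indicator {?a n..b} r \<partial>lborel) = ennreal (F b - F (?a n))" for n
  proof (rule nn_integral_FTC_Icc)
    have "0 < ?a n" using b by simp
    then show "DERIV F r :> f r" "0 \<le> f r" if "r \<in> {?a n..b}" for r using that d[of r] nonneg[of r] by auto
    have "b \<le> b * real (Suc n)" using b by simp
    then show "?a n \<le> b" by (subst pos_divide_le_eq) auto
  qed measurable
  moreover have "(\<lambda>n. ennreal (F b - F (?a n))) \<longlonglongrightarrow> ennreal (F b - 0)"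
  proof (intro tendsto_ennrealI tendsto_diff tendsto_const)
    have "filterlim ?a (at_right 0) sequentially" using b by real_asymp
    then show "(\<lambda>n. F (?a n)) \<longlonglongrightarrow> 0" by (rule filterlim_compose[OF lim])
  qed
  ultimately have "(\<integral>\<^sup>+r. ennreal (f r) * indicator {0<..b} r \<partial>lborel) = ennreal (F b - 0)"
    using LIMSEQ_unique by simp
  moreover have "(\<integral>\<^sup>+r. ennreal (f r) * indicator {0<..<b} r \<partial>lborel) = (\<integral>\<^sup>+r. ennreal (f r) * indicator {0<..b} r \<partial>lborel)"
    by (rule nn_integral_cong_AE) (use AE_lborel_neq[of b] in \<open>auto elim!: eventually_mono simp: indicator_def\<close>)
  ultimately show ?thesis by simp
qed

section \<open>Exponential moments\<close>

text \<open>The inequality half of the formula for the moment generating function. It is the half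
  that induction over the generations and Fatou's lemma can transport.\<close>

definition exp_bounded :: "real measure \<Rightarrow> bool" where
  "exp_bounded N \<longleftrightarrow> (\<forall>t. 0 < t \<longrightarrow> t < r_star \<longrightarrow> (\<integral>\<^sup>+x. ennreal (exp (t * x)) \<partial>N) \<le> ennreal (exp (chi t)))"

lemma continuous_on_chi: "continuous_on {0<..<r_star} chi"
  by (rule DERIV_continuous_on) (auto intro: has_field_derivative_at_within has_derivative_chi)

context normalized_distribution
begin

definition exp_levy :: "real \<Rightarrow> ennreal" where
  "exp_levy t = (\<integral>\<^sup>+y. ennreal (exp (t * y)) * ennreal (levy N y) \<partial>lborel)"

lemma exp_levy_eq:
  assumes t: "t > 0"
  shows "ennreal t * exp_levy t = (\<integral>\<^sup>+z. ennreal ((exp (t * z) - 1) / z) * indicator {0<..} z * ennreal (tail N z) \<partial>lborel)"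
proof -
  have "ennreal t * exp_levy t = (\<integral>\<^sup>+y. ennreal t * (ennreal (exp (t * y)) * ennreal (levy N y)) \<partial>lborel)"
    unfolding exp_levy_def by (subst nn_integral_cmult) auto
  also have "\<dots> = (\<integral>\<^sup>+y. ennreal (t * exp (t * y)) * ennreal (levy N y) \<partial>lborel)"
    using t by (intro nn_integral_cong) (simp add: ennreal_mult mult.assoc)
  finally show ?thesis using levy_exp_integral[OF t] by simp
qed

text \<open>The moment bound controls the exponential integral of the tail by (exp
  (\<open>chi\<close> r) - 1) / r. Integration over r in (0, t) yields t * \<open>exp_levy t\<close>
  on the left and \<open>speed (chi t)\<close> on the right, an antiderivative that vanishes at
  0.\<close>

lemma exp_levy_le:
  assumes bd: "exp_bounded N" and t: "0 < t" "t < r_star"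
  shows "exp_levy t \<le> ennreal (speed (chi t) / t)"
proof -
  \<comment> \<open>\<open>chi\<close> is an unspecified choice outside (0, \<open>r_star\<close>);
    the indicator makes f Borel on the line.\<close>
  define f where "f r = indicator {0<..<r_star} r * ((exp (chi r) - 1) / r)" for r
  have fm [measurable]: "f \<in> borel_measurable borel"
  proof -
    have "(\<lambda>r. indicator {0<..<r_star} r *\<^sub>R ((exp (chi r) - 1) / r)) \<in> borel_measurable borel"
      by (intro borel_measurable_continuous_on_indicator continuous_intros continuous_on_chi) auto
    then show ?thesis unfolding f_def[abs_def] by simp
  qed
  have m: "(\<integral>\<^sup>+z. ennreal (exp (r * z)) * indicator {0<..} z * ennreal (tail N z) \<partial>lborel) \<le> ennreal (f r)" if r: "0 < r" "r < r_star" for r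
  proof -
    let ?I = "\<integral>\<^sup>+z. ennreal (exp (r * z)) * indicator {0<..} z * ennreal (tail N z) \<partial>lborel"
    have "1 + ennreal r * ?I = (\<integral>\<^sup>+x. ennreal (exp (r * x)) \<partial>N)"
      unfolding exp_moment_eq[OF r(1)]
      by (subst nn_integral_cmult[symmetric]) (use r in \<open>auto intro!: nn_integral_cong simp: ennreal_mult mult.assoc\<close>)
    also have "\<dots> \<le> ennreal (exp (chi r))" using bd r by (auto simp: exp_bounded_def)
    finally have le: "1 + ennreal r * ?I \<le> ennreal (exp (chi r))" .
    show ?thesis
    proof (cases ?I)
      case (real i)
      then have "ennreal (1 + r * i) \<le> ennreal (exp (chi r))"
        using le r by (simp add: ennreal_mult[symmetric] ennreal_1[symmetric] ennreal_plus[symmetric] del: ennreal_1 ennreal_plus)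
      then have "1 + r * i \<le> exp (chi r)" by (simp add: ennreal_le_iff)
      then have "i \<le> (exp (chi r) - 1) / r" using r by (simp add: pos_le_divide_eq mult.commute)
      then show ?thesis using r real by (simp add: f_def ennreal_leI)
    next
      case top
      then show ?thesis using le r by (simp add: ennreal_mult_top top_unique)
    qed
  qed
  have "ennreal t * exp_levy t = (\<integral>\<^sup>+z. (\<integral>\<^sup>+r. ennreal (exp (r * z)) * indicator {0<..<t} r \<partial>lborel) * (indicator {0<..} z * ennreal (tail N z)) \<partial>lborel)"
    unfolding exp_levy_eq[OF t(1)]
  proof (rule nn_integral_cong)
    fix z :: real
    show "ennreal ((exp (t * z) - 1) / z) * indicator {0<..} z * ennreal (tail N z)
       = (\<integral>\<^sup>+r. ennreal (exp (r * z)) * indicator {0<..<t} r \<partial>lborel) * (indicator {0<..} z * ennreal (tail N z))"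
    proof (cases "z > 0")
      case True
      have "(\<integral>\<^sup>+r. ennreal (exp (r * z)) * indicator {0<..<t} r \<partial>lborel) = ennreal (exp (t * z) / z - exp (0 * z) / z)"
        using t True by (intro nn_integral_Ioo_FTC) (auto intro!: derivative_eq_intros)
      then show ?thesis using True by (simp add: diff_divide_distrib mult.assoc)
    qed simp
  qed
  also have "\<dots> = (\<integral>\<^sup>+z. (\<integral>\<^sup>+r. indicator {0<..<t} r * (ennreal (exp (r * z)) * indicator {0<..} z * ennreal (tail N z)) \<partial>lborel) \<partial>lborel)"
    by (intro nn_integral_cong, subst nn_integral_multc[symmetric]) (auto intro!: nn_integral_cong simp: mult_ac)
  also have "\<dots> = (\<integral>\<^sup>+r. (\<integral>\<^sup>+z. indicator {0<..<t} r * (ennreal (exp (r * z)) * indicator {0<..} z * ennreal (tail N z)) \<partial>lborel) \<partial>lborel)"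
    by (rule lborel_pair.Fubini') measurable
  also have "\<dots> \<le> (\<integral>\<^sup>+r. ennreal (f r) * indicator {0<..<t} r \<partial>lborel)"
  proof (rule nn_integral_mono)
    fix r :: real
    show "(\<integral>\<^sup>+z. indicator {0<..<t} r * (ennreal (exp (r * z)) * indicator {0<..} z * ennreal (tail N z)) \<partial>lborel) \<le> ennreal (f r) * indicator {0<..<t} r"
      using m[of r] t by (cases "r \<in> {0<..<t}") auto
  qed
  also have "\<dots> = ennreal (speed (chi t))"
  proof (rule nn_integral_FTC_open_left[OF fm t(1) _ _ speed_chi_tendsto_0])
    fix r assume r: "0 < r" "r \<le> t"
    then show "((\<lambda>t. speed (chi t)) has_real_derivative f r) (at r)"
      using has_derivative_speed_chi[of r] t by (simp add: f_def)
    show "0 \<le> f r" using r t chi_pos[of r] by (simp add: f_def)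
  qed
  finally have le: "ennreal t * exp_levy t \<le> ennreal (speed (chi t))" .
  show ?thesis
  proof (cases "exp_levy t")
    case (real k)
    then have "t * k \<le> speed (chi t)" using le t speed_pos[OF chi_pos[OF t]] by (simp add: ennreal_mult[symmetric] ennreal_le_iff)
    then show ?thesis using real t by (simp add: ennreal_leI pos_le_divide_eq mult.commute)
  next
    case top
    then show ?thesis using le t by (simp add: ennreal_mult_top top_unique)
  qed
qed

end

context smoothed
begin

text \<open>Gronwall's argument: the size-bias equation for the truncated moment H gives H' <= H *
  \<open>speed (chi s)\<close> / s, where the last factor is the derivative of \<open>chi\<close>,
  so H * exp (- \<open>chi\<close>) is nonincreasing.\<close>

lemma exp_bounded_step:
  assumes bd: "exp_bounded N" shows "exp_bounded N'"
  unfolding exp_bounded_def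
proof (intro allI impI)
  fix t assume t: "0 < t" "t < r_star"
  \<comment> \<open>On [0, A] all moments are finite and differentiable before anything is known
    about the exponential moments of N'.\<close>
  have step: "(\<integral>\<^sup>+x. ennreal (exp (t * x)) * indicator {0..A} x \<partial>N') \<le> ennreal (exp (chi t))" if A: "A > 0" for A
  proof -
    define H where "H s = (\<integral>x. exp (s * x) * indicator {0..A} x \<partial>N')" for s
    define G where "G s = (\<integral>x. x * exp (s * x) * indicator {0..A} x \<partial>N')" for s
    have iH: "integrable N' (\<lambda>x. exp (s * x) * indicator {0..A} x)" for s
    proof (rule N'.integrable_const_bound[of _ "exp (\<bar>s\<bar> * A)"])
      show "AE x in N'. norm (exp (s * x) * indicator {0..A} x) \<le> exp (\<bar>s\<bar> * A)"
        using A by (intro AE_I2) (auto simp: indicator_def intro: order_trans[OF abs_ge_self] mult_mono abs_mult intro!: mult_mono abs_ge_self)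
    qed measurable
    have nH: "ennreal (H s) = (\<integral>\<^sup>+x. ennreal (exp (s * x)) * indicator {0..A} x \<partial>N')" for s
      unfolding H_def by (subst nn_integral_eq_integral[OF iH, symmetric]) (auto intro!: nn_integral_cong simp: indicator_def)
    have iG: "integrable N' (\<lambda>x. x * exp (s * x) * indicator {0..A} x)" if s: "s \<ge> 0" for s
    proof (rule N'.integrable_const_bound[of _ "A * exp (s * A)"])
      show "AE x in N'. norm (x * exp (s * x) * indicator {0..A} x) \<le> A * exp (s * A)"
        using A s by (intro AE_I2) (auto simp: indicator_def abs_mult intro!: mult_mono)
    qed measurable
    have dH: "(H has_real_derivative G s) (at s)" if s: "0 < s" "s < r_star" for s
      unfolding H_def[abs_def] G_def
    proof (rule has_real_derivative_integral[where S="{0<..<r_star}" and w="\<lambda>x. A * exp (r_star * A)"])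
      show "AE y in N'. \<forall>x\<in>{0<..<r_star}. ((\<lambda>x. exp (x * y) * indicator {0..A} y) has_real_derivative y * exp (x * y) * indicator {0..A} y) (at x)
         \<and> \<bar>y * exp (x * y) * indicator {0..A} y\<bar> \<le> A * exp (r_star * A)"
        using A by (intro AE_I2) (auto intro!: derivative_eq_intros mult_mono simp: indicator_def abs_mult)
    qed (use s iH in auto)
    have GH: "G s \<le> H s * (speed (chi s) / s)" if s: "0 < s" "s < r_star" for s
    proof -
      have G0: "0 \<le> G s" unfolding G_def by (intro integral_nonneg_AE AE_I2) (auto simp: indicator_def)
      have H0: "0 \<le> H s" unfolding H_def by (intro integral_nonneg_AE AE_I2) (auto simp: indicator_def)
      have "ennreal (G s) = (\<integral>\<^sup>+x. ennreal x * (ennreal (exp (s * x)) * indicator {0..A} x) \<partial>N')"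
        unfolding G_def using s
        by (subst nn_integral_eq_integral[OF iG, symmetric]) (auto intro!: nn_integral_cong AE_I2 simp: indicator_def ennreal_mult)
      also have "\<dots> = (\<integral>\<^sup>+x. (\<integral>\<^sup>+y. ennreal (levy N y) * (ennreal (exp (s * (x + y))) * indicator {0..A} (x + y)) \<partial>lborel) \<partial>N')"
        by (rule size_biased_nn_integral) measurable
      also have "\<dots> \<le> (\<integral>\<^sup>+x. (ennreal (exp (s * x)) * indicator {0..A} x) * N.exp_levy s \<partial>N')"
      proof (rule nn_integral_mono_AE)
        show "AE x in N'. (\<integral>\<^sup>+y. ennreal (levy N y) * (ennreal (exp (s * (x + y))) * indicator {0..A} (x + y)) \<partial>lborel) \<le> (ennreal (exp (s * x)) * indicator {0..A} x) * N.exp_levy s"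
          using N'.AE_nonneg
        proof eventually_elim
          case (elim x)
          have "(\<integral>\<^sup>+y. ennreal (levy N y) * (ennreal (exp (s * (x + y))) * indicator {0..A} (x + y)) \<partial>lborel)
            \<le> (\<integral>\<^sup>+y. (ennreal (exp (s * x)) * indicator {0..A} x) * (ennreal (exp (s * y)) * ennreal (levy N y)) \<partial>lborel)"
          proof (rule nn_integral_mono)
            fix y :: real
            show "ennreal (levy N y) * (ennreal (exp (s * (x + y))) * indicator {0..A} (x + y))
              \<le> (ennreal (exp (s * x)) * indicator {0..A} x) * (ennreal (exp (s * y)) * ennreal (levy N y))"
            \<comment> \<open>The truncation is compatible with the convolution:
              \<open>levy N\<close> vanishes for y <= 0, and otherwise x + y <= A forces x <=
              A.\<close>
            proof (cases "0 < y \<and> x + y \<le> A")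
              case True
              then show ?thesis using elim by (simp add: ennreal_mult[symmetric] exp_add distrib_left mult_ac)
            next
              case False
              then have "levy N y = 0 \<or> \<not> x + y \<le> A" by (auto simp: levy_def)
              then show ?thesis by (auto simp: indicator_def)
            qed
          qed
          also have "\<dots> = (ennreal (exp (s * x)) * indicator {0..A} x) * N.exp_levy s"
            unfolding N.exp_levy_def by (rule nn_integral_cmult) measurable
          finally show ?case .
        qed
      qed
      also have "\<dots> = ennreal (H s) * N.exp_levy s"
        unfolding nH by (rule nn_integral_multc) measurable
      also have "\<dots> \<le> ennreal (H s) * ennreal (speed (chi s) / s)"
        by (intro mult_left_mono N.exp_levy_le bd s) simp
      also have "\<dots> = ennreal (H s * (speed (chi s) / s))"
        using H0 s speed_pos[OF chi_pos[OF s]] by (simp add: ennreal_mult[symmetric])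
      finally show ?thesis using G0 H0 s speed_pos[OF chi_pos[OF s]] by (simp add: ennreal_le_iff)
    qed
    have H0: "0 \<le> H s" for s unfolding H_def by (intro integral_nonneg_AE AE_I2) (auto simp: indicator_def)
    \<comment> \<open>The comparison starts at e > 0, where H e <= exp (e * A); letting e tend to 0
      gives the initial value 1.\<close>
    have "H t * exp (- chi t) \<le> exp (e * A)" if e: "0 < e" "e < t" for e
    proof -
      have "H t * exp (- chi t) \<le> H e * exp (- chi e)"
      proof (rule DERIV_nonpos_imp_nonincreasing[of e t "\<lambda>s. H s * exp (- chi s)"])
        fix s assume "e \<le> s" "s \<le> t"
        then have s: "0 < s" "s < r_star" using e t by auto
        have "((\<lambda>s. H s * exp (- chi s)) has_real_derivative (G s - H s * (speed (chi s) / s)) * exp (- chi s)) (at s)"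
          by (rule derivative_eq_intros dH[OF s] has_derivative_chi[OF s] refl)+ (simp add: algebra_simps)
        moreover have "(G s - H s * (speed (chi s) / s)) * exp (- chi s) \<le> 0"
          using GH[OF s] by (simp add: mult_nonpos_nonneg)
        ultimately show "\<exists>y. ((\<lambda>s. H s * exp (- chi s)) has_real_derivative y) (at s) \<and> y \<le> 0" by blast
      qed (use e in simp)
      also have "\<dots> \<le> H e" using H0[of e] chi_pos[of e] e t by (simp add: mult_left_le)
      also have "H e \<le> (\<integral>x. exp (e * A) \<partial>N')" unfolding H_def
        by (intro integral_mono iH) (use A e in \<open>auto simp: indicator_def\<close>)
      finally show ?thesis by simp
    qed
    then have "\<forall>\<^sub>F e in at_right 0. H t * exp (- chi t) \<le> exp (e * A)"
      using eventually_at_right_real[OF t(1)] by (auto elim!: eventually_mono)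
    moreover have "((\<lambda>e. exp (e * A)) \<longlongrightarrow> exp (0 * A)) (at_right 0)" by (intro tendsto_intros)
    ultimately have "H t * exp (- chi t) \<le> exp (0 * A)"
      by (intro tendsto_lowerbound[of "\<lambda>e. exp (e * A)" _ "at_right 0"]) auto
    then have "H t \<le> exp (chi t)" by (simp add: exp_minus field_simps)
    then show ?thesis unfolding nH[symmetric] by (rule ennreal_leI)
  qed
  have "(\<lambda>n. \<integral>\<^sup>+x. ennreal (exp (t * x)) * indicator {0..real (Suc n)} x \<partial>N') \<longlonglongrightarrow> (\<integral>\<^sup>+x. ennreal (exp (t * x)) * indicator {0..} x \<partial>N')"
  proof (rule nn_integral_LIMSEQ)
    show "incseq (\<lambda>n x. ennreal (exp (t * x)) * indicator {0..real (Suc n)} x)"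
      by (intro incseq_SucI le_funI mult_left_mono) (auto simp: indicator_def)
    show "(\<lambda>n. ennreal (exp (t * x)) * indicator {0..real (Suc n)} x) \<longlonglongrightarrow> ennreal (exp (t * x)) * indicator {0..} x" for x
    proof (rule tendsto_eventually)
      have "\<forall>\<^sub>F n in sequentially. x \<le> real (Suc n)" by real_asymp
      then show "\<forall>\<^sub>F n in sequentially. ennreal (exp (t * x)) * indicator {0..real (Suc n)} x = ennreal (exp (t * x)) * indicator {0..} x"
        by eventually_elim (auto simp: indicator_def)
    qed
  qed measurable
  then have "(\<integral>\<^sup>+x. ennreal (exp (t * x)) * indicator {0..} x \<partial>N') \<le> ennreal (exp (chi t))"
    by (rule LIMSEQ_le_const2) (use step in auto)
  moreover have "(\<integral>\<^sup>+x. ennreal (exp (t * x)) * indicator {0..} x \<partial>N') = (\<integral>\<^sup>+x. ennreal (exp (t * x)) \<partial>N')"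
    by (rule nn_integral_cong_AE) (use N'.AE_nonneg in \<open>auto elim!: eventually_mono\<close>)
  ultimately show "(\<integral>\<^sup>+x. ennreal (exp (t * x)) \<partial>N') \<le> ennreal (exp (chi t))" by simp
qed

end

lemma (in brw) exp_bounded_law: "exp_bounded (law n)"
proof (induction n)
  case 0
  then show ?case unfolding exp_bounded_def law_0 using chi_ge by (auto intro!: ennreal_leI)
next
  case (Suc n)
  interpret smoothed "law n" "law (Suc n)"
    using normalized_law smoothing_law by (auto simp: smoothed_def smoothed_axioms_def normalized_iff)
  show ?case using Suc by (rule exp_bounded_step)
qed

locale fixed_point = smoothed N N for N +
  assumes exp_bounded: "exp_bounded N"

lemma (in brw_limit) fixed_point_mu: "fixed_point mu"
proof -
  have "exp_bounded mu" unfolding exp_bounded_def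
    using exp_moment_le exp_bounded_law unfolding exp_bounded_def by blast
  then show ?thesis using normalized_mu smoothing_mu
    by (auto simp: fixed_point_def fixed_point_axioms_def smoothed_def smoothed_axioms_def normalized_iff)
qed


lemma (in nonneg_distribution) integrable_ident_exp:
  assumes "(\<integral>\<^sup>+x. ennreal x * ennreal (exp (t * x)) \<partial>N) < \<top>"
  shows "integrable N (\<lambda>x. x * exp (t * x))"
proof (rule integrableI_bounded)
  have "(\<integral>\<^sup>+x. ennreal (norm (x * exp (t * x))) \<partial>N) = (\<integral>\<^sup>+x. ennreal x * ennreal (exp (t * x)) \<partial>N)"
    by (rule nn_integral_cong_AE) (use AE_nonneg in \<open>auto elim!: eventually_mono simp: abs_mult ennreal_mult\<close>)
  then show "(\<integral>\<^sup>+x. ennreal (norm (x * exp (t * x))) \<partial>N) < \<infinity>" using assms by simp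
qed measurable

section \<open>The moment generating function of the fixed point\<close>

context fixed_point
begin

definition mgf :: "real \<Rightarrow> real" where
  "mgf t = (\<integral>x. exp (t * x) \<partial>N)"

definition mlevy :: "real \<Rightarrow> real" where
  "mlevy t = (\<integral>y. exp (t * y) * levy N y \<partial>lborel)"

definition mtail :: "real \<Rightarrow> real" where
  "mtail t = (\<integral>z. exp (t * z) * indicator {0<..} z * tail N z \<partial>lborel)"

context
  fixes t :: real assumes t: "0 < t" "t < r_star"
begin

lemma integrable_mgf: "integrable N (\<lambda>x. exp (t * x))"
proof (rule integrableI_nonneg)
  show "(\<integral>\<^sup>+x. ennreal (exp (t * x)) \<partial>N) < \<infinity>"
    using exp_bounded t unfolding exp_bounded_def by (metis ennreal_less_top infinity_ennreal_def le_less_trans)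
qed auto

lemma mgf_nn: "ennreal (mgf t) = (\<integral>\<^sup>+x. ennreal (exp (t * x)) \<partial>N)"
  unfolding mgf_def by (rule nn_integral_eq_integral[symmetric]) (use integrable_mgf in auto)

lemma mgf_le: "mgf t \<le> exp (chi t)"
  using exp_bounded t unfolding exp_bounded_def mgf_nn[symmetric] by (metis ennreal_le_iff exp_ge_zero mgf_nn)

lemma mgf_ge: "1 + t \<le> mgf t"
proof -
  have "(\<integral>x. x \<partial>N) = 1"
  proof -
    have "ennreal (\<integral>x. x \<partial>N) = (\<integral>\<^sup>+x. ennreal x \<partial>N)"
      by (rule nn_integral_eq_integral[symmetric]) (use N.integrable_id N.AE_nonneg in auto)
    then have "ennreal (\<integral>x. x \<partial>N) = ennreal 1" using N.mean by simp
    moreover have "0 \<le> (\<integral>x. x \<partial>N)" by (rule integral_nonneg_AE) (rule N.AE_nonneg)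
    ultimately show ?thesis by (subst (asm) ennreal_inj) auto
  qed
  then have "1 + t = (\<integral>x. 1 + t * x \<partial>N)"
    using N.integrable_id by (subst Bochner_Integration.integral_add) auto
  also have "\<dots> \<le> mgf t" unfolding mgf_def
    by (rule integral_mono) (use N.integrable_id integrable_mgf exp_ge_add_one_self in auto)
  finally show ?thesis .
qed

lemma exp_levy_finite: "N.exp_levy t < \<top>"
  using N.exp_levy_le[OF exp_bounded t] by (metis ennreal_less_top le_less_trans)

lemma integrable_mlevy: "integrable lborel (\<lambda>y. exp (t * y) * levy N y)"
proof (rule integrableI_nonneg)
  show "(\<integral>\<^sup>+y. ennreal (exp (t * y) * levy N y) \<partial>lborel) < \<infinity>"
    using exp_levy_finite by (simp add: N.exp_levy_def ennreal_mult)
qed auto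

lemma mlevy_nn: "ennreal (mlevy t) = N.exp_levy t"
  unfolding mlevy_def N.exp_levy_def
  by (subst nn_integral_eq_integral[OF integrable_mlevy, symmetric]) (auto simp: ennreal_mult)

lemma mlevy_nonneg: "0 \<le> mlevy t"
  unfolding mlevy_def by (intro integral_nonneg_AE AE_I2) simp

lemma mlevy_le: "mlevy t \<le> speed (chi t) / t"
  using N.exp_levy_le[OF exp_bounded t] speed_pos[OF chi_pos[OF t]] t
  unfolding mlevy_nn[symmetric] by (simp add: ennreal_le_iff)

lemma mtail_nn: "ennreal t * (\<integral>\<^sup>+z. ennreal (exp (t * z) * indicator {0<..} z * tail N z) \<partial>lborel) + 1 = ennreal (mgf t)"
proof -
  have "ennreal t * (\<integral>\<^sup>+z. ennreal (exp (t * z) * indicator {0<..} z * tail N z) \<partial>lborel)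
    = (\<integral>\<^sup>+z. ennreal (t * exp (t * z)) * indicator {0<..} z * ennreal (tail N z) \<partial>lborel)"
    by (subst nn_integral_cmult[symmetric]) (use t in \<open>auto intro!: nn_integral_cong simp: ennreal_mult indicator_def mult.assoc\<close>)
  then show ?thesis unfolding mgf_nn using N.exp_moment_eq[OF t(1)] by (simp add: add.commute)
qed

lemma integrable_mtail: "integrable lborel (\<lambda>z. exp (t * z) * indicator {0<..} z * tail N z)"
proof (rule integrableI_nonneg)
  show "(\<integral>\<^sup>+z. ennreal (exp (t * z) * indicator {0<..} z * tail N z) \<partial>lborel) < \<infinity>"
  proof (rule ccontr)
    assume "\<not> ?thesis"
    then have "(\<integral>\<^sup>+z. ennreal (exp (t * z) * indicator {0<..} z * tail N z) \<partial>lborel) = \<top>" by (simp add: not_less top_unique)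
    then have "ennreal t * (\<integral>\<^sup>+z. ennreal (exp (t * z) * indicator {0<..} z * tail N z) \<partial>lborel) = \<top>"
      using t by (simp add: ennreal_mult_top)
    then show False using mtail_nn by simp
  qed
qed auto

lemma mtail_eq: "mtail t = (mgf t - 1) / t"
proof -
  have "(\<integral>\<^sup>+z. ennreal (exp (t * z) * indicator {0<..} z * tail N z) \<partial>lborel) = ennreal (mtail t)"
    unfolding mtail_def by (rule nn_integral_eq_integral) (use integrable_mtail in auto)
  moreover have m0: "0 \<le> mtail t" unfolding mtail_def by (intro integral_nonneg_AE AE_I2) simp
  ultimately have "ennreal (t * mtail t + 1) = ennreal (mgf t)"
    using mtail_nn t by (simp add: ennreal_mult[symmetric] ennreal_1[symmetric] ennreal_plus[symmetric] del: ennreal_1 ennreal_plus)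
  then have "t * mtail t + 1 = mgf t"
    using mgf_ge t m0 by (subst (asm) ennreal_inj) auto
  then show ?thesis using t by (simp add: field_simps)
qed

lemma size_biased_mgf_nn: "(\<integral>\<^sup>+x. ennreal x * ennreal (exp (t * x)) \<partial>N) = ennreal (mgf t * mlevy t)"
proof -
  have "(\<integral>\<^sup>+x. ennreal x * ennreal (exp (t * x)) \<partial>N) = (\<integral>\<^sup>+x. (\<integral>\<^sup>+y. ennreal (levy N y) * ennreal (exp (t * (x + y))) \<partial>lborel) \<partial>N)"
    by (rule size_biased_nn_integral) measurable
  also have "\<dots> = (\<integral>\<^sup>+x. ennreal (exp (t * x)) * N.exp_levy t \<partial>N)"
    unfolding N.exp_levy_def
    by (intro nn_integral_cong, subst nn_integral_cmult[symmetric])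
       (auto intro!: nn_integral_cong simp: ennreal_mult[symmetric] exp_add distrib_left mult_ac)
  also have "\<dots> = ennreal (mgf t) * ennreal (mlevy t)"
    unfolding mgf_nn mlevy_nn by (rule nn_integral_multc) measurable
  finally show ?thesis using mgf_ge t mlevy_nonneg by (simp add: ennreal_mult)
qed

lemma integrable_size_biased_mgf: "integrable N (\<lambda>x. x * exp (t * x))"
  by (rule N.integrable_ident_exp) (simp add: size_biased_mgf_nn)

lemma size_biased_mgf: "(\<integral>x. x * exp (t * x) \<partial>N) = mgf t * mlevy t"
proof -
  have "ennreal (\<integral>x. x * exp (t * x) \<partial>N) = (\<integral>\<^sup>+x. ennreal (x * exp (t * x)) \<partial>N)"
    by (rule nn_integral_eq_integral[symmetric])
       (use integrable_size_biased_mgf N.AE_nonneg in \<open>auto elim!: eventually_mono\<close>)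
  also have "\<dots> = (\<integral>\<^sup>+x. ennreal x * ennreal (exp (t * x)) \<partial>N)"
    by (rule nn_integral_cong_AE) (use N.AE_nonneg in \<open>auto elim!: eventually_mono simp: ennreal_mult\<close>)
  finally have "ennreal (\<integral>x. x * exp (t * x) \<partial>N) = ennreal (mgf t * mlevy t)" using size_biased_mgf_nn by simp
  moreover have "0 \<le> (\<integral>x. x * exp (t * x) \<partial>N)"
    by (rule integral_nonneg_AE) (use N.AE_nonneg in \<open>auto elim!: eventually_mono\<close>)
  moreover have "0 \<le> mgf t * mlevy t" using mgf_ge t mlevy_nonneg by simp
  ultimately show ?thesis by (subst (asm) ennreal_inj) auto
qed

lemma t_mlevy: "t * mlevy t = (\<integral>z. (exp (t * z) - 1) / z * indicator {0<..} z * tail N z \<partial>lborel)"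
  and integrable_t_mlevy: "integrable lborel (\<lambda>z. (exp (t * z) - 1) / z * indicator {0<..} z * tail N z)"
proof -
  have nn: "0 \<le> (exp (t * z) - 1) / z * indicator {0<..} z * tail N z" for z
    using t by (auto simp: indicator_def)
  have "ennreal (t * mlevy t) = (\<integral>\<^sup>+z. ennreal ((exp (t * z) - 1) / z) * indicator {0<..} z * ennreal (tail N z) \<partial>lborel)"
    using N.exp_levy_eq[OF t(1)] mlevy_nn t mlevy_nonneg by (simp add: ennreal_mult)
  also have "\<dots> = (\<integral>\<^sup>+z. ennreal ((exp (t * z) - 1) / z * indicator {0<..} z * tail N z) \<partial>lborel)"
    using t by (intro nn_integral_cong) (auto simp: indicator_def ennreal_mult[symmetric])
  finally have eq: "(\<integral>\<^sup>+z. ennreal ((exp (t * z) - 1) / z * indicator {0<..} z * tail N z) \<partial>lborel) = ennreal (t * mlevy t)" by simp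
  show i: "integrable lborel (\<lambda>z. (exp (t * z) - 1) / z * indicator {0<..} z * tail N z)"
    by (rule integrableI_nonneg) (use nn eq in auto)
  have "ennreal (t * mlevy t) = ennreal (\<integral>z. (exp (t * z) - 1) / z * indicator {0<..} z * tail N z \<partial>lborel)"
    unfolding eq[symmetric] by (rule nn_integral_eq_integral) (use i nn in auto)
  then show "t * mlevy t = (\<integral>z. (exp (t * z) - 1) / z * indicator {0<..} z * tail N z \<partial>lborel)"
    using t mlevy_nonneg nn by (subst (asm) ennreal_inj) (auto intro!: integral_nonneg_AE)
qed

end

lemma has_derivative_mgf:
  assumes t: "0 < t" "t < r_star"
  shows "(mgf has_real_derivative mgf t * mlevy t) (at t)"
  unfolding mgf_def[abs_def] size_biased_mgf[OF t, symmetric, unfolded mgf_def]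
proof -
  define u where "u = (t + r_star) / 2"
  have u: "0 < u" "u < r_star" "t < u" using t by (auto simp: u_def)
  show "((\<lambda>t. \<integral>x. exp (t * x) \<partial>N) has_real_derivative (\<integral>x. x * exp (t * x) \<partial>N)) (at t)"
  proof (rule has_real_derivative_integral[where S="{0<..<u}" and w="\<lambda>x. \<bar>x * exp (u * x)\<bar>"])
    show "AE y in N. \<forall>x\<in>{0<..<u}. ((\<lambda>x. exp (x * y)) has_real_derivative y * exp (x * y)) (at x) \<and> \<bar>y * exp (x * y)\<bar> \<le> \<bar>y * exp (u * y)\<bar>"
      using N.AE_nonneg
      by eventually_elim (auto intro!: derivative_eq_intros mult_left_mono mult_right_mono simp: abs_mult)
    show "integrable N (\<lambda>x. \<bar>x * exp (u * x)\<bar>)"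
      by (intro integrable_abs integrable_size_biased_mgf u)
    show "integrable N (\<lambda>y. exp (x * y))" if "x \<in> {0<..<u}" for x using that u by (intro integrable_mgf) auto
  qed (use t u in auto)
qed

lemma has_derivative_t_mlevy:
  assumes t: "0 < t" "t < r_star"
  shows "((\<lambda>t. t * mlevy t) has_real_derivative (mgf t - 1) / t) (at t)"
proof -
  define u where "u = (t + r_star) / 2"
  have u: "0 < u" "u < r_star" "t < u" using t by (auto simp: u_def)
  have "((\<lambda>t. \<integral>z. (exp (t * z) - 1) / z * indicator {0<..} z * tail N z \<partial>lborel) has_real_derivative
     (\<integral>z. exp (t * z) * indicator {0<..} z * tail N z \<partial>lborel)) (at t)"
  proof (rule has_real_derivative_integral[where S="{0<..<u}" and w="\<lambda>z. exp (u * z) * indicator {0<..} z * tail N z"])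
    show "AE y in lborel. \<forall>x\<in>{0<..<u}. ((\<lambda>x. (exp (x * y) - 1) / y * indicator {0<..} y * tail N y) has_real_derivative exp (x * y) * indicator {0<..} y * tail N y) (at x)
       \<and> \<bar>exp (x * y) * indicator {0<..} y * tail N y\<bar> \<le> exp (u * y) * indicator {0<..} y * tail N y"
    proof (intro AE_I2 ballI)
      fix y x assume x: "x \<in> {0<..<u}"
      show "((\<lambda>x. (exp (x * y) - 1) / y * indicator {0<..} y * tail N y) has_real_derivative exp (x * y) * indicator {0<..} y * tail N y) (at x)
       \<and> \<bar>exp (x * y) * indicator {0<..} y * tail N y\<bar> \<le> exp (u * y) * indicator {0<..} y * tail N y"
      proof (cases "y > 0")
        case True
        then show ?thesis using x
          by (auto intro!: derivative_eq_intros mult_right_mono simp: abs_mult)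
      qed auto
    qed
    show "integrable lborel (\<lambda>z. (exp (x * z) - 1) / z * indicator {0<..} z * tail N z)" if "x \<in> {0<..<u}" for x
      using that u by (intro integrable_t_mlevy) auto
    show "integrable lborel (\<lambda>z. exp (u * z) * indicator {0<..} z * tail N z)" by (intro integrable_mtail u)
  qed (use t u in auto)
  then have "((\<lambda>t. \<integral>z. (exp (t * z) - 1) / z * indicator {0<..} z * tail N z \<partial>lborel) has_real_derivative (mgf t - 1) / t) (at t)"
    using mtail_eq[OF t] by (simp add: mtail_def)
  moreover have "\<forall>\<^sub>F s in nhds t. s * mlevy s = (\<integral>z. (exp (s * z) - 1) / z * indicator {0<..} z * tail N z \<partial>lborel)"
    using eventually_nhds_in_open[of "{0<..<r_star}" t] t by (auto elim!: eventually_mono simp: t_mlevy)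
  ultimately show ?thesis by (subst DERIV_cong_ev[OF refl _ refl])
qed

lemma ln_mgf_bounds:
  assumes t: "0 < t" "t < r_star"
  shows "ln (1 + t) \<le> ln (mgf t)" "ln (mgf t) \<le> chi t" "0 < ln (mgf t)"
proof -
  have m: "1 + t \<le> mgf t" by (rule mgf_ge[OF t])
  show 1: "ln (1 + t) \<le> ln (mgf t)" using m t by simp
  have "ln (mgf t) \<le> ln (exp (chi t))" using mgf_le[OF t] m t by (subst ln_le_cancel_iff) auto
  then show "ln (mgf t) \<le> chi t" by simp
  show "0 < ln (mgf t)" using m t by simp
qed

lemma eventually_at_right_range: "\<forall>\<^sub>F t in at_right 0. 0 < t \<and> t < r_star"
  using eventually_at_right_real[OF r_star_pos] by simp

lemma ln_mgf_tendsto_0: "((\<lambda>t. ln (mgf t)) \<longlongrightarrow> 0) (at_right 0)"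
proof (rule tendsto_sandwich)
  show "\<forall>\<^sub>F t in at_right 0. 0 \<le> ln (mgf t)" using eventually_at_right_range
    by eventually_elim (use ln_mgf_bounds in \<open>auto intro: less_imp_le\<close>)
  show "\<forall>\<^sub>F t in at_right 0. ln (mgf t) \<le> chi t" using eventually_at_right_range
    by eventually_elim (use ln_mgf_bounds in auto)
qed (use chi_tendsto_0 in auto)

text \<open>Energy conservation for the equation g'' = exp g - 1 in logarithmic time.\<close>
lemma t_mlevy_eq_speed:
  assumes t: "0 < t" "t < r_star"
  shows "t * mlevy t = speed (ln (mgf t))"
proof -
  \<comment> \<open>In the time variable ln t, the height ln \<open>mgf\<close> has velocity t *
    \<open>mlevy t\<close> and acceleration \<open>mgf t\<close> - 1.\<close>
  define E where "E t = (t * mlevy t)\<^sup>2 - 2 * (mgf t - ln (mgf t) - 1)" for t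
  have "(E has_real_derivative 0) (at s within {0<..<r_star})" if s: "s \<in> {0<..<r_star}" for s
  proof -
    have s': "0 < s" "s < r_star" using s by auto
    have m: "mgf s > 0" using mgf_ge[OF s'] s' by simp
    have g: "((\<lambda>s. ln (mgf s)) has_real_derivative 1 / mgf s * (mgf s * mlevy s)) (at s)"
      by (rule DERIV_chain2[OF DERIV_ln_divide[OF m] has_derivative_mgf[OF s']])
    have "(E has_real_derivative real 2 * ((mgf s - 1) / s * (s * mlevy s) ^ (2 - Suc 0)) - 2 * (mgf s * mlevy s - 1 / mgf s * (mgf s * mlevy s) - 0)) (at s)"
      unfolding E_def[abs_def]
      by (intro DERIV_diff DERIV_cmult DERIV_power DERIV_const has_derivative_t_mlevy s' has_derivative_mgf g)
    moreover have "real 2 * ((mgf s - 1) / s * (s * mlevy s) ^ (2 - Suc 0)) - 2 * (mgf s * mlevy s - 1 / mgf s * (mgf s * mlevy s) - 0) = 0"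
    proof -
      have "(mgf s - 1) / s * (s * mlevy s) = (mgf s - 1) * mlevy s" "1 / mgf s * (mgf s * mlevy s) = mlevy s"
        using m s' by simp_all
      then show ?thesis by (simp add: left_diff_distrib)
    qed
    ultimately show ?thesis by (simp only: has_field_derivative_at_within)
  qed
  then obtain c where c: "E s = c" if "s \<in> {0<..<r_star}" for s
    using has_field_derivative_zero_constant[of "{0<..<r_star}" E] by auto
  have l1: "((\<lambda>s. s * mlevy s) \<longlongrightarrow> 0) (at_right 0)"
  proof (rule tendsto_sandwich)
    show "\<forall>\<^sub>F t in at_right 0. 0 \<le> t * mlevy t" using eventually_at_right_range
      by eventually_elim (use mlevy_nonneg in auto)
    show "\<forall>\<^sub>F t in at_right 0. t * mlevy t \<le> speed (chi t)" using eventually_at_right_range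
    proof eventually_elim
      case (elim t)
      then show ?case using mlevy_le[of t] by (simp add: pos_le_divide_eq mult.commute)
    qed
  qed (use speed_chi_tendsto_0 in auto)
  have l2: "(mgf \<longlongrightarrow> 1) (at_right 0)"
  proof (rule Lim_transform_eventually)
    show "((\<lambda>s. exp (ln (mgf s))) \<longlongrightarrow> 1) (at_right 0)"
      using tendsto_exp[OF ln_mgf_tendsto_0] by simp
    show "\<forall>\<^sub>F s in at_right 0. exp (ln (mgf s)) = mgf s" using eventually_at_right_range
    proof eventually_elim
      case (elim s)
      then show ?case using mgf_ge[of s] by simp
    qed
  qed
  \<comment> \<open>Velocity and height both vanish as t tends to 0, so the constant energy is
    0.\<close>
  have "(E \<longlongrightarrow> 0\<^sup>2 - 2 * (1 - 0 - 1)) (at_right 0)"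
    unfolding E_def[abs_def]
    by (intro tendsto_diff tendsto_power tendsto_mult tendsto_const l1 l2 ln_mgf_tendsto_0)
  moreover have "(E \<longlongrightarrow> c) (at_right 0)"
    by (rule tendsto_eventually) (use eventually_at_right_range c in \<open>auto elim!: eventually_mono\<close>)
  ultimately have "c = 0" using tendsto_unique[of "at_right (0::real)"] by fastforce
  then have "E t = 0" using c t by auto
  moreover have "exp (ln (mgf t)) = mgf t" using mgf_ge[OF t] t by simp
  ultimately have "(t * mlevy t)\<^sup>2 = (speed (ln (mgf t)))\<^sup>2"
    using speed_square[of "ln (mgf t)"] ln_mgf_bounds(3)[OF t] by (simp add: E_def)
  moreover have "0 \<le> t * mlevy t" "0 \<le> speed (ln (mgf t))"
    using t mlevy_nonneg speed_pos[OF ln_mgf_bounds(3)[OF t]] by auto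
  ultimately show ?thesis by (simp add: power2_eq_iff_nonneg)
qed

text \<open>By \<open>t_mlevy_eq_speed\<close>, ln \<open>mgf\<close> solves the same first order
  equation as \<open>chi\<close>, so \<open>log_time\<close> of it minus ln t is constant. A time
  shift is excluded by the sandwich ln (1 + t) <= ln \<open>mgf\<close> <= \<open>chi\<close> t,
  whose two ends are equivalent to t at 0.\<close>

theorem ln_mgf_eq_chi:
  assumes t: "0 < t" "t < r_star"
  shows "ln (mgf t) = chi t"
proof -
  define L where "L t = log_time (ln (mgf t)) - ln t" for t
  have "(L has_real_derivative 0) (at s within {0<..<r_star})" if s: "s \<in> {0<..<r_star}" for s
  proof -
    have s': "0 < s" "s < r_star" using s by auto
    have m: "mgf s > 0" using mgf_ge[OF s'] s' by simp
    have g: "((\<lambda>s. ln (mgf s)) has_real_derivative mlevy s) (at s)"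
      by (rule derivative_eq_intros has_derivative_mgf[OF s'] refl m)+ (use m in simp)
    have "((\<lambda>s. log_time (ln (mgf s))) has_real_derivative 1 / speed (ln (mgf s)) * mlevy s) (at s)"
      by (rule DERIV_chain2[OF has_derivative_log_time[OF ln_mgf_bounds(3)[OF s']] g])
    then have "(L has_real_derivative 1 / speed (ln (mgf s)) * mlevy s - 1 / s) (at s)"
      unfolding L_def[abs_def] using s' by (auto intro!: derivative_eq_intros)
    moreover have "1 / speed (ln (mgf s)) * mlevy s - 1 / s = 0"
      unfolding t_mlevy_eq_speed[OF s', symmetric]
      using s' speed_pos[OF ln_mgf_bounds(3)[OF s']] t_mlevy_eq_speed[OF s'] by (auto simp: field_simps)
    ultimately show ?thesis by (simp add: has_field_derivative_at_within)
  qed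
  then obtain c where c: "L s = c" if "s \<in> {0<..<r_star}" for s
    using has_field_derivative_zero_constant[of "{0<..<r_star}" L] by auto
  have lt: "((\<lambda>t. log_time (h t) - ln (h t)) \<longlongrightarrow> 0) (at_right 0)"
    if "(h \<longlongrightarrow> 0) (at_right 0)" "\<forall>\<^sub>F t in at_right 0. 0 < h t" for h
    by (rule filterlim_compose[OF log_time_minus_ln_tendsto]) (use that in \<open>auto simp: filterlim_at elim!: eventually_mono\<close>)
  have 1: "((\<lambda>t. log_time (ln (mgf t)) - ln (ln (mgf t))) \<longlongrightarrow> 0) (at_right 0)"
    by (rule lt[OF ln_mgf_tendsto_0]) (use eventually_at_right_range ln_mgf_bounds(3) in \<open>auto elim!: eventually_mono\<close>)
  have 2: "((\<lambda>t. log_time (chi t) - ln (chi t)) \<longlongrightarrow> 0) (at_right 0)"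
    by (rule lt[OF chi_tendsto_0]) (use eventually_at_right_range chi_pos in \<open>auto elim!: eventually_mono\<close>)
  have 3: "((\<lambda>t. ln (ln (mgf t)) - ln t) \<longlongrightarrow> 0) (at_right 0)"
  proof (rule tendsto_sandwich)
    show "((\<lambda>t::real. ln (ln (1 + t)) - ln t) \<longlongrightarrow> 0) (at_right 0)" by real_asymp
    show "\<forall>\<^sub>F t in at_right 0. ln (ln (1 + t)) - ln t \<le> ln (ln (mgf t)) - ln t" using eventually_at_right_range
    proof eventually_elim
      case (elim t)
      then show ?case using ln_mgf_bounds[of t] by simp
    qed
    show "((\<lambda>t. - (log_time (chi t) - ln (chi t))) \<longlongrightarrow> 0) (at_right 0)" using tendsto_minus[OF 2] by simp
    show "\<forall>\<^sub>F t in at_right 0. ln (ln (mgf t)) - ln t \<le> - (log_time (chi t) - ln (chi t))" using eventually_at_right_range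
    proof eventually_elim
      case (elim t)
      then show ?case using ln_mgf_bounds[of t] log_time_chi[of t] chi_pos[of t] by simp
    qed
  qed
  have "(L \<longlongrightarrow> 0 + 0) (at_right 0)"
    using tendsto_add[OF 1 3] unfolding L_def[abs_def] by simp
  moreover have "(L \<longlongrightarrow> c) (at_right 0)"
    by (rule tendsto_eventually) (use eventually_at_right_range c in \<open>auto elim!: eventually_mono\<close>)
  ultimately have "c = 0" using tendsto_unique[of "at_right (0::real)"] by fastforce
  then have "log_time (ln (mgf t)) = log_time (chi t)" using c[of t] t log_time_chi[OF t] by (simp add: L_def)
  then show ?thesis using log_time_inj ln_mgf_bounds(3)[OF t] chi_pos[OF t] by blast
qed

end

section \<open>The upper tail\<close>

lemma nonneg_distribution_erlang:
  assumes l: "0 < l" shows "nonneg_distribution (density lborel (\<lambda>x. ennreal (erlang_density k l x)))"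
proof (intro nonneg_distribution.intro nonneg_distribution_axioms.intro real_distribution.intro real_distribution_axioms.intro)
  show "prob_space (density lborel (\<lambda>x. ennreal (erlang_density k l x)))"
    using prob_space_erlang_density[OF l, of k] by simp
  show "AE x in density lborel (\<lambda>x. ennreal (erlang_density k l x)). 0 \<le> x"
    by (subst AE_density) (auto simp: erlang_density_def)
qed simp

lemma laplace_erlang:
  assumes l: "0 < l" and s: "0 \<le> s"
  shows "laplace (density lborel (\<lambda>x. ennreal (erlang_density k l x))) s = (l / (l + s)) ^ Suc k"
proof -
  have ls: "l + s > 0" using l s by simp
  interpret P: prob_space "density lborel (\<lambda>x. ennreal (erlang_density k (l + s) x))"
    using prob_space_erlang_density[OF ls, of k] by simp
  have "laplace (density lborel (\<lambda>x. ennreal (erlang_density k l x))) s = (\<integral>x. erlang_density k l x * exp (- (s * x)) \<partial>lborel)"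
    unfolding laplace_def using l by (subst integral_density) (auto simp: erlang_density_nonneg)
  also have "\<dots> = (\<integral>x. (l / (l + s)) ^ Suc k * erlang_density k (l + s) x \<partial>lborel)"
  proof (rule Bochner_Integration.integral_cong)
    fix x :: real
    have "exp (- (l * x)) * exp (- (s * x)) = exp (- ((l + s) * x))" by (simp add: exp_add[symmetric] algebra_simps)
    then show "erlang_density k l x * exp (- (s * x)) = (l / (l + s)) ^ Suc k * erlang_density k (l + s) x"
      using l s by (auto simp: erlang_density_def power_divide field_simps simp del: power_Suc)
  qed simp
  also have "\<dots> = (l / (l + s)) ^ Suc k * (\<integral>x. 1 \<partial>density lborel (\<lambda>x. ennreal (erlang_density k (l + s) x)))"
    using ls by (subst integral_density) (auto simp: erlang_density_nonneg)
  also have "(\<integral>x. 1 \<partial>density lborel (\<lambda>x. ennreal (erlang_density k (l + s) x))) = (1::real)"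
    using P.prob_space by simp
  finally show ?thesis by simp
qed

lemma filterlim_chi_at_top: "filterlim chi at_top (at_left r_star)"
  unfolding filterlim_at_top
proof
  fix Z :: real
  define B where "B = max Z 1"
  have "exp (log_time B) < r_star" using log_time_less[of B] r_star_pos by (metis B_def exp_less_cancel_iff exp_ln less_max_iff_disj zero_less_one)
  then have "\<forall>\<^sub>F t in at_left r_star. t \<in> {exp (log_time B)<..<r_star}" by (rule eventually_at_left_real)
  then show "\<forall>\<^sub>F t in at_left r_star. Z \<le> chi t"
  proof eventually_elim
    case (elim t)
    then have t: "0 < t" "t < r_star" by (auto intro: less_trans[OF exp_gt_zero])
    have "log_time B < ln t" using elim t by (metis exp_less_cancel_iff exp_ln greaterThanLessThan_iff)
    then have "log_time B < log_time (chi t)" using log_time_chi[OF t] by simp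
    then have "\<not> chi t < B" using log_time_strict_mono[OF chi_pos[OF t], of B] by auto
    then show ?case by (simp add: B_def)
  qed
qed

text \<open>Both bounds of \<open>time_left\<close> are squared. The limit says that exp x behaves
  like 2 / (time to explosion)^2, the source of the double pole.\<close>

lemma exp_time_left_tendsto: "((\<lambda>x. exp x * (time_left x)\<^sup>2) \<longlongrightarrow> 2) at_top"
proof (rule tendsto_sandwich)
  have lt1: "\<forall>\<^sub>F x in at_top. (x + 1) * exp (- x) < (1::real)" by real_asymp
  show "\<forall>\<^sub>F x in at_top. 2 \<le> exp x * (time_left x)\<^sup>2" using eventually_gt_at_top[of 0]
  proof eventually_elim
    case (elim x)
    have "(sqrt 2 * exp (- (x / 2)))\<^sup>2 \<le> (time_left x)\<^sup>2"
      by (rule power_mono[OF time_left_bounds(1)[OF elim]]) simp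
    then have "2 * exp (- x) \<le> (time_left x)\<^sup>2" by (simp add: power_mult_distrib exp_double[symmetric])
    then have "exp x * (2 * exp (- x)) \<le> exp x * (time_left x)\<^sup>2" by (intro mult_left_mono) auto
    moreover have "exp x * (2 * exp (- x)) = 2" by (simp add: exp_minus)
    ultimately show ?case by (simp only:)
  qed
  show "\<forall>\<^sub>F x in at_top. exp x * (time_left x)\<^sup>2 \<le> 2 / (1 - (x + 1) * exp (- x))"
    using eventually_gt_at_top[of 0] lt1
  proof eventually_elim
    case (elim x)
    have "0 \<le> time_left x" using time_left_bounds(1)[OF elim(1)] by (rule order_trans[rotated]) simp
    then have "(time_left x)\<^sup>2 \<le> (sqrt 2 * exp (- (x / 2)) / sqrt (1 - (x + 1) * exp (- x)))\<^sup>2"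
      by (rule power_mono[OF time_left_bounds(2)[OF elim(1)]])
    also have "\<dots> = 2 * exp (- x) / (1 - (x + 1) * exp (- x))"
      using elim by (simp add: power_mult_distrib power_divide exp_double[symmetric])
    finally have "exp x * (time_left x)\<^sup>2 \<le> exp x * (2 * exp (- x) / (1 - (x + 1) * exp (- x)))" by (intro mult_left_mono) auto
    also have "exp x * (2 * exp (- x) / (1 - (x + 1) * exp (- x))) = (exp x * exp (- x)) * 2 / (1 - (x + 1) * exp (- x))" by simp
    also have "exp x * exp (- x) = 1" by (simp add: exp_minus)
    finally show ?case by simp
  qed
  show "((\<lambda>x::real. 2 / (1 - (x + 1) * exp (- x))) \<longlongrightarrow> 2) at_top" by real_asymp
qed simp

context fixed_point
begin

lemma mgf_eq: "0 < t \<Longrightarrow> t < r_star \<Longrightarrow> mgf t = exp (chi t)"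
  using ln_mgf_eq_chi[of t] mgf_ge[of t] by (metis exp_ln add_pos_pos less_le_trans zero_less_one)

text \<open>At height \<open>chi t\<close> the remaining time is ln \<open>r_star\<close> - ln t,
  equivalent to (\<open>r_star\<close> - t) / \<open>r_star\<close>; this carries the limit 2 over
  to 2 * \<open>r_star\<close>^2.\<close>

lemma mgf_asymp: "((\<lambda>t. mgf t * (r_star - t)\<^sup>2) \<longlongrightarrow> 2 * r_star\<^sup>2) (at_left r_star)"
proof -
  have rng: "\<forall>\<^sub>F t in at_left r_star. t \<in> {0<..<r_star}" by (rule eventually_at_left_real[OF r_star_pos])
  have 1: "((\<lambda>t. exp (chi t) * (time_left (chi t))\<^sup>2) \<longlongrightarrow> 2) (at_left r_star)"
    by (rule filterlim_compose[OF exp_time_left_tendsto filterlim_chi_at_top])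
  have "(ln has_real_derivative 1 / r_star) (at r_star)" using r_star_pos by (auto intro!: derivative_eq_intros)
  then have "((\<lambda>t. (ln t - ln r_star) / (t - r_star)) \<longlongrightarrow> 1 / r_star) (at r_star)"
    by (simp add: has_field_derivative_iff)
  then have "((\<lambda>t. (ln t - ln r_star) / (t - r_star)) \<longlongrightarrow> 1 / r_star) (at_left r_star)"
    by (rule tendsto_mono[rotated]) (simp add: at_le)
  from tendsto_divide[OF 1 tendsto_power[OF this, of 2]]
  have "((\<lambda>t. exp (chi t) * (time_left (chi t))\<^sup>2 / ((ln t - ln r_star) / (t - r_star))\<^sup>2) \<longlongrightarrow> 2 / (1 / r_star)\<^sup>2) (at_left r_star)"
    using r_star_pos by simp
  then have "((\<lambda>t. exp (chi t) * (time_left (chi t))\<^sup>2 / ((ln t - ln r_star) / (t - r_star))\<^sup>2) \<longlongrightarrow> 2 * r_star\<^sup>2) (at_left r_star)"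
    by (simp add: power_divide)
  moreover have "\<forall>\<^sub>F t in at_left r_star. exp (chi t) * (time_left (chi t))\<^sup>2 / ((ln t - ln r_star) / (t - r_star))\<^sup>2 = mgf t * (r_star - t)\<^sup>2"
    using rng
  proof eventually_elim
    case (elim t)
    then have t: "0 < t" "t < r_star" by auto
    have tl: "time_left (chi t) = ln r_star - ln t" using log_time_chi[OF t] by (simp add: log_time_def)
    have "ln t \<noteq> ln r_star" using t by simp
    then show ?case unfolding tl mgf_eq[OF t]
      by (simp add: power_divide power2_commute[of "ln t"] power2_commute[of t])
  qed
  ultimately show ?thesis by (rule Lim_transform_eventually)
qed

text \<open>The Esscher transform of N at \<open>r_star\<close> - s, rescaled by s. Its Laplace
  transform is a ratio of values of \<open>mgf\<close>, so the double pole makes it tend to 1 / (1 +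
  u)^2 as s tends to 0.\<close>

definition tilted :: "real \<Rightarrow> real measure" where
  "tilted s = distr (density N (\<lambda>x. ennreal (exp ((r_star - s) * x) / mgf (r_star - s)))) borel (\<lambda>x. s * x)"

context
  fixes s assumes s: "0 < s" "s < r_star"
begin

lemma mgf_pos: "0 < mgf (r_star - s)"
  using mgf_ge[of "r_star - s"] s by simp

lemma tilted_integral:
  assumes [measurable]: "h \<in> borel_measurable borel"
  shows "(\<integral>x. h x \<partial>tilted s) = (\<integral>x. exp ((r_star - s) * x) / mgf (r_star - s) * h (s * x) \<partial>N)"
  unfolding tilted_def using mgf_pos
  by (subst integral_distr, measurable) (subst integral_density, auto intro: less_imp_le)

lemma nonneg_distribution_tilted: "nonneg_distribution (tilted s)"
proof -
  let ?D = "density N (\<lambda>x. ennreal (exp ((r_star - s) * x) / mgf (r_star - s)))"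
  have "(\<integral>\<^sup>+x. ennreal (exp ((r_star - s) * x) / mgf (r_star - s)) \<partial>N) = ennreal (\<integral>x. exp ((r_star - s) * x) / mgf (r_star - s) \<partial>N)"
    using mgf_pos s by (intro nn_integral_eq_integral) (auto intro!: integrable_mgf less_imp_le[OF mgf_pos])
  also have "\<dots> = 1" using mgf_pos by (simp add: mgf_def)
  finally interpret D: prob_space ?D
    by (intro prob_spaceI) (simp add: emeasure_density)
  show ?thesis unfolding tilted_def
  proof (rule D.nonneg_distribution_distr)
    show "AE x in ?D. 0 \<le> s * x"
      by (subst AE_density) (use N.AE_nonneg s in \<open>auto elim!: eventually_mono\<close>)
  qed simp
qed

lemma laplace_tilted: "laplace (tilted s) u = mgf (r_star - s - u * s) / mgf (r_star - s)"
proof -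
  have "laplace (tilted s) u = (\<integral>x. exp ((r_star - s) * x) / mgf (r_star - s) * exp (- (u * (s * x))) \<partial>N)"
    unfolding laplace_def by (rule tilted_integral) measurable
  also have "\<dots> = (\<integral>x. exp ((r_star - s - u * s) * x) / mgf (r_star - s) \<partial>N)"
    by (intro Bochner_Integration.integral_cong) (simp_all add: exp_add[symmetric] algebra_simps)
  finally show ?thesis by (simp add: mgf_def)
qed

end

text \<open>Karamata's Tauberian argument: the tilted laws converge to the Gamma(2) law, which charges every interval.\<close>
lemma interval_mass_lower:
  assumes d: "0 < d"
  shows "\<exists>c>0. \<forall>\<^sub>F y in at_top. c * exp (- (r_star * (1 + d) * y)) \<le> measure N {y<..<(1 + d) * y}"
proof -
  let ?E = "density lborel (\<lambda>x. ennreal (erlang_density 1 1 x))"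
  have rng: "\<forall>\<^sub>F s in at_right 0. s \<in> {0<..<r_star}" by (rule eventually_at_right_real[OF r_star_pos])
  \<comment> \<open>As a function of y = exp (- x), g is a continuous bump carried by 1 < x < 1 + d,
    with values at most 1.\<close>
  define g where "g y = max 0 ((exp (- 1) - y) * (y - exp (- (1 + d))))" for y :: real
  have gc: "continuous_on {0..1} g" unfolding g_def by (intro continuous_intros)
  have gm [measurable]: "g \<in> borel_measurable borel" unfolding g_def by measurable
  have lim: "((\<lambda>s. laplace (tilted s) (real j)) \<longlongrightarrow> laplace ?E (real j)) (at_right 0)" for j
  proof -
    let ?m = "\<lambda>a s. mgf (r_star - a * s) * (a * s)\<^sup>2"
    have l: "((\<lambda>s. ?m a s) \<longlongrightarrow> 2 * r_star\<^sup>2) (at_right 0)" if a: "a > 0" for a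
    proof -
      have "filterlim (\<lambda>s. r_star - a * s) (at_left r_star) (at_right 0)"
        using a by real_asymp
      from filterlim_compose[OF mgf_asymp this] show ?thesis by simp
    qed
    \<comment> \<open>The squares (a * s)^2 turn a ratio of diverging moment generating functions
      into a ratio of two convergent quantities.\<close>
    have "((\<lambda>s. ?m (1 + real j) s / ?m 1 s * (1 / (1 + real j))\<^sup>2) \<longlongrightarrow> (2 * r_star\<^sup>2) / (2 * r_star\<^sup>2) * (1 / (1 + real j))\<^sup>2) (at_right 0)"
      using r_star_pos by (intro tendsto_mult tendsto_divide l tendsto_const) auto
    then have "((\<lambda>s. ?m (1 + real j) s / ?m 1 s * (1 / (1 + real j))\<^sup>2) \<longlongrightarrow> (1 / (1 + real j))\<^sup>2) (at_right 0)"
      using r_star_pos by simp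
    moreover have "\<forall>\<^sub>F s in at_right 0. ?m (1 + real j) s / ?m 1 s * (1 / (1 + real j))\<^sup>2 = laplace (tilted s) (real j)"
      using rng
    proof eventually_elim
      case (elim s)
      then have s: "0 < s" "s < r_star" by auto
      have "?m (1 + real j) s / ?m 1 s * (1 / (1 + real j))\<^sup>2 = mgf (r_star - (1 + real j) * s) / mgf (r_star - s)"
        using s by (simp add: power_mult_distrib power_divide)
      also have "\<dots> = laplace (tilted s) (real j)"
      proof -
        have "r_star - (1 + real j) * s = r_star - s - real j * s" by (simp add: algebra_simps)
        then show ?thesis unfolding laplace_tilted[OF s] by (simp only:)
      qed
      finally show ?case .
    qed
    ultimately have "((\<lambda>s. laplace (tilted s) (real j)) \<longlongrightarrow> (1 / (1 + real j))\<^sup>2) (at_right 0)"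
      by (rule Lim_transform_eventually)
    moreover have "laplace ?E (real j) = (1 / (1 + real j))\<^sup>2"
      by (subst laplace_erlang) (auto simp: power2_eq_square)
    ultimately show ?thesis by simp
  qed
  have "((\<lambda>s. \<integral>x. (if x \<ge> 0 then g (exp (- x)) else 0) \<partial>tilted s) \<longlongrightarrow> (\<integral>x. (if x \<ge> 0 then g (exp (- x)) else 0) \<partial>?E)) (at_right 0)"
  proof (rule laplace_tendsto_imp_integral[OF _ _ lim gc])
    show "\<forall>\<^sub>F s in at_right 0. nonneg_distribution (tilted s)"
      using rng by eventually_elim (auto intro: nonneg_distribution_tilted)
    show "nonneg_distribution ?E" by (rule nonneg_distribution_erlang) simp
  qed
  moreover define c where "c = (\<integral>x. (if x \<ge> 0 then g (exp (- x)) else 0) \<partial>?E)"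
  ultimately have lim: "((\<lambda>s. \<integral>x. (if x \<ge> 0 then g (exp (- x)) else 0) \<partial>tilted s) \<longlongrightarrow> c) (at_right 0)" by simp
  interpret E: nonneg_distribution ?E by (rule nonneg_distribution_erlang) simp
  have gpos: "g (exp (- x)) > 0" if "1 < x" "x < 1 + d" for x
    using that by (simp add: g_def)
  have gzero: "g (exp (- x)) = 0" if "x \<le> 1 \<or> 1 + d \<le> x" for x
  proof -
    have "(exp (- 1) - exp (- x)) * (exp (- x) - exp (- (1 + d))) \<le> 0"
    proof (cases "x \<le> 1")
      case True
      then show ?thesis using d by (intro mult_nonpos_nonneg) auto
    next
      case False
      then show ?thesis using d that by (intro mult_nonneg_nonpos) auto
    qed
    then show ?thesis by (simp add: g_def)
  qed
  have gle: "g y \<le> 1" if "0 \<le> y" "y \<le> 1" for y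
  proof (cases "(exp (- 1) - y) * (y - exp (- (1 + d))) \<le> 0")
    case False
    have "(exp (- 1) - y) * (y - exp (- (1 + d))) \<le> \<bar>exp (- 1) - y\<bar> * \<bar>y - exp (- (1 + d))\<bar>"
      by (simp add: abs_mult[symmetric])
    also have "\<dots> \<le> 1 * 1"
    proof (intro mult_mono)
      have e: "0 < exp (- 1 :: real)" "exp (- 1 :: real) \<le> 1" "0 < exp (- (1 + d))" "exp (- (1 + d)) \<le> 1" using d by auto
      show "\<bar>exp (- 1) - y\<bar> \<le> 1" using e(1,2) that by linarith
      show "\<bar>y - exp (- (1 + d))\<bar> \<le> 1" using e(3,4) that by linarith
    qed auto
    finally show ?thesis by (simp add: g_def)
  qed (simp add: g_def)
  have c: "c > 0"
  proof -
    have "c \<ge> 0" unfolding c_def by (intro integral_nonneg_AE AE_I2) (auto simp: g_def)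
    moreover have "c \<noteq> 0"
    proof
      assume "c = 0"
      then have "AE x in ?E. (if x \<ge> 0 then g (exp (- x)) else 0) = 0"
        unfolding c_def using integral_nonneg_eq_0_iff_AE[OF E.integrable_fun_exp[OF gc]] by (auto simp: g_def)
      then have "AE x in lborel. 0 < ennreal (erlang_density 1 1 x) \<longrightarrow> (if x \<ge> 0 then g (exp (- x)) else 0) = 0"
        by (subst (asm) AE_density) auto
      then have "AE x in lborel. x \<notin> {1<..<1+d}"
      proof eventually_elim
        case (elim x)
        show ?case
        proof
          assume x: "x \<in> {1<..<1+d}"
          then have "0 < ennreal (erlang_density 1 1 x)" by (simp add: erlang_density_def)
          then show False using elim x gpos[of x] by auto
        qed
      qed
      then have "emeasure lborel {1<..<1+d} = 0" by (subst (asm) AE_iff_measurable[of "{1<..<1+d}"]) auto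
      then show False using d by simp
    qed
    ultimately show ?thesis by simp
  qed
  have "\<forall>\<^sub>F s in at_right 0. c / 2 < (\<integral>x. (if x \<ge> 0 then g (exp (- x)) else 0) \<partial>tilted s)"
    by (rule order_tendstoD(1)[OF lim]) (use c in simp)
  \<comment> \<open>On the interval the tilting factor exp (t x) / \<open>mgf t\<close> is at most
    exp (\<open>r_star\<close> * (1 + d) / s), because t < \<open>r_star\<close> and
    \<open>mgf t\<close> >= 1; this converts tilted mass into a lower bound for N.\<close>
  then have ev: "\<forall>\<^sub>F s in at_right 0. c / 2 * exp (- (r_star * (1 + d) * (1 / s))) \<le> measure N {1 / s<..<(1 + d) * (1 / s)}"
    using rng
  proof eventually_elim
    case (elim s)
    then have s: "0 < s" "s < r_star" by auto
    let ?t = "r_star - s" and ?A = "{1 / s<..<(1 + d) * (1 / s)}"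
    have "(\<integral>x. (if x \<ge> 0 then g (exp (- x)) else 0) \<partial>tilted s) = (\<integral>x. exp (?t * x) / mgf ?t * (if s * x \<ge> 0 then g (exp (- (s * x))) else 0) \<partial>N)"
      by (rule tilted_integral[OF s]) measurable
    also have "\<dots> \<le> (\<integral>x. exp (r_star * (1 + d) * (1 / s)) * indicator ?A x \<partial>N)"
    proof (rule integral_mono')
      show "integrable N (\<lambda>x. exp (r_star * (1 + d) * (1 / s)) * indicator ?A x)"
        by (intro integrable_mult_right N.integrable_const_bound[of _ 1]) auto
      fix x
      show "exp (?t * x) / mgf ?t * (if s * x \<ge> 0 then g (exp (- (s * x))) else 0) \<le> exp (r_star * (1 + d) * (1 / s)) * indicator ?A x"
      proof (cases "x \<in> ?A")
        case True
        have m1: "1 \<le> mgf ?t" using mgf_ge[of ?t] s by simp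
        have x0: "0 < x" using True s by (auto intro: less_trans[of 0 "1 / s"])
        have "?t * x \<le> r_star * ((1 + d) * (1 / s))" using True s x0 r_star_pos by (intro mult_mono) auto
        then have "exp (?t * x) \<le> exp (r_star * (1 + d) * (1 / s))" by (simp add: mult.assoc)
        then have "exp (?t * x) / mgf ?t \<le> exp (r_star * (1 + d) * (1 / s)) / 1" using m1 by (intro frac_le) auto
        moreover have "g (exp (- (s * x))) \<le> 1" using s x0 by (intro gle) auto
        moreover have "0 \<le> g (exp (- (s * x)))" by (simp add: g_def)
        ultimately have "exp (?t * x) / mgf ?t * g (exp (- (s * x))) \<le> exp (r_star * (1 + d) * (1 / s)) * 1"
          by (intro mult_mono) auto
        then show ?thesis using True x0 s by simp
      next
        case False
        have "g (exp (- (s * x))) = 0"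
        proof (rule gzero)
          show "s * x \<le> 1 \<or> 1 + d \<le> s * x" using False s by (auto simp: field_simps not_less)
        qed
        then show ?thesis using False by simp
      qed
    qed auto
    also have "\<dots> = exp (r_star * (1 + d) * (1 / s)) * measure N ?A" by simp
    finally have "c / 2 \<le> exp (r_star * (1 + d) * (1 / s)) * measure N ?A" using elim by simp
    then have "exp (- (r_star * (1 + d) * (1 / s))) * (c / 2) \<le> exp (- (r_star * (1 + d) * (1 / s))) * (exp (r_star * (1 + d) * (1 / s)) * measure N ?A)"
      by (intro mult_left_mono) auto
    also have "\<dots> = measure N ?A" by (simp add: mult.assoc[symmetric] exp_add[symmetric])
    finally show ?case by (simp add: mult.commute)
  qed
  have "filterlim (\<lambda>y::real. 1 / y) (at_right 0) at_top" by real_asymp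
  from eventually_compose_filterlim[OF ev this]
  have "\<forall>\<^sub>F y in at_top. c / 2 * exp (- (r_star * (1 + d) * y)) \<le> measure N {y<..<(1 + d) * y}" by simp
  then show ?thesis using c by (intro exI[of _ "c / 2"]) auto
qed

end

section \<open>The Laplace transform at infinity\<close>

text \<open>Under Lebesgue measure on the quadrant, the sum t + x has density u on the half
  line.\<close>

lemma quad_integral_eq:
  assumes [measurable]: "g \<in> borel_measurable borel"
  shows "quad_integral g = (\<integral>\<^sup>+u. ennreal u * g u * indicator {0<..} u \<partial>lborel)"
proof -
  have inner: "(\<integral>\<^sup>+x. g (t + x) * indicator {0<..} x \<partial>lborel) = (\<integral>\<^sup>+u. g u * indicator {t<..} u \<partial>lborel)" for t
    by (subst nn_integral_real_affine[of "\<lambda>u. g u * indicator {t<..} u" 1 t])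
       (auto intro!: nn_integral_cong simp: indicator_def)
  have m: "(\<lambda>(u, t). g u * indicator {t<..} u * indicator {0<..} t) \<in> borel_measurable (lborel \<Otimes>\<^sub>M lborel)"
  proof -
    have "(\<lambda>(u, t). g u * (if t < u then 1 else 0 :: ennreal) * indicator {0<..} t) \<in> borel_measurable (lborel \<Otimes>\<^sub>M lborel)"
      by measurable
    then show ?thesis by (simp add: indicator_def)
  qed
  have "quad_integral g = (\<integral>\<^sup>+t. (\<integral>\<^sup>+u. g u * indicator {t<..} u * indicator {0<..} t \<partial>lborel) \<partial>lborel)"
    unfolding quad_integral_def inner by (intro nn_integral_cong nn_integral_multc[symmetric]) measurable
  also have "\<dots> = (\<integral>\<^sup>+u. (\<integral>\<^sup>+t. g u * indicator {t<..} u * indicator {0<..} t \<partial>lborel) \<partial>lborel)"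
    by (rule lborel_pair.Fubini'[OF m])
  also have "\<dots> = (\<integral>\<^sup>+u. ennreal u * g u * indicator {0<..} u \<partial>lborel)"
  proof (rule nn_integral_cong)
    fix u :: real
    have "(\<integral>\<^sup>+t. g u * indicator {t<..} u * indicator {0<..} t \<partial>lborel) = (\<integral>\<^sup>+t. g u * indicator {0<..<u} t \<partial>lborel)"
      by (intro nn_integral_cong) (auto split: split_indicator)
    also have "\<dots> = g u * emeasure lborel {0<..<u}" by (rule nn_integral_cmult_indicator) simp
    finally show "(\<integral>\<^sup>+t. g u * indicator {t<..} u * indicator {0<..} t \<partial>lborel) = ennreal u * g u * indicator {0<..} u"
      by (cases "u > 0") (auto simp: mult.commute)
  qed
  finally show ?thesis .
qed

lemma quad_integral_atMost: "0 \<le> L \<Longrightarrow> quad_integral (indicator {..L}) = ennreal (L\<^sup>2 / 2)"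
proof -
  assume L: "0 \<le> L"
  have "quad_integral (indicator {..L}) = (\<integral>\<^sup>+u. ennreal u * indicator {..L} u * indicator {0<..} u \<partial>lborel)"
    by (rule quad_integral_eq) measurable
  also have "\<dots> = (\<integral>\<^sup>+u. ennreal u * indicator {0<..<L} u \<partial>lborel)"
    by (rule nn_integral_cong_AE) (use AE_lborel_neq[of L] in \<open>auto elim!: eventually_mono simp: indicator_def\<close>)
  also have "\<dots> = ennreal (L\<^sup>2 / 2 - 0\<^sup>2 / 2)"
    by (rule nn_integral_Ioo_FTC) (use L in \<open>auto intro!: derivative_eq_intros\<close>)
  finally show ?thesis by simp
qed

lemma quad_integral_min:
  assumes L: "0 \<le> L"
  shows "quad_integral (\<lambda>u. ennreal (min 1 (exp (L - u)))) = ennreal (L\<^sup>2 / 2 + L + 1)"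
proof -
  have "quad_integral (\<lambda>u. ennreal (min 1 (exp (L - u)))) = quad_integral (\<lambda>u. indicator {..L} u + ennreal (exp (L - u)) * indicator {L<..} u)"
    by (rule arg_cong[of _ _ quad_integral]) (auto simp: fun_eq_iff indicator_def min_def)
  also have "\<dots> = ennreal (L\<^sup>2 / 2) + quad_integral (\<lambda>u. ennreal (exp (L - u)) * indicator {L<..} u)"
    by (subst quad_integral_add) (auto simp: quad_integral_atMost[OF L])
  also have "quad_integral (\<lambda>u. ennreal (exp (L - u)) * indicator {L<..} u) = (\<integral>\<^sup>+u. ennreal u * (ennreal (exp (L - u)) * indicator {L<..} u) * indicator {0<..} u \<partial>lborel)"
    by (rule quad_integral_eq) measurable
  also have "\<dots> = (\<integral>\<^sup>+u. ennreal (u * exp (L - u)) * indicator {L..} u \<partial>lborel)"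
    by (rule nn_integral_cong_AE) (use AE_lborel_neq[of L] L in \<open>auto elim!: eventually_mono simp: indicator_def ennreal_mult\<close>)
  also have "\<dots> = ennreal (0 - (- ((L + 1) * exp (L - L))))"
  proof (rule nn_integral_FTC_atLeast[where F="\<lambda>u. - ((u + 1) * exp (L - u))"])
    show "((\<lambda>u. - ((u + 1) * exp (L - u))) has_real_derivative x * exp (L - x)) (at x)" for x
      by (auto intro!: derivative_eq_intros simp: algebra_simps)
    show "((\<lambda>u. - ((u + 1) * exp (L - u))) \<longlongrightarrow> 0) at_top" by real_asymp
  qed (use L in auto)
  finally show ?thesis using L by (simp add: ennreal_plus[symmetric] del: ennreal_plus)
qed

lemma (in nonneg_distribution) laplace_antimono: "0 \<le> s \<Longrightarrow> s \<le> s' \<Longrightarrow> laplace N s' \<le> laplace N s"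
  unfolding laplace_def
  by (intro integral_mono_AE integrable_exp_neg) (use AE_nonneg in \<open>auto elim!: eventually_mono intro: mult_right_mono\<close>)

context fixed_point
begin

lemma laplace_fixed: "0 \<le> s \<Longrightarrow> laplace N s = expm (quad_integral (\<lambda>t. ennreal (1 - laplace N (s * exp (- t)))))"
  using smoothing unfolding smoothing_def by blast

text \<open>In the fixed point equation 1 - \<open>laplace N\<close> (s exp (- t)) is at most min 1
  (s exp (- t)), which switches at t = ln s; the integral of this minimum is L^2/2 + L + 1 with L =
  ln s.\<close>

lemma laplace_lower_log:
  assumes s: "1 \<le> s" shows "exp (- ((ln s)\<^sup>2 / 2 + ln s + 1)) \<le> laplace N s"
proof -
  have L: "0 \<le> ln s" using s by simp
  have "quad_integral (\<lambda>t. ennreal (1 - laplace N (s * exp (- t)))) \<le> quad_integral (\<lambda>t. ennreal (min 1 (exp (ln s - t))))"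
  proof (rule quad_integral_mono)
    fix t :: real
    have e: "exp (ln s - t) = s * exp (- t)" using s by (simp add: exp_diff exp_minus divide_inverse)
    have p: "0 \<le> s * exp (- t)" using s by simp
    have "1 - laplace N (s * exp (- t)) \<le> s * exp (- t)"
      using N.norm_lower[OF p] one_minus_exp_le[of "s * exp (- t)"] by linarith
    moreover have "1 - laplace N (s * exp (- t)) \<le> 1" using N.laplace_pos[OF p] by simp
    ultimately show "ennreal (1 - laplace N (s * exp (- t))) \<le> ennreal (min 1 (exp (ln s - t)))"
      unfolding e by (intro ennreal_leI) simp
  qed
  also have "\<dots> = ennreal ((ln s)\<^sup>2 / 2 + ln s + 1)" by (rule quad_integral_min[OF L])
  finally have "expm (ennreal ((ln s)\<^sup>2 / 2 + ln s + 1)) \<le> expm (quad_integral (\<lambda>t. ennreal (1 - laplace N (s * exp (- t)))))"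
    by (rule expm_antimono)
  moreover have "laplace N s = expm (quad_integral (\<lambda>t. ennreal (1 - laplace N (s * exp (- t)))))"
    using s by (intro laplace_fixed) simp
  moreover have "expm (ennreal ((ln s)\<^sup>2 / 2 + ln s + 1)) = exp (- ((ln s)\<^sup>2 / 2 + ln s + 1))"
    by (rule expm_ennreal) (use L in simp)
  ultimately show ?thesis by (simp only:)
qed

text \<open>For t <= ln (s / w) the argument s exp (- t) is at least w. Keeping this range alone
  costs the factor 1 - \<open>laplace N w\<close>, which is close to 1 for large w.\<close>

lemma laplace_upper_log:
  assumes w: "0 < w" "w \<le> s"
  shows "laplace N s \<le> exp (- ((1 - laplace N w) * (ln (s / w))\<^sup>2 / 2))"
proof -
  let ?L = "ln (s / w)" and ?c = "1 - laplace N w"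
  have L: "0 \<le> ?L" using w by simp
  have c: "0 \<le> ?c" using N.laplace_le_1[of w] w by simp
  have "ennreal ?c * quad_integral (indicator {..?L}) = quad_integral (\<lambda>t. ennreal ?c * indicator {..?L} t)"
    by (simp add: quad_integral_eq nn_integral_cmult[symmetric] mult_ac)
  also have "\<dots> \<le> quad_integral (\<lambda>t. ennreal (1 - laplace N (s * exp (- t))))"
  proof (rule quad_integral_mono)
    fix t :: real
    show "ennreal ?c * indicator {..?L} t \<le> ennreal (1 - laplace N (s * exp (- t)))"
    proof (cases "t \<le> ?L")
      case True
      have "exp t \<le> exp ?L" using True by simp
      also have "\<dots> = s / w" using w by simp
      finally have "w \<le> s * exp (- t)" using w by (simp add: exp_minus field_simps)
      then have "laplace N (s * exp (- t)) \<le> laplace N w" using w by (intro N.laplace_antimono) auto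
      then show ?thesis using True by (simp add: ennreal_leI)
    qed simp
  qed
  finally have "expm (quad_integral (\<lambda>t. ennreal (1 - laplace N (s * exp (- t))))) \<le> expm (ennreal ?c * ennreal (?L\<^sup>2 / 2))"
    unfolding quad_integral_atMost[OF L] by (rule expm_antimono)
  moreover have "laplace N s = expm (quad_integral (\<lambda>t. ennreal (1 - laplace N (s * exp (- t)))))"
    using w by (intro laplace_fixed) simp
  moreover have "expm (ennreal ?c * ennreal (?L\<^sup>2 / 2)) = exp (- (?c * ?L\<^sup>2 / 2))"
    using c by (subst ennreal_mult[symmetric]) auto
  ultimately show ?thesis by (simp only:)
qed

text \<open>The lower bound on interval masses makes the support of N unbounded; strict positivity
  of the kernel tail(z)/z in the size-bias equation rests on this.\<close>

lemma tail_pos: "0 < tail N z"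
proof -
  obtain c where c: "c > 0" "\<forall>\<^sub>F y in at_top. c * exp (- (r_star * (1 + 1) * y)) \<le> measure N {y<..<(1 + 1) * y}"
    using interval_mass_lower[of 1] by auto
  have "\<forall>\<^sub>F y in at_top. z \<le> y \<and> c * exp (- (r_star * (1 + 1) * y)) \<le> measure N {y<..<(1 + 1) * y}"
    using c(2) eventually_ge_at_top[of z] by eventually_elim auto
  then obtain y where y: "z \<le> y" "c * exp (- (r_star * (1 + 1) * y)) \<le> measure N {y<..<(1 + 1) * y}"
    using eventually_happens by force
  have "0 < c * exp (- (r_star * (1 + 1) * y))" using c by simp
  also have "\<dots> \<le> measure N {y<..<(1 + 1) * y}" by (rule y)
  also have "\<dots> \<le> tail N z" unfolding tail_def using y by (intro N.finite_measure_mono) auto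
  finally show ?thesis .
qed

lemma levy_lower:
  assumes y: "0 < y" "y \<le> w" shows "tail N w * (ln w - ln y) \<le> levy N y"
proof -
  have "ennreal (tail N w) * ennreal (ln w - ln y) = ennreal (tail N w) * (\<integral>\<^sup>+z. ennreal (1 / z) * indicator {y<..<w} z \<partial>lborel)"
    using y by (subst nn_integral_Ioo_FTC[where F=ln]) (auto intro!: derivative_eq_intros)
  also have "\<dots> = (\<integral>\<^sup>+z. ennreal (tail N w) * (ennreal (1 / z) * indicator {y<..<w} z) \<partial>lborel)"
    by (rule nn_integral_cmult[symmetric]) measurable
  also have "\<dots> \<le> levy_nn N y" unfolding levy_nn_def
  proof (rule nn_integral_mono)
    fix z :: real
    have "ennreal (tail N w) * ennreal (1 / z) \<le> ennreal (tail N z / z)" if "y < z" "z < w"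
      using y that N.tail_antimono[of z w] by (auto simp: ennreal_mult[symmetric] intro!: ennreal_leI divide_right_mono)
    then show "ennreal (tail N w) * (ennreal (1 / z) * indicator {y<..<w} z) \<le> ennreal (tail N z / z) * indicator {y<..} z"
      by (auto simp: indicator_def)
  qed
  also have "\<dots> = ennreal (levy N y)" using N.levy_eq[OF y(1)] by simp
  finally show ?thesis using y by (simp add: ennreal_mult[symmetric] ennreal_le_iff)
qed

text \<open>Near 0 \<open>levy N\<close> grows at least logarithmically and so exceeds 4; at
  infinity it decays at most exponentially by \<open>interval_mass_lower\<close>. A large b handles
  the range in between.\<close>

lemma levy_exp_lower: "\<exists>b>0. \<forall>y>0. 4 * exp (- (b * y)) \<le> levy N y"
proof -
  obtain c where c: "c > 0" "\<forall>\<^sub>F y in at_top. c * exp (- (r_star * (1 + 1) * y)) \<le> measure N {y<..<(1 + 1) * y}"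
    using interval_mass_lower[of 1] by auto
  obtain y0 where y0: "y0 > 0" "\<And>y. y \<ge> y0 \<Longrightarrow> c * exp (- (r_star * 2 * y)) \<le> tail N y"
  proof -
    obtain y1 where y1: "\<And>y. y \<ge> y1 \<Longrightarrow> c * exp (- (r_star * (1 + 1) * y)) \<le> measure N {y<..<(1 + 1) * y}"
      using c(2) by (auto simp: eventually_at_top_linorder)
    have "c * exp (- (r_star * 2 * y)) \<le> tail N y" if "y \<ge> max 1 y1" for y
    proof -
      have "c * exp (- (r_star * 2 * y)) \<le> measure N {y<..<(1 + 1) * y}" using y1[of y] that by simp
      also have "\<dots> \<le> tail N y" unfolding tail_def by (intro N.finite_measure_mono) auto
      finally show ?thesis .
    qed
    then show ?thesis using that[of "max 1 y1"] by auto
  qed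
  \<comment> \<open>This is a lower bound for \<open>levy N y0\<close>, hence by monotonicity for
    \<open>levy N y\<close> with y <= y0. The rate 4 * \<open>r_star\<close> comes from the tail at
    2 * y, estimated by the mass of (2y, 4y).\<close>
  define a where "a = c * ln 2 * exp (- (r_star * 4 * y0))"
  have a: "a > 0" using c by (simp add: a_def)
  have la: "a * exp (- (r_star * 4 * y)) \<le> levy N y" if y: "y > 0" for y
  proof -
    have big: "c * ln 2 * exp (- (r_star * 4 * y)) \<le> levy N y" if "y \<ge> y0" for y
    proof -
      have "c * exp (- (r_star * 2 * (2 * y))) * ln 2 \<le> tail N (2 * y) * ln 2"
        using y0 that by (intro mult_right_mono y0(2)) auto
      also have "\<dots> = tail N (2 * y) * (ln (2 * y) - ln y)" using y0 that by (simp add: ln_mult)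
      also have "\<dots> \<le> levy N y" using y0 that by (intro levy_lower) auto
      finally show ?thesis by (simp add: mult_ac)
    qed
    show ?thesis
    proof (cases "y \<ge> y0")
      case True
      have "a \<le> c * ln 2" using c r_star_pos y0 by (simp add: a_def mult_left_le)
      then have "a * exp (- (r_star * 4 * y)) \<le> c * ln 2 * exp (- (r_star * 4 * y))" by (intro mult_right_mono) auto
      then show ?thesis using big[OF True] by linarith
    next
      case False
      have "a * exp (- (r_star * 4 * y)) \<le> a" using a r_star_pos y by (simp add: mult_left_le)
      also have "\<dots> \<le> levy N y0" using big[of y0] by (simp add: a_def)
      also have "\<dots> \<le> levy N y" using False y by (intro N.levy_antimono) auto
      finally show ?thesis .
    qed
  qed
  \<comment> \<open>Chosen so that \<open>tail N 1\<close> * (ln 1 - ln d) = 4.\<close>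
  define d where "d = exp (- (4 / tail N 1))"
  have d: "0 < d" "d \<le> 1" using tail_pos[of 1] by (auto simp: d_def)
  have ld: "4 \<le> levy N y" if "0 < y" "y \<le> d" for y
  proof -
    have "4 = tail N 1 * (ln 1 - ln d)" using tail_pos[of 1] by (simp add: d_def)
    also have "\<dots> \<le> levy N d" using d by (intro levy_lower) auto
    also have "\<dots> \<le> levy N y" using that by (intro N.levy_antimono) auto
    finally show ?thesis .
  qed
  \<comment> \<open>The term divided by d absorbs the constant 4 / a once y > d.\<close>
  define b where "b = r_star * 4 + \<bar>ln (4 / a)\<bar> / d + 1"
  have b: "b > 0" using r_star_pos d by (simp add: b_def add_pos_nonneg)
  have "4 * exp (- (b * y)) \<le> levy N y" if y: "y > 0" for y
  proof (cases "y \<le> d")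
    case True
    have "4 * exp (- (b * y)) \<le> 4" using b y by simp
    then show ?thesis using ld[OF y True] by linarith
  next
    case False
    have "\<bar>ln (4 / a)\<bar> = \<bar>ln (4 / a)\<bar> / d * d" using d by simp
    also have "\<dots> \<le> \<bar>ln (4 / a)\<bar> / d * y" using False d by (intro mult_left_mono) auto
    finally have "ln (4 / a) + r_star * 4 * y \<le> b * y" using y by (simp add: b_def algebra_simps)
    then have "exp (ln (4 / a) + r_star * 4 * y) \<le> exp (b * y)" by simp
    then have "4 / a * exp (r_star * 4 * y) \<le> exp (b * y)" using a by (simp add: exp_add)
    then have "4 * exp (- (b * y)) \<le> a * exp (- (r_star * 4 * y))"
      using a by (simp add: exp_minus field_simps)
    then show ?thesis using la[OF y] by linarith
  qed
  then show ?thesis using b by blast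
qed

end

section \<open>The density and its unimodality\<close>

text \<open>A Frullani integral: (1 - exp (- s z)) / z is the integral of exp (- r z) over r in (0,
  s). It identifies exp (- b z) / z as the Levy density of the exponential law of rate b.\<close>

lemma erlang_exponent:
  assumes b: "0 < b" and s: "0 \<le> s"
  shows "(\<integral>\<^sup>+z. ennreal ((1 - exp (- (s * z))) / z * exp (- (b * z))) * indicator {0<..} z \<partial>lborel) = ennreal (ln ((b + s) / b))"
proof -
  have "(\<integral>\<^sup>+z. ennreal ((1 - exp (- (s * z))) / z * exp (- (b * z))) * indicator {0<..} z \<partial>lborel)
    = (\<integral>\<^sup>+z. (\<integral>\<^sup>+r. ennreal (exp (- ((b + r) * z))) * indicator {0<..<s} r * indicator {0<..} z \<partial>lborel) \<partial>lborel)"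
  proof (rule nn_integral_cong)
    fix z :: real
    show "ennreal ((1 - exp (- (s * z))) / z * exp (- (b * z))) * indicator {0<..} z
      = (\<integral>\<^sup>+r. ennreal (exp (- ((b + r) * z))) * indicator {0<..<s} r * indicator {0<..} z \<partial>lborel)"
    proof (cases "z > 0")
      case True
      have "(\<integral>\<^sup>+r. ennreal (exp (- ((b + r) * z))) * indicator {0<..<s} r \<partial>lborel) = ennreal (- exp (- ((b + s) * z)) / z - (- exp (- ((b + 0) * z)) / z))"
        using s True by (intro nn_integral_Ioo_FTC) (auto intro!: derivative_eq_intros)
      also have "- exp (- ((b + s) * z)) / z - (- exp (- ((b + 0) * z)) / z) = (1 - exp (- (s * z))) / z * exp (- (b * z))"
        using True by (simp add: field_simps exp_add[symmetric])
      finally show ?thesis using True by simp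
    qed simp
  qed
  also have "\<dots> = (\<integral>\<^sup>+r. (\<integral>\<^sup>+z. ennreal (exp (- ((b + r) * z))) * indicator {0<..<s} r * indicator {0<..} z \<partial>lborel) \<partial>lborel)"
    by (rule lborel_pair.Fubini') measurable
  also have "\<dots> = (\<integral>\<^sup>+r. ennreal (1 / (b + r)) * indicator {0<..<s} r \<partial>lborel)"
  proof (rule nn_integral_cong)
    fix r :: real
    show "(\<integral>\<^sup>+z. ennreal (exp (- ((b + r) * z))) * indicator {0<..<s} r * indicator {0<..} z \<partial>lborel) = ennreal (1 / (b + r)) * indicator {0<..<s} r"
      using b nn_integral_exp_half_line[of "b + r"] by (cases "r \<in> {0<..<s}") auto
  qed
  also have "\<dots> = ennreal (ln (b + s) - ln (b + 0))"
    using b s by (intro nn_integral_Ioo_FTC[where F="\<lambda>r. ln (b + r)"]) (auto intro!: derivative_eq_intros)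
  finally show ?thesis using b s by (simp add: ln_div)
qed

text \<open>Any probability space carrying a Poisson process can serve as the source for
  \<open>ex_infinitely_divisible\<close>.\<close>

locale fixed_point_ppp = fixed_point N for N +
  fixes M :: "'b measure" and X
  assumes prob_M: "prob_space M" and ppp: "is_PPP_leb M X"
begin

text \<open>Removing 4 exp (- b z) / z, the Levy density of the Gamma law of shape 4 (which is
  \<open>erlang_density 3\<close>), leaves a nonnegative Levy density by
  \<open>levy_exp_lower\<close>, and hence a law nu.\<close>

lemma erlang_factor:
  "\<exists>b nu. 0 < b \<and> nonneg_distribution nu \<and>
     N = distr (density lborel (\<lambda>x. ennreal (erlang_density 3 b x)) \<Otimes>\<^sub>M nu) borel (\<lambda>(x, y). 1 * x + y)"
proof -
  obtain b where b: "0 < b" "\<And>y. 0 < y \<Longrightarrow> 4 * exp (- (b * y)) \<le> levy N y"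
    using levy_exp_lower by auto
  let ?G = "density lborel (\<lambda>x. ennreal (erlang_density 3 b x))"
  define j where "j z = (if 0 < z then (levy N z - 4 * exp (- (b * z))) / z else 0)" for z
  have [measurable]: "j \<in> borel_measurable borel" unfolding j_def by measurable
  have j0: "0 \<le> j z" for z using b by (simp add: j_def)
  have "(\<integral>\<^sup>+z. ennreal (z * j z) * indicator {0<..} z \<partial>lborel) \<le> (\<integral>\<^sup>+z. ennreal (levy N z) \<partial>lborel)"
    by (rule nn_integral_mono) (auto simp: j_def indicator_def intro!: ennreal_leI)
  then have "(\<integral>\<^sup>+z. ennreal (z * j z) * indicator {0<..} z \<partial>lborel) < \<top>"
    unfolding N.levy_integral by (rule le_less_trans) simp
  then obtain nu where nu: "nonneg_distribution nu"
    "\<And>s. s \<ge> 0 \<Longrightarrow> laplace nu s = expm (\<integral>\<^sup>+z. ennreal ((1 - exp (- (s * z))) * j z) * indicator {0<..} z \<partial>lborel)"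
    using ex_infinitely_divisible[OF prob_M ppp, of j] j0 by auto
  interpret G: nonneg_distribution ?G by (rule nonneg_distribution_erlang[OF b(1)])
  interpret nu: nonneg_distribution nu by fact
  have "laplace N s = laplace (distr (?G \<Otimes>\<^sub>M nu) borel (\<lambda>(x, y). 1 * x + y)) s" if s: "s \<ge> 0" for s
  proof -
    have E: "laplace N s = expm (\<integral>\<^sup>+z. ennreal ((1 - exp (- (s * z))) / z * levy N z) \<partial>lborel)"
    proof (cases "s = 0")
      case False
      then show ?thesis using laplace_fixed[OF s] N.quad_integral_laplace[of s] s by simp
    qed (simp add: N.laplace_0)
    have "(\<integral>\<^sup>+z. ennreal ((1 - exp (- (s * z))) / z * levy N z) \<partial>lborel)
      = (\<integral>\<^sup>+z. ennreal 4 * (ennreal ((1 - exp (- (s * z))) / z * exp (- (b * z))) * indicator {0<..} z) + ennreal ((1 - exp (- (s * z))) * j z) * indicator {0<..} z \<partial>lborel)"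
    proof (rule nn_integral_cong)
      fix z :: real
      show "ennreal ((1 - exp (- (s * z))) / z * levy N z) = ennreal 4 * (ennreal ((1 - exp (- (s * z))) / z * exp (- (b * z))) * indicator {0<..} z) + ennreal ((1 - exp (- (s * z))) * j z) * indicator {0<..} z"
      proof (cases "z > 0")
        case True
        have e0: "0 \<le> 1 - exp (- (s * z))" using s True by simp
        have "(1 - exp (- (s * z))) / z * levy N z = 4 * ((1 - exp (- (s * z))) / z * exp (- (b * z))) + (1 - exp (- (s * z))) * j z"
          using True by (simp add: j_def field_simps)
        moreover have "ennreal (4 * ((1 - exp (- (s * z))) / z * exp (- (b * z))) + (1 - exp (- (s * z))) * j z)
          = ennreal 4 * ennreal ((1 - exp (- (s * z))) / z * exp (- (b * z))) + ennreal ((1 - exp (- (s * z))) * j z)"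
          using e0 j0[of z] True by (subst ennreal_plus, simp, simp, subst ennreal_mult, simp_all)
        ultimately show ?thesis using True by simp
      qed (simp add: levy_def)
    qed
    also have "\<dots> = ennreal 4 * ennreal (ln ((b + s) / b)) + (\<integral>\<^sup>+z. ennreal ((1 - exp (- (s * z))) * j z) * indicator {0<..} z \<partial>lborel)"
      by (subst nn_integral_add, measurable, subst nn_integral_cmult, measurable, subst erlang_exponent) (use b s in auto)
    finally have "laplace N s = expm (ennreal 4 * ennreal (ln ((b + s) / b))) * laplace nu s"
      unfolding E nu(2)[OF s] by (simp only: expm_add)
    also have "expm (ennreal 4 * ennreal (ln ((b + s) / b))) = laplace ?G s"
    proof -
      have "0 \<le> ln ((b + s) / b)" using b s by simp
      then have "expm (ennreal 4 * ennreal (ln ((b + s) / b))) = exp (- (4 * ln ((b + s) / b)))"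
        by (simp only: ennreal_mult[symmetric] expm_ennreal mult_nonneg_nonneg zero_le_numeral)
      also have "\<dots> = (exp (- ln ((b + s) / b))) ^ 4"
        by (simp add: exp_of_nat_mult[symmetric])
      also have "exp (- ln ((b + s) / b)) = b / (b + s)"
        using b s by (simp add: exp_minus)
      finally show ?thesis using b s by (simp add: laplace_erlang eval_nat_numeral)
    qed
    finally show ?thesis using laplace_convolution[OF G.nonneg_distribution_axioms nu(1), of 1 s] s by simp
  qed
  then have "N = distr (?G \<Otimes>\<^sub>M nu) borel (\<lambda>(x, y). 1 * x + y)"
    by (intro laplace_unique nonneg_distribution_convolution N.nonneg_distribution_axioms G.nonneg_distribution_axioms nu(1)) auto
  then show ?thesis using b nu by blast
qed

end

section \<open>A unimodality criterion for a delay equation\<close>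

lemma integral_pos_on_interval:
  fixes g :: "real \<Rightarrow> real"
  assumes i: "integrable lborel g" and nn: "\<And>x. 0 \<le> g x" and ab: "a < b" and p: "\<And>x. a < x \<Longrightarrow> x < b \<Longrightarrow> 0 < g x"
  shows "0 < (\<integral>x. g x \<partial>lborel)"
proof -
  have "(\<integral>x. g x \<partial>lborel) \<noteq> 0"
  proof
    assume "(\<integral>x. g x \<partial>lborel) = 0"
    then have "AE x in lborel. g x = 0" using integral_nonneg_eq_0_iff_AE[OF i] nn by auto
    then have "AE x in lborel. x \<notin> {a<..<b}" by eventually_elim (use p in force)
    then have "emeasure lborel {a<..<b} = 0" by (subst (asm) AE_iff_measurable[of "{a<..<b}"]) auto
    then show False using ab by simp
  qed
  moreover have "0 \<le> (\<integral>x. g x \<partial>lborel)" using nn by (intro integral_nonneg_AE) auto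
  ultimately show ?thesis by simp
qed

lemma first_zero:
  fixes g :: "real \<Rightarrow> real"
  assumes c: "continuous_on UNIV g" and ab: "a \<le> b" and ga: "0 < g a" and gb: "g b \<le> 0"
  obtains z where "a < z" "z \<le> b" "g z = 0" "\<And>x. a \<le> x \<Longrightarrow> x < z \<Longrightarrow> 0 < g x"
proof -
  define S where "S = {x \<in> {a..b}. g x \<le> 0}"
  have "closed S"
  proof -
    have "S = {a..b} \<inter> g -` {..0}" by (auto simp: S_def)
    moreover have "closed (g -` {..0})" using c by (intro continuous_closed_vimage) (auto simp: continuous_on_eq_continuous_at)
    ultimately show ?thesis by (simp add: closed_Int)
  qed
  moreover have ne: "S \<noteq> {}" "bdd_below S" using ab gb by (auto simp: S_def)
  ultimately have z: "Inf S \<in> S" by (intro closed_contains_Inf)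
  define z where "z = Inf S"
  have zS: "a \<le> z" "z \<le> b" "g z \<le> 0" using z by (auto simp: S_def z_def)
  have lt: "0 < g x" if "a \<le> x" "x < z" for x
  proof (rule ccontr)
    assume "\<not> 0 < g x"
    then have "x \<in> S" using that zS by (auto simp: S_def)
    then have "z \<le> x" unfolding z_def using ne by (intro cInf_lower)
    then show False using that by simp
  qed
  have az: "a < z" using zS ga by (cases "a = z") auto
  have "g z = 0"
  proof (rule ccontr)
    assume "g z \<noteq> 0"
    then have "g z < 0" using zS by simp
    then obtain y where "a \<le> y" "y \<le> z" "g y = 0"
      using IVT2'[of g z 0 a] ga az c continuous_on_subset[of UNIV g "{a..z}"] by auto
    then show False using lt[of y] \<open>g z < 0\<close> by (cases "y = z") auto
  qed
  then show ?thesis using that az zS lt by blast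
qed

text \<open>At a zero b of f' the first equation says that the average of f (b - z) / f b is the same as at
  the first zero a; after a the comparison of the two averages is strict.\<close>
lemma unimodal_of_delay_equation:
  fixes f f1 f2 kap :: "real \<Rightarrow> real"
  assumes d1: "\<And>x. (f has_real_derivative f1 x) (at x)" and d2: "\<And>x. (f1 has_real_derivative f2 x) (at x)"
    and f0: "\<And>x. x \<le> 0 \<Longrightarrow> f x = 0" and fp: "\<And>x. 0 < x \<Longrightarrow> 0 < f x"
    and e: "0 < e" and f1e: "\<And>x. 0 < x \<Longrightarrow> x < e \<Longrightarrow> 0 < f1 x"
    and k0: "\<And>z. z \<le> 0 \<Longrightarrow> kap z = 0" and kp: "\<And>z. 0 < z \<Longrightarrow> 0 < kap z"
    and int1: "\<And>x. integrable lborel (\<lambda>z. kap z * (f x - f (x - z)))"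
    and int2: "\<And>x. integrable lborel (\<lambda>z. kap z * (f1 x - f1 (x - z)))"
    and E1: "\<And>x. f x + x * f1 x = (\<integral>z. kap z * (f x - f (x - z)) \<partial>lborel)"
    and E2: "\<And>x. 2 * f1 x + x * f2 x = (\<integral>z. kap z * (f1 x - f1 (x - z)) \<partial>lborel)"
    and x0: "0 < x0" "f1 x0 \<le> 0"
  shows "\<exists>a>0. (\<forall>x y. x \<le> y \<and> y \<le> a \<longrightarrow> f x \<le> f y) \<and> (\<forall>x y. a \<le> x \<and> x \<le> y \<longrightarrow> f y \<le> f x)"
proof -
  have c1: "continuous_on UNIV f1" using d2 by (intro DERIV_continuous_on) (auto intro: has_field_derivative_at_within)
  have f1neg: "f1 x = 0" if "x \<le> 0" for x
  proof (rule DERIV_local_min[OF d1, of 1])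
    show "\<forall>y. \<bar>x - y\<bar> < 1 \<longrightarrow> f x \<le> f y" using f0[OF that] f0 fp by (metis less_imp_le linorder_le_less_linear order_refl)
  qed simp
  have "0 < f1 (e/2)" using f1e e by auto
  have xe: "e / 2 \<le> x0"
  proof (rule ccontr)
    assume "\<not> e / 2 \<le> x0"
    then have "0 < f1 x0" using f1e[of x0] x0 e by simp
    then show False using x0 by simp
  qed
  obtain a where a: "e / 2 < a" "f1 a = 0" "\<And>x. e / 2 \<le> x \<Longrightarrow> x < a \<Longrightarrow> 0 < f1 x"
    using first_zero[OF c1 xe \<open>0 < f1 (e/2)\<close> x0(2)] by metis
  have a0: "0 < a" using a e by simp
  have inc: "0 < f1 x" if "0 < x" "x < a" for x using that a(3)[of x] f1e[of x] e by (cases "x < e/2") auto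
  have nonneg: "0 \<le> f1 x" if "x \<le> a" for x using inc[of x] f1neg[of x] a that by (cases "x \<le> 0"; cases "x = a") auto
  have mono: "f x \<le> f y" if "x \<le> y" "y \<le> a" for x y
    by (rule DERIV_nonneg_imp_nondecreasing[OF that(1)]) (use d1 nonneg that in \<open>meson order_trans\<close>)
  have smono: "f x < f a" if "0 \<le> x" "x < a" for x
    by (rule DERIV_pos_imp_increasing_open[OF that(2)]) (use d1 inc that DERIV_isCont in \<open>(meson le_less_trans order_less_imp_le continuous_at_imp_continuous_on)+\<close>)
  \<comment> \<open>At the first zero a of f' the second equation equates a * f2 a with minus this
    integral, so f' changes sign strictly there.\<close>
  have "0 < (\<integral>z. kap z * f1 (a - z) \<partial>lborel)"
  proof (rule integral_pos_on_interval[of _ 0 a])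
    show "integrable lborel (\<lambda>z. kap z * f1 (a - z))" using Bochner_Integration.integrable_minus[OF int2[of a]] a(2) by simp
    show "0 \<le> kap z * f1 (a - z)" for z using kp[of z] k0[of z] nonneg[of "a - z"] by (cases "z \<le> 0") auto
    show "0 < kap z * f1 (a - z)" if "0 < z" "z < a" for z using kp[of z] inc[of "a - z"] that by auto
  qed (use a0 in auto)
  then have "a * f2 a < 0" using E2[of a] a(2) by simp
  then have "f2 a < 0" using a0 by (simp add: mult_less_0_iff)
  then obtain d where d: "d > 0" "\<And>h. h > 0 \<Longrightarrow> h < d \<Longrightarrow> f1 (a + h) < f1 a"
    using DERIV_neg_dec_right[OF d2] by blast
  have nz: "f1 b \<noteq> 0" if b: "a < b" and dec: "\<And>x. a < x \<Longrightarrow> x < b \<Longrightarrow> f1 x < 0" for b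
  proof
    assume fb: "f1 b = 0"
    have cf: "isCont f x" for x using d1 DERIV_isCont by blast
    have sdec: "f y < f x" if "a \<le> x" "x < y" "y \<le> b" for x y
    proof (rule DERIV_neg_imp_decreasing_open[OF that(2)])
      show "\<exists>D. (f has_real_derivative D) (at z) \<and> D < 0" if "x < z" "z < y" for z
        using d1[of z] dec[of z] that \<open>a \<le> x\<close> \<open>y \<le> b\<close> by (intro exI[of _ "f1 z"]) auto
      show "continuous_on {x..y} f" using cf by (simp add: continuous_at_imp_continuous_on)
    qed
    have pos: "0 < f a" "0 < f b" using fp a0 b by auto
    \<comment> \<open>Both normalised averages equal 1 by the first equation, so g has integral 0;
      the contradiction is that g is nonnegative and positive on an interval.\<close>
    define g where "g z = kap z * (f a - f (a - z)) / f a - kap z * (f b - f (b - z)) / f b" for z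
    have gi: "integrable lborel g" unfolding g_def
      by (intro Bochner_Integration.integrable_diff integrable_divide_zero int1)
    have "(\<integral>z. g z \<partial>lborel) = (\<integral>z. kap z * (f a - f (a - z)) \<partial>lborel) / f a - (\<integral>z. kap z * (f b - f (b - z)) \<partial>lborel) / f b"
      unfolding g_def using int1 by (subst Bochner_Integration.integral_diff) auto
    also have "\<dots> = 0" using E1[of a] E1[of b] a(2) fb pos by simp
    finally have g_0: "(\<integral>z. g z \<partial>lborel) = 0" .
    have geq: "g z = kap z * (f (b - z) / f b - f (a - z) / f a)" for z
      using pos by (simp add: g_def field_simps)
    \<comment> \<open>If b - z lies beyond a, the two ratios are separated by 1. Otherwise both
      points lie on the increasing branch, while f b <= f a.\<close>
    have ratio: "f (a - z) / f a \<le> f (b - z) / f b" if z: "0 < z" for z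
    proof (cases "a \<le> b - z")
      case True
      have "f (a - z) \<le> f a" by (rule mono) (use z in auto)
      then have "f (a - z) / f a \<le> 1" using pos by simp
      also have "1 \<le> f (b - z) / f b" using sdec[of "b - z" b] True z pos by (simp add: less_imp_le)
      finally show ?thesis .
    next
      case False
      have nn: "0 \<le> f (a - z)" using f0[of "a - z"] fp[of "a - z"] by (cases "a - z \<le> 0") auto
      have "f (a - z) \<le> f (b - z)" by (rule mono) (use b False in auto)
      moreover have "f b \<le> f a" using sdec[of a b] b by simp
      ultimately show ?thesis using pos nn by (intro frac_le) auto
    qed
    have "0 < (\<integral>z. g z \<partial>lborel)"
    proof (rule integral_pos_on_interval[OF gi, of 0 "min a (b - a)"])
      show "0 \<le> g z" for z unfolding geq using k0[of z] kp[of z] ratio[of z] by (cases "z \<le> 0") auto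
      show "0 < g z" if z: "0 < z" "z < min a (b - a)" for z
      proof -
        have "f (a - z) / f a < 1" using smono[of "a - z"] z pos by simp
        also have "1 < f (b - z) / f b" using sdec[of "b - z" b] z pos by simp
        finally show ?thesis unfolding geq using kp[of z] z by simp
      qed
    qed (use a0 b in auto)
    then show False using g_0 by simp
  qed
  have neg: "f1 x < 0" if x: "a < x" for x
  proof (rule ccontr)
    assume nx: "\<not> f1 x < 0"
    \<comment> \<open>A point right after a up to which f' is already negative; the first zero of f'
      beyond it would be one of those excluded by \<open>nz\<close>.\<close>
    define m where "m = a + min d (x - a) / 2"
    have m: "a < m" "m < x" "m < a + d" using d x by (auto simp: m_def min_def field_simps)
    have neg0: "f1 y < 0" if "a < y" "y \<le> m" for y using d(2)[of "y - a"] that m a(2) by simp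
    have "0 < - f1 m" using neg0[of m] m by simp
    moreover have "- f1 x \<le> 0" using nx by simp
    moreover have "continuous_on UNIV (\<lambda>x. - f1 x)" using c1 by (intro continuous_intros)
    ultimately obtain b where b: "m < b" "- f1 b = 0" "\<And>y. m \<le> y \<Longrightarrow> y < b \<Longrightarrow> 0 < - f1 y"
      using first_zero[of "\<lambda>x. - f1 x" m x] m by (metis less_imp_le)
    have "f1 y < 0" if "a < y" "y < b" for y using neg0[of y] b(3)[of y] that by (cases "y \<le> m") auto
    then show False using nz[of b] b m by auto
  qed
  have anti: "f y \<le> f x" if "a \<le> x" "x \<le> y" for x y
  proof (rule DERIV_nonpos_imp_nonincreasing[OF that(2)])
    fix z assume "x \<le> z" "z \<le> y"
    then have "f1 z \<le> 0" using neg[of z] a(2) that by (cases "z = a") auto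
    then show "\<exists>y. (f has_real_derivative y) (at z) \<and> y \<le> 0" using d1 by blast
  qed
  show ?thesis using a0 mono anti by blast
qed

section \<open>The Gamma density of shape 4 as a twice differentiable function\<close>

lemma has_derivative_max_power:
  "((\<lambda>x. max 0 x ^ Suc (Suc n)) has_real_derivative real (Suc (Suc n)) * max 0 x ^ Suc n) (at (x::real))"
proof -
  consider "x > 0" | "x < 0" | "x = 0" by linarith
  then show ?thesis
  proof cases
    case 1
    have "((\<lambda>x. x ^ Suc (Suc n)) has_real_derivative real (Suc (Suc n)) * x ^ Suc n) (at x)"
      by (auto intro!: derivative_eq_intros simp del: power_Suc)
    moreover have "\<forall>\<^sub>F y in nhds x. max 0 y ^ Suc (Suc n) = y ^ Suc (Suc n)"
      using eventually_nhds_in_open[of "{0<..}" x] 1 by (auto elim!: eventually_mono)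
    ultimately show ?thesis using 1 by (subst DERIV_cong_ev[OF refl _ refl]) (simp_all del: power_Suc)
  next
    case 2
    have "((\<lambda>x::real. 0::real) has_real_derivative 0) (at x)" by simp
    moreover have ev: "\<forall>\<^sub>F y in nhds x. max 0 y ^ Suc (Suc n) = 0"
      using eventually_nhds_in_open[of "{..<0}" x] 2 by (auto elim!: eventually_mono)
    ultimately have "((\<lambda>x. max 0 x ^ Suc (Suc n)) has_real_derivative 0) (at x)"
      by (subst DERIV_cong_ev[OF refl ev refl])
    then show ?thesis using 2 by simp
  next
    case 3
    have "((\<lambda>h. max 0 h ^ Suc (Suc n) / h) \<longlongrightarrow> 0) (at (0::real))"
    proof (rule Lim_null_comparison)
      show "\<forall>\<^sub>F h in at 0. norm (max 0 h ^ Suc (Suc n) / h) \<le> \<bar>h\<bar> ^ Suc n"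
      proof (intro always_eventually allI)
        fix h :: real
        show "norm (max 0 h ^ Suc (Suc n) / h) \<le> \<bar>h\<bar> ^ Suc n"
        proof (cases "h > 0")
          case False
          then show ?thesis by (simp add: max_def del: power_Suc)
        qed (simp add: abs_mult)
      qed
      have "((\<lambda>h::real. \<bar>h\<bar> ^ Suc n) \<longlongrightarrow> \<bar>0\<bar> ^ Suc n) (at 0)" by (intro tendsto_intros)
      then show "((\<lambda>h::real. \<bar>h\<bar> ^ Suc n) \<longlongrightarrow> 0) (at 0)" by simp
    qed
    then show ?thesis using 3 by (simp add: has_field_derivative_iff)
  qed
qed

lemma max_power_exp_bounded:
  assumes b: "0 < b"
  shows "\<exists>B. \<forall>x. max 0 x ^ Suc k * exp (- (b * x)) \<le> (B::real)"
proof (intro exI allI)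
  fix x :: real
  \<comment> \<open>The function x^(k+1) exp (- b x) peaks at ?c; the bound is y <= exp y at y = x /
    ?c, raised to the power k+1.\<close>
  let ?c = "real (Suc k) / b"
  show "max 0 x ^ Suc k * exp (- (b * x)) \<le> ?c ^ Suc k"
  proof (cases "x > 0")
    case True
    have "x / ?c \<le> exp (x / ?c)" using exp_ge_add_one_self[of "x / ?c"] by linarith
    then have "(x / ?c) ^ Suc k \<le> exp (x / ?c) ^ Suc k" using True b by (intro power_mono) auto
    also have "\<dots> = exp (b * x)" using b by (simp add: exp_of_nat_mult[symmetric] del: of_nat_Suc power_Suc)
    finally have "x ^ Suc k / ?c ^ Suc k \<le> exp (b * x)" unfolding power_divide[of x ?c, symmetric] .
    then have "x ^ Suc k \<le> exp (b * x) * ?c ^ Suc k" using b by (subst (asm) pos_divide_le_eq) (auto simp del: power_Suc)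
    then have "x ^ Suc k * exp (- (b * x)) \<le> exp (b * x) * ?c ^ Suc k * exp (- (b * x))" by (intro mult_right_mono) auto
    also have "\<dots> = ?c ^ Suc k" by (simp add: exp_minus del: power_Suc)
    finally show ?thesis using True by (simp add: max_def del: power_Suc)
  next
    case False
    then show ?thesis using b by (simp add: max_def)
  qed
qed

text \<open>The Gamma density written with max 0 x, as one formula on the whole line;
  \<open>gam1\<close> and \<open>gam2\<close> are its first two derivatives, also at the junction x
  = 0.\<close>

definition gam :: "real \<Rightarrow> real \<Rightarrow> real" where
  "gam b x = b ^ 4 / 6 * (max 0 x ^ 3 * exp (- (b * x)))"

definition gam1 :: "real \<Rightarrow> real \<Rightarrow> real" where
  "gam1 b x = b ^ 4 / 6 * (3 * (max 0 x ^ 2 * exp (- (b * x))) - b * (max 0 x ^ 3 * exp (- (b * x))))"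

definition gam2 :: "real \<Rightarrow> real \<Rightarrow> real" where
  "gam2 b x = b ^ 4 / 6 * (6 * (max 0 x * exp (- (b * x))) - 6 * b * (max 0 x ^ 2 * exp (- (b * x))) + b\<^sup>2 * (max 0 x ^ 3 * exp (- (b * x))))"

lemma gam_eq_erlang: "gam b x = erlang_density 3 b x"
  by (auto simp: gam_def erlang_density_def max_def fact_numeral eval_nat_numeral)

lemma has_derivative_gam: "(gam b has_real_derivative gam1 b x) (at x)"
proof -
  have 3: "((\<lambda>x. max 0 x ^ 3) has_real_derivative 3 * max 0 x ^ 2) (at x)"
    using has_derivative_max_power[of 1 x] by (simp add: eval_nat_numeral)
  have e: "((\<lambda>x. exp (- (b * x))) has_real_derivative - b * exp (- (b * x))) (at x)"
    by (auto intro!: derivative_eq_intros)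
  show ?thesis unfolding gam_def[abs_def]
    by (rule DERIV_cong[OF DERIV_cmult[OF DERIV_mult[OF 3 e]]]) (simp add: gam1_def algebra_simps)
qed

lemma has_derivative_gam1: "(gam1 b has_real_derivative gam2 b x) (at x)"
proof -
  have 3: "((\<lambda>x. max 0 x ^ 3) has_real_derivative 3 * max 0 x ^ 2) (at x)"
    using has_derivative_max_power[of 1 x] by (simp add: eval_nat_numeral)
  have 2: "((\<lambda>x. max 0 x ^ 2) has_real_derivative 2 * max 0 x) (at x)"
    using has_derivative_max_power[of 0 x] by (simp add: eval_nat_numeral)
  have e: "((\<lambda>x. exp (- (b * x))) has_real_derivative - b * exp (- (b * x))) (at x)"
    by (auto intro!: derivative_eq_intros)
  show ?thesis unfolding gam1_def[abs_def]
    by (rule DERIV_cong[OF DERIV_cmult[OF DERIV_diff[OF DERIV_cmult[OF DERIV_mult[OF 2 e]] DERIV_cmult[OF DERIV_mult[OF 3 e]]]]])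
       (simp add: gam2_def algebra_simps power2_eq_square)
qed

lemma gam_bounded:
  assumes b: "0 < b"
  shows "\<exists>B. \<forall>x. \<bar>gam b x\<bar> \<le> B \<and> \<bar>gam1 b x\<bar> \<le> B \<and> \<bar>gam2 b x\<bar> \<le> B"
proof -
  obtain B1 B2 B3 where B: "\<And>x. max 0 x * exp (- (b * x)) \<le> B1" "\<And>x. max 0 x ^ 2 * exp (- (b * x)) \<le> B2" "\<And>x. max 0 x ^ 3 * exp (- (b * x)) \<le> B3"
    using max_power_exp_bounded[OF b, of 0] max_power_exp_bounded[OF b, of 1] max_power_exp_bounded[OF b, of 2]
    by (auto simp: eval_nat_numeral)
  define C where "C = b ^ 4 / 6 * (6 * B1 + (3 + 6 * b) * B2 + (1 + b + b\<^sup>2) * B3)"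
  have C: "\<bar>b ^ 4 / 6 * y\<bar> \<le> C" if "\<bar>y\<bar> \<le> 6 * B1 + (3 + 6 * b) * B2 + (1 + b + b\<^sup>2) * B3" for y
    unfolding C_def abs_mult using that b by (intro mult_mono) auto
  show ?thesis
  proof (intro exI[of _ C] allI)
    fix x :: real
    define p1 p2 p3 where p: "p1 = max 0 x * exp (- (b * x))" "p2 = max 0 x ^ 2 * exp (- (b * x))" "p3 = max 0 x ^ 3 * exp (- (b * x))"
    have pn: "0 \<le> p1" "0 \<le> p2" "0 \<le> p3" by (auto simp: p)
    have pB: "p1 \<le> B1" "p2 \<le> B2" "p3 \<le> B3" using B by (auto simp: p)
    have m: "0 \<le> b * p2" "b * p2 \<le> b * B2" "0 \<le> b * p3" "b * p3 \<le> b * B3" "0 \<le> b\<^sup>2 * p3" "b\<^sup>2 * p3 \<le> b\<^sup>2 * B3"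
      using pn pB b by (auto intro!: mult_left_mono)
    have e: "gam b x = b ^ 4 / 6 * p3" "gam1 b x = b ^ 4 / 6 * (3 * p2 - b * p3)" "gam2 b x = b ^ 4 / 6 * (6 * p1 - 6 * b * p2 + b\<^sup>2 * p3)"
      by (auto simp: gam_def gam1_def gam2_def p)
    have x: "6 * B1 + (3 + 6 * b) * B2 + (1 + b + b\<^sup>2) * B3 = 6 * B1 + 3 * B2 + 6 * (b * B2) + B3 + b * B3 + b\<^sup>2 * B3" by (simp add: algebra_simps)
    show "\<bar>gam b x\<bar> \<le> C \<and> \<bar>gam1 b x\<bar> \<le> C \<and> \<bar>gam2 b x\<bar> \<le> C"
      unfolding e mult.assoc[of 6 b p2]
      by (intro conjI C; unfold x; use pn pB m in linarith)
  qed
qed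

lemma measurable_gam [measurable]: "gam b \<in> borel_measurable borel" "gam1 b \<in> borel_measurable borel" "gam2 b \<in> borel_measurable borel"
  unfolding gam_def[abs_def] gam1_def[abs_def] gam2_def[abs_def] by measurable

locale erlang_factored = fixed_point N for N +
  fixes b :: real and nu :: "real measure"
  assumes b: "0 < b" and nu: "nonneg_distribution nu"
    and N_eq: "N = distr (density lborel (\<lambda>x. ennreal (erlang_density 3 b x)) \<Otimes>\<^sub>M nu) borel (\<lambda>(x, y). 1 * x + y)"
begin

sublocale nu: nonneg_distribution nu by (rule nu)

definition f :: "real \<Rightarrow> real" where "f x = (\<integral>y. gam b (x - y) \<partial>nu)"
definition f1 :: "real \<Rightarrow> real" where "f1 x = (\<integral>y. gam1 b (x - y) \<partial>nu)"
definition f2 :: "real \<Rightarrow> real" where "f2 x = (\<integral>y. gam2 b (x - y) \<partial>nu)"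

text \<open>One bound for all three functions, which later serves as Lipschitz constant of
  \<open>Phi\<close>, \<open>f\<close> and \<open>f1\<close>.\<close>

definition bnd :: real where
  "bnd = (SOME B. \<forall>x. \<bar>gam b x\<bar> \<le> B \<and> \<bar>gam1 b x\<bar> \<le> B \<and> \<bar>gam2 b x\<bar> \<le> B)"

lemma bnd: "\<bar>gam b x\<bar> \<le> bnd" "\<bar>gam1 b x\<bar> \<le> bnd" "\<bar>gam2 b x\<bar> \<le> bnd"
  using someI_ex[OF gam_bounded[OF b]] unfolding bnd_def by blast+

lemma integrable_gam [simp]: "integrable nu (\<lambda>y. gam b (x - y))" "integrable nu (\<lambda>y. gam1 b (x - y))" "integrable nu (\<lambda>y. gam2 b (x - y))"
  by (rule nu.integrable_const_bound[of _ bnd]; use bnd in simp)+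

lemma has_derivative_f: "(f has_real_derivative f1 x) (at x)"
  unfolding f_def[abs_def] f1_def
proof (rule has_real_derivative_integral[where S=UNIV and w="\<lambda>_. bnd"])
  show "AE y in nu. \<forall>x\<in>UNIV. ((\<lambda>x. gam b (x - y)) has_real_derivative gam1 b (x - y)) (at x) \<and> \<bar>gam1 b (x - y)\<bar> \<le> bnd"
    using bnd by (intro AE_I2) (auto intro!: DERIV_chain2[OF has_derivative_gam, THEN DERIV_cong] derivative_eq_intros)
qed auto

lemma has_derivative_f1: "(f1 has_real_derivative f2 x) (at x)"
  unfolding f1_def[abs_def] f2_def
proof (rule has_real_derivative_integral[where S=UNIV and w="\<lambda>_. bnd"])
  show "AE y in nu. \<forall>x\<in>UNIV. ((\<lambda>x. gam1 b (x - y)) has_real_derivative gam2 b (x - y)) (at x) \<and> \<bar>gam2 b (x - y)\<bar> \<le> bnd"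
    using bnd by (intro AE_I2) (auto intro!: DERIV_chain2[OF has_derivative_gam1, THEN DERIV_cong] derivative_eq_intros)
qed auto

lemma f_bound: "\<bar>f x\<bar> \<le> bnd" "\<bar>f1 x\<bar> \<le> bnd" "\<bar>f2 x\<bar> \<le> bnd"
proof -
  have *: "\<bar>\<integral>y. g (x - y) \<partial>nu\<bar> \<le> bnd" if "integrable nu (\<lambda>y. g (x - y))" "\<And>x. \<bar>g x\<bar> \<le> bnd" for g
  proof -
    have "\<bar>\<integral>y. g (x - y) \<partial>nu\<bar> \<le> (\<integral>y. bnd \<partial>nu)"
      by (rule integral_abs_bound[THEN order_trans], rule integral_mono) (use that in \<open>auto intro: integrable_abs\<close>)
    then show ?thesis by simp
  qed
  show "\<bar>f x\<bar> \<le> bnd" "\<bar>f1 x\<bar> \<le> bnd" "\<bar>f2 x\<bar> \<le> bnd"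
    unfolding f_def f1_def f2_def by (rule *; use bnd in simp)+
qed

lemma continuous_f: "continuous_on A f" and continuous_f1: "continuous_on A f1"
  using has_derivative_f has_derivative_f1
  by (auto intro!: DERIV_continuous_on intro: has_field_derivative_at_within)

lemma measurable_f [measurable]: "f \<in> borel_measurable borel" and measurable_f1 [measurable]: "f1 \<in> borel_measurable borel"
  by (intro borel_measurable_continuous_onI continuous_f continuous_f1)+

lemma f_nonneg [simp]: "0 \<le> f x"
  unfolding f_def by (intro integral_nonneg_AE AE_I2) (simp add: gam_def)

lemma f_eq_0: "x \<le> 0 \<Longrightarrow> f x = 0"
proof -
  assume x: "x \<le> 0"
  have "f x = (\<integral>y. 0 \<partial>nu)" unfolding f_def
  proof (rule integral_cong_AE)
    show "AE y in nu. gam b (x - y) = 0"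
      using nu.AE_nonneg by eventually_elim (use x in \<open>simp add: gam_def max_def\<close>)
  qed auto
  then show ?thesis by simp
qed

text \<open>Otherwise \<open>laplace N s\<close> would be at most exp (- e s), against the lower
  bound \<open>laplace_lower_log\<close>, whose exponent is of order (ln s)^2. Positivity of the
  density arbitrarily close to 0 depends on it.\<close>

lemma nu_charges_0: "0 < e \<Longrightarrow> \<not> (AE y in nu. e \<le> y)"
proof
  assume e: "0 < e" and ae: "AE y in nu. e \<le> y"
  have le: "e * s \<le> (ln s)\<^sup>2 / 2 + ln s + 1" if s: "1 \<le> s" for s
  proof -
    have "laplace nu s \<le> (\<integral>y. exp (- (e * s)) \<partial>nu)" unfolding laplace_def
      by (intro integral_mono_AE nu.integrable_exp_neg) (use ae s in \<open>auto elim!: eventually_mono\<close>)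
    then have "laplace nu s \<le> exp (- (e * s))" by simp
    moreover have "laplace N s \<le> laplace nu s"
    proof -
      have "laplace N s = laplace (density lborel (\<lambda>x. ennreal (erlang_density 3 b x))) (1 * s) * laplace nu s"
        by (subst N_eq, rule laplace_convolution[OF nonneg_distribution_erlang[OF b] nu]) (use s in auto)
      also have "\<dots> \<le> 1 * laplace nu s"
        using nonneg_distribution.laplace_le_1[OF nonneg_distribution_erlang[OF b, of 3], of s] nu.laplace_pos[of s] s
        by (intro mult_right_mono) auto
      finally show ?thesis by simp
    qed
    moreover note laplace_lower_log[OF s]
    ultimately have "exp (- ((ln s)\<^sup>2 / 2 + ln s + 1)) \<le> exp (- (e * s))" by linarith
    then show ?thesis by simp
  qed
  have "\<forall>\<^sub>F s in at_top. (ln s)\<^sup>2 / 2 + ln s + 1 < e * s" using e by real_asymp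
  then have "\<forall>\<^sub>F s in at_top. 1 \<le> s \<and> (ln s)\<^sup>2 / 2 + ln s + 1 < e * s" using eventually_ge_at_top by (rule eventually_conj[rotated])
  then obtain s where "1 \<le> s" "(ln s)\<^sup>2 / 2 + ln s + 1 < e * s" using eventually_happens by force
  then show False using le by force
qed

lemma convolution_pos:
  fixes g :: "real \<Rightarrow> real"
  assumes x: "0 < x" and i: "integrable nu (\<lambda>y. g (x - y))"
    and g0: "\<And>u. u \<le> 0 \<Longrightarrow> g u = 0" and gp: "\<And>u. 0 < u \<Longrightarrow> u \<le> x \<Longrightarrow> 0 < g u"
  shows "0 < (\<integral>y. g (x - y) \<partial>nu)"
proof -
  have ae: "AE y in nu. 0 \<le> g (x - y)" using nu.AE_nonneg
  proof eventually_elim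
    case (elim y)
    then show ?case using g0[of "x - y"] gp[of "x - y"] by (cases "x - y \<le> 0") auto
  qed
  have "(\<integral>y. g (x - y) \<partial>nu) \<noteq> 0"
  proof
    assume "(\<integral>y. g (x - y) \<partial>nu) = 0"
    then have "AE y in nu. g (x - y) = 0" using integral_nonneg_eq_0_iff_AE[OF i ae] by simp
    then have "AE y in nu. x \<le> y" using nu.AE_nonneg
    proof eventually_elim
      case (elim y)
      then show ?case using gp[of "x - y"] by (cases "x \<le> y") auto
    qed
    then show False using nu_charges_0[OF x] by simp
  qed
  moreover have "0 \<le> (\<integral>y. g (x - y) \<partial>nu)" by (rule integral_nonneg_AE[OF ae])
  ultimately show ?thesis by simp
qed

lemma f_pos: "0 < x \<Longrightarrow> 0 < f x"
  unfolding f_def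
proof (rule convolution_pos)
  show "gam b u = 0" if "u \<le> 0" for u using that by (simp add: gam_def max_def)
  show "0 < gam b u" if "0 < u" for u using that b by (simp add: gam_def)
qed auto

text \<open>The Gamma density increases on (0, 3/b), and for x < 3/b the convolution sees it at
  points x - y of that interval or where it vanishes. This provides the initial increasing stretch
  of f.\<close>

lemma f1_pos: "0 < x \<Longrightarrow> x < 3 / b \<Longrightarrow> 0 < f1 x"
  unfolding f1_def
proof (rule convolution_pos)
  assume x: "0 < x" "x < 3 / b"
  show "0 < gam1 b u" if u: "0 < u" "u \<le> x" for u
  proof -
    have "b * u \<le> b * x" using u b by (intro mult_left_mono) auto
    also have "b * x < 3" using x b by (simp add: pos_less_divide_eq mult.commute)
    finally have "b * u < 3" .
    then have "0 < b ^ 4 / 6 * (u\<^sup>2 * exp (- (b * u)) * (3 - b * u))" using b u by simp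
    also have "\<dots> = gam1 b u" using u by (simp add: gam1_def power2_eq_square power3_eq_cube algebra_simps)
    finally show ?thesis .
  qed
  show "integrable nu (\<lambda>y. gam1 b (x - y))" by simp
  show "gam1 b u = 0" if "u \<le> 0" for u using that by (simp add: gam1_def max_def)
qed

lemma N_density: "N = density lborel (\<lambda>x. ennreal (f x))"
proof (rule measure_eqI)
  let ?G = "density lborel (\<lambda>x. ennreal (erlang_density 3 b x))"
  interpret G: nonneg_distribution ?G by (rule nonneg_distribution_erlang[OF b])
  interpret P: pair_prob_space ?G nu ..
  fix A assume "A \<in> sets N"
  then have [measurable]: "A \<in> sets borel" by simp
  have "emeasure N A = (\<integral>\<^sup>+p. indicator A (fst p + snd p) \<partial>(?G \<Otimes>\<^sub>M nu))"
    by (subst N_eq, subst nn_integral_indicator[symmetric], simp, subst nn_integral_distr) (auto simp: split_beta')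
  also have "\<dots> = (\<integral>\<^sup>+y. (\<integral>\<^sup>+x. indicator A (x + y) \<partial>?G) \<partial>nu)"
    by (subst P.nn_integral_snd[symmetric]) auto
  also have "\<dots> = (\<integral>\<^sup>+y. (\<integral>\<^sup>+x. ennreal (gam b x) * indicator A (x + y) \<partial>lborel) \<partial>nu)"
    by (intro nn_integral_cong, subst nn_integral_density) (auto simp: gam_eq_erlang)
  also have "\<dots> = (\<integral>\<^sup>+y. (\<integral>\<^sup>+x. ennreal (gam b (x - y)) * indicator A x \<partial>lborel) \<partial>nu)"
  proof (rule nn_integral_cong)
    fix y
    show "(\<integral>\<^sup>+x. ennreal (gam b x) * indicator A (x + y) \<partial>lborel) = (\<integral>\<^sup>+x. ennreal (gam b (x - y)) * indicator A x \<partial>lborel)"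
      by (subst nn_integral_real_affine[of "\<lambda>x. ennreal (gam b (x - y)) * indicator A x" 1 y]) (auto simp: add.commute)
  qed
  also have "\<dots> = (\<integral>\<^sup>+x. (\<integral>\<^sup>+y. ennreal (gam b (x - y)) * indicator A x \<partial>nu) \<partial>lborel)"
    by (rule nu.PL.Fubini') measurable
  also have "\<dots> = (\<integral>\<^sup>+x. ennreal (f x) * indicator A x \<partial>lborel)"
  proof (rule nn_integral_cong)
    fix x
    have "(\<integral>\<^sup>+y. ennreal (gam b (x - y)) \<partial>nu) = ennreal (f x)" unfolding f_def
      by (rule nn_integral_eq_integral[OF integrable_gam(1)]) (auto simp: gam_def)
    then show "(\<integral>\<^sup>+y. ennreal (gam b (x - y)) * indicator A x \<partial>nu) = ennreal (f x) * indicator A x"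
      by (simp add: nn_integral_multc)
  qed
  finally show "emeasure N A = emeasure (density lborel (\<lambda>x. ennreal (f x))) A" by (simp add: emeasure_density)
qed simp

end

lemma (in normalized_distribution) integrable_tail: "integrable lborel (\<lambda>z. indicator {0<..} z * tail N z)"
proof (rule integrableI_nonneg)
  have "(\<integral>\<^sup>+z. ennreal (indicator {0<..} z * tail N z) \<partial>lborel) = (\<integral>\<^sup>+z. indicator {0<..} z * ennreal (tail N z) \<partial>lborel)"
    by (intro nn_integral_cong) (auto simp: indicator_def)
  then show "(\<integral>\<^sup>+z. ennreal (indicator {0<..} z * tail N z) \<partial>lborel) < \<infinity>" using mean_tail by simp
qed auto

lemma lipschitz_of_bounded_deriv:
  fixes g :: "real \<Rightarrow> real"
  assumes "\<And>x. (g has_real_derivative g' x) (at x)" "\<And>x. \<bar>g' x\<bar> \<le> B"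
  shows "\<bar>g x - g y\<bar> \<le> B * \<bar>x - y\<bar>"
  using field_differentiable_bound[of UNIV g g' B x y] assms by auto

context erlang_factored
begin

text \<open>Minus the derivative of \<open>levy\<close>: integration by parts moves the size-bias
  convolution from \<open>levy\<close> to this kernel. It has a 1/z singularity at 0, so it acts on
  increments only.\<close>

definition kap :: "real \<Rightarrow> real" where
  "kap z = tail N z / z * indicator {0<..} z"

lemma measurable_kap [measurable]: "kap \<in> borel_measurable borel"
  unfolding kap_def by measurable

lemma kap_abs: "\<bar>kap z\<bar> * \<bar>z\<bar> = indicator {0<..} z * tail N z"
  by (auto simp: kap_def indicator_def)

text \<open>Increments of a Lipschitz function supply a factor z, and z * \<open>kap z\<close> is
  the tail, which is integrable. The same bound for g' dominates the differentiated
  integrand.\<close>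

lemma kap_convolution:
  fixes g g' :: "real \<Rightarrow> real"
  assumes d: "\<And>x. (g has_real_derivative g' x) (at x)"
    and L: "\<And>x y. \<bar>g x - g y\<bar> \<le> B * \<bar>x - y\<bar>" and L': "\<And>x y. \<bar>g' x - g' y\<bar> \<le> B * \<bar>x - y\<bar>"
    and [measurable]: "g \<in> borel_measurable borel" "g' \<in> borel_measurable borel"
  shows "integrable lborel (\<lambda>z. kap z * (g x - g (x - z)))"
    and "((\<lambda>x. \<integral>z. kap z * (g x - g (x - z)) \<partial>lborel) has_real_derivative (\<integral>z. kap z * (g' x - g' (x - z)) \<partial>lborel)) (at x)"
proof -
  have bd: "\<bar>kap z * (h x - h (x - z))\<bar> \<le> B * (indicator {0<..} z * tail N z)" if "\<And>x y. \<bar>h x - h y\<bar> \<le> B * \<bar>x - y\<bar>" for h :: "real \<Rightarrow> real" and x z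
  proof -
    have "\<bar>kap z * (h x - h (x - z))\<bar> \<le> \<bar>kap z\<bar> * (B * \<bar>z\<bar>)"
      unfolding abs_mult using that[of x "x - z"] by (intro mult_left_mono) auto
    then show ?thesis using kap_abs[of z] by (simp add: mult.left_commute)
  qed
  show i: "integrable lborel (\<lambda>z. kap z * (g x - g (x - z)))" for x
  proof (rule Bochner_Integration.integrable_bound)
    show "integrable lborel (\<lambda>z. B * (indicator {0<..} z * tail N z))" using N.integrable_tail by simp
    show "AE z in lborel. norm (kap z * (g x - g (x - z))) \<le> norm (B * (indicator {0<..} z * tail N z))"
      using bd[of g, OF L] by (intro AE_I2) (auto intro: order_trans[OF _ abs_ge_self])
  qed measurable
  show "((\<lambda>x. \<integral>z. kap z * (g x - g (x - z)) \<partial>lborel) has_real_derivative (\<integral>z. kap z * (g' x - g' (x - z)) \<partial>lborel)) (at x)"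
  proof (rule has_real_derivative_integral[where S=UNIV and w="\<lambda>z. B * (indicator {0<..} z * tail N z)"])
    show "AE z in lborel. \<forall>x\<in>UNIV. ((\<lambda>x. kap z * (g x - g (x - z))) has_real_derivative kap z * (g' x - g' (x - z))) (at x)
       \<and> \<bar>kap z * (g' x - g' (x - z))\<bar> \<le> B * (indicator {0<..} z * tail N z)"
    proof (intro AE_I2 ballI conjI bd L')
      fix z x
      have "((\<lambda>x. g (x - z)) has_real_derivative g' (x - z) * 1) (at x)"
        by (rule DERIV_chain2[OF d]) (auto intro!: derivative_eq_intros)
      then show "((\<lambda>x. kap z * (g x - g (x - z))) has_real_derivative kap z * (g' x - g' (x - z))) (at x)"
        using d by (intro DERIV_cmult DERIV_diff) auto
    qed
    show "integrable lborel (\<lambda>z. B * (indicator {0<..} z * tail N z))" using N.integrable_tail by simp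
  qed (use i in auto)
qed

lemma nn_integral_f: "(\<integral>\<^sup>+x. ennreal (f x) \<partial>lborel) = 1"
proof -
  have "emeasure N UNIV = (\<integral>\<^sup>+x. ennreal (f x) \<partial>lborel)"
    by (subst N_density) (simp add: emeasure_density)
  then show ?thesis using N.emeasure_space_1 by simp
qed

lemma integrable_f: "integrable lborel f"
  by (rule integrableI_nonneg) (auto simp: nn_integral_f)

text \<open>A primitive of f, so that the size-bias equation and its two derivatives have the same
  shape, with \<open>Phi\<close>, \<open>f\<close> and \<open>f1\<close> in turn.\<close>

definition Phi :: "real \<Rightarrow> real" where
  "Phi x = (\<integral>u. f u * indicator {..x} u \<partial>lborel)"

lemma Phi_diff:
  assumes ax: "a \<le> x"
  shows "Phi x - Phi a = (\<integral>u. f u * indicator {a<..x} u \<partial>lborel)" "Phi x - Phi a = integral {a..x} f"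
proof -
  show 1: "Phi x - Phi a = (\<integral>u. f u * indicator {a<..x} u \<partial>lborel)"
  proof -
    have i: "integrable lborel (\<lambda>u. f u * indicator {..c} u)" for c
      by (intro integrable_real_mult_indicator integrable_f) simp
    have "Phi x - Phi a = (\<integral>u. f u * indicator {..x} u - f u * indicator {..a} u \<partial>lborel)"
      unfolding Phi_def by (rule Bochner_Integration.integral_diff[symmetric]) (rule i)+
    also have "\<dots> = (\<integral>u. f u * indicator {a<..x} u \<partial>lborel)"
      by (rule Bochner_Integration.integral_cong) (use ax in \<open>auto split: split_indicator\<close>)
    finally show ?thesis .
  qed
  have si: "set_integrable lborel {a..x} f"
    using borel_integrable_compact[of "{a..x}" f] continuous_f by (simp add: set_integrable_def)
  have "(\<integral>u. f u * indicator {a<..x} u \<partial>lborel) = (LINT u:{a..x}|lborel. f u)"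
    unfolding set_lebesgue_integral_def
    by (rule integral_cong_AE) (use AE_lborel_neq[of a] in \<open>auto elim!: eventually_mono simp: indicator_def\<close>)
  then show "Phi x - Phi a = integral {a..x} f" using 1 set_borel_integral_eq_integral(2)[OF si] by simp
qed

lemma has_derivative_Phi: "(Phi has_real_derivative f x) (at x)"
proof -
  have "((\<lambda>y. integral {x-1..y} f) has_real_derivative f x) (at x within {x-1..x+1})"
    by (rule integral_has_real_derivative[OF continuous_f]) auto
  then have d: "((\<lambda>y. integral {x-1..y} f) has_real_derivative f x) (at x)"
    by (subst (asm) at_within_interior) auto
  have "((\<lambda>y. Phi (x-1) + integral {x-1..y} f) has_real_derivative 0 + f x) (at x)"
    by (intro DERIV_add DERIV_const d)
  moreover have ev: "\<forall>\<^sub>F y in nhds x. Phi y = Phi (x-1) + integral {x-1..y} f"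
    using eventually_nhds_in_open[of "{x-1<..}" x]
    by (auto elim!: eventually_mono simp: Phi_diff(2)[symmetric])
  ultimately show ?thesis by (subst DERIV_cong_ev[OF refl ev refl]) simp
qed

lemma Phi_lipschitz: "\<bar>Phi x - Phi y\<bar> \<le> bnd * \<bar>x - y\<bar>"
  by (rule lipschitz_of_bounded_deriv[OF has_derivative_Phi f_bound(1)])

lemma f_lipschitz: "\<bar>f x - f y\<bar> \<le> bnd * \<bar>x - y\<bar>"
  by (rule lipschitz_of_bounded_deriv[OF has_derivative_f f_bound(2)])

lemma f1_lipschitz: "\<bar>f1 x - f1 y\<bar> \<le> bnd * \<bar>x - y\<bar>"
  by (rule lipschitz_of_bounded_deriv[OF has_derivative_f1 f_bound(3)])

lemma measurable_Phi [measurable]: "Phi \<in> borel_measurable borel"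
  by (intro borel_measurable_continuous_onI DERIV_continuous_on[of _ _ f]) (auto intro: has_field_derivative_at_within has_derivative_Phi)

lemma nn_integral_N: "g \<in> borel_measurable borel \<Longrightarrow> (\<integral>\<^sup>+x. g x \<partial>N) = (\<integral>\<^sup>+x. ennreal (f x) * g x \<partial>lborel)"
  by (subst N_density, subst nn_integral_density) auto

text \<open>Writing \<open>levy\<close> as an integral of \<open>kap\<close> and exchanging the
  integrals leaves the integral of f (x - y) over 0 < y < z, an increment of
  \<open>Phi\<close>.\<close>

lemma levy_convolution_eq:
  "(\<integral>\<^sup>+y. ennreal (levy N y) * ennreal (f (x - y)) \<partial>lborel) = ennreal (\<integral>z. kap z * (Phi x - Phi (x - z)) \<partial>lborel)"
proof -
  have Phi_mono: "Phi a \<le> Phi x" if "a \<le> x" for a x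
  proof -
    have "0 \<le> (\<integral>u. f u * indicator {a<..x} u \<partial>lborel)" by (intro integral_nonneg_AE AE_I2) simp
    then show ?thesis using Phi_diff(1)[OF that] by linarith
  qed
  have "(\<integral>\<^sup>+y. ennreal (levy N y) * ennreal (f (x - y)) \<partial>lborel) = (\<integral>\<^sup>+y. ennreal (f (x - y)) * indicator {0<..} y * levy_nn N y \<partial>lborel)"
    by (intro nn_integral_cong) (simp add: N.levy_nn_eq[symmetric] mult_ac)
  also have "\<dots> = (\<integral>\<^sup>+z. ennreal (tail N z / z) * indicator {0<..} z * (\<integral>\<^sup>+y. ennreal (f (x - y)) * indicator {0<..<z} y \<partial>lborel) \<partial>lborel)"
    by (rule N.levy_tonelli) measurable
  also have "\<dots> = (\<integral>\<^sup>+z. ennreal (kap z * (Phi x - Phi (x - z))) \<partial>lborel)"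
  proof (rule nn_integral_cong)
    fix z :: real
    show "ennreal (tail N z / z) * indicator {0<..} z * (\<integral>\<^sup>+y. ennreal (f (x - y)) * indicator {0<..<z} y \<partial>lborel) = ennreal (kap z * (Phi x - Phi (x - z)))"
    proof (cases "z > 0")
      case True
      have "(\<integral>\<^sup>+y. ennreal (f (x - y)) * indicator {0<..<z} y \<partial>lborel) = (\<integral>\<^sup>+u. ennreal (f u) * indicator {x - z<..<x} u \<partial>lborel)"
        by (subst nn_integral_real_affine[of "\<lambda>y. ennreal (f (x - y)) * indicator {0<..<z} y" "-1" x])
           (auto intro!: nn_integral_cong simp: indicator_def)
      also have "\<dots> = (\<integral>\<^sup>+u. ennreal (f u * indicator {x - z<..x} u) \<partial>lborel)"
        by (rule nn_integral_cong_AE) (use AE_lborel_neq[of x] in \<open>auto elim!: eventually_mono simp: indicator_def\<close>)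
      also have "\<dots> = ennreal (Phi x - Phi (x - z))"
        unfolding Phi_diff(1)[of "x - z" x, simplified less_imp_le[OF True] diff_le_eq le_add_same_cancel1, OF TrueI]
        by (intro nn_integral_eq_integral integrable_real_mult_indicator integrable_f) auto
      finally show ?thesis using True Phi_mono[of "x - z" x] by (simp add: kap_def ennreal_mult[symmetric])
    qed (simp add: kap_def)
  qed
  also have "\<dots> = ennreal (\<integral>z. kap z * (Phi x - Phi (x - z)) \<partial>lborel)"
  proof (rule nn_integral_eq_integral)
    show "integrable lborel (\<lambda>z. kap z * (Phi x - Phi (x - z)))"
      by (rule kap_convolution[OF has_derivative_Phi Phi_lipschitz f_lipschitz]) measurable
    show "AE z in lborel. 0 \<le> kap z * (Phi x - Phi (x - z))"
    proof (rule AE_I2)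
      fix z show "0 \<le> kap z * (Phi x - Phi (x - z))"
        using Phi_mono[of "x - z" x] by (cases "z > 0") (auto simp: kap_def)
    qed
  qed
  finally show ?thesis .
qed

text \<open>The size-bias identity of measures, read off on densities, holds almost everywhere; both
  sides are continuous, so it holds everywhere.\<close>

lemma E0: "x * f x = (\<integral>z. kap z * (Phi x - Phi (x - z)) \<partial>lborel)"
proof -
  let ?c = "\<lambda>x. \<integral>\<^sup>+y. ennreal (levy N y) * ennreal (f (x - y)) \<partial>lborel"
  let ?R = "\<lambda>x. \<integral>z. kap z * (Phi x - Phi (x - z)) \<partial>lborel"
  have eqm: "density lborel (\<lambda>x. ennreal (x * f x)) = density lborel ?c"
  proof (rule measure_eqI)
    fix A assume "A \<in> sets (density lborel (\<lambda>x. ennreal (x * f x)))"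
    then have [measurable]: "A \<in> sets borel" by simp
    have "emeasure (density lborel (\<lambda>x. ennreal (x * f x))) A = (\<integral>\<^sup>+x. ennreal (f x) * (ennreal x * indicator A x) \<partial>lborel)"
    proof -
      have "ennreal (x * f x) * indicator A x = ennreal (f x) * (ennreal x * indicator A x)" for x
      proof (cases "x > 0")
        case True
        then have "ennreal (x * f x) = ennreal (f x) * ennreal x" by (subst mult.commute, intro ennreal_mult) auto
        then show ?thesis by (simp only: mult.assoc)
      next
        case False
        then show ?thesis using f_eq_0[of x] by simp
      qed
      then show ?thesis by (subst emeasure_density) simp_all
    qed
    also have "\<dots> = (\<integral>\<^sup>+x. ennreal x * indicator A x \<partial>N)" by (rule nn_integral_N[symmetric]) measurable
    also have "\<dots> = (\<integral>\<^sup>+x. (\<integral>\<^sup>+y. ennreal (levy N y) * indicator A (x + y) \<partial>lborel) \<partial>N)"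
      by (rule size_biased_nn_integral) measurable
    also have "\<dots> = (\<integral>\<^sup>+x. ennreal (f x) * (\<integral>\<^sup>+y. ennreal (levy N y) * indicator A (x + y) \<partial>lborel) \<partial>lborel)"
      by (rule nn_integral_N) measurable
    also have "\<dots> = (\<integral>\<^sup>+x. (\<integral>\<^sup>+y. ennreal (f x) * (ennreal (levy N y) * indicator A (x + y)) \<partial>lborel) \<partial>lborel)"
      by (intro nn_integral_cong nn_integral_cmult[symmetric]) measurable
    also have "\<dots> = (\<integral>\<^sup>+y. (\<integral>\<^sup>+x. ennreal (f x) * (ennreal (levy N y) * indicator A (x + y)) \<partial>lborel) \<partial>lborel)"
      by (rule lborel_pair.Fubini') measurable
    also have "\<dots> = (\<integral>\<^sup>+y. (\<integral>\<^sup>+x. ennreal (levy N y) * ennreal (f (x - y)) * indicator A x \<partial>lborel) \<partial>lborel)"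
    proof (rule nn_integral_cong)
      fix y
      show "(\<integral>\<^sup>+x. ennreal (f x) * (ennreal (levy N y) * indicator A (x + y)) \<partial>lborel) = (\<integral>\<^sup>+x. ennreal (levy N y) * ennreal (f (x - y)) * indicator A x \<partial>lborel)"
        by (subst nn_integral_real_affine[of "\<lambda>x. ennreal (levy N y) * ennreal (f (x - y)) * indicator A x" 1 y])
           (simp_all add: add.commute[of y] mult.left_commute mult.assoc)
    qed
    also have "\<dots> = (\<integral>\<^sup>+x. (\<integral>\<^sup>+y. ennreal (levy N y) * ennreal (f (x - y)) * indicator A x \<partial>lborel) \<partial>lborel)"
      by (rule lborel_pair.Fubini') measurable
    also have "\<dots> = (\<integral>\<^sup>+x. ?c x * indicator A x \<partial>lborel)"
      by (intro nn_integral_cong nn_integral_multc) measurable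
    also have "\<dots> = emeasure (density lborel ?c) A"
      by (rule emeasure_density[symmetric]) measurable
    finally show "emeasure (density lborel (\<lambda>x. ennreal (x * f x))) A = emeasure (density lborel ?c) A" .
  qed simp
  have "AE x in lborel. ennreal (x * f x) = ?c x"
    by (rule sigma_finite_measure.density_unique[OF lborel.sigma_finite_measure_axioms _ _ eqm]) measurable
  then have ae: "AE x in lborel. x \<in> UNIV \<longrightarrow> x * f x = ?R x"
  proof eventually_elim
    case (elim x)
    have "0 \<le> x * f x" using f_eq_0[of x] by (cases "x > 0") auto
    moreover have "0 \<le> ?R x"
    proof (intro integral_nonneg_AE AE_I2)
      fix z
      have "0 \<le> (\<integral>u. f u * indicator {x-z<..x} u \<partial>lborel)" by (intro integral_nonneg_AE AE_I2) simp
      then show "0 \<le> kap z * (Phi x - Phi (x - z))" using Phi_diff(1)[of "x - z" x] by (cases "z > 0") (auto simp: kap_def)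
    qed
    moreover have "ennreal (x * f x) = ennreal (?R x)"
      using elim levy_convolution_eq[of x] by (rule trans)
    ultimately have "x * f x = ?R x" by (rule ennreal_inj[THEN iffD1])
    then show ?case by blast
  qed
  show ?thesis
  proof (rule AE_eq_continuous_imp_eq[where S=UNIV and f="\<lambda>x. x * f x" and g="?R"])
    show "continuous_on UNIV (\<lambda>x. x * f x)" by (intro continuous_intros continuous_f)
    show "continuous_on UNIV ?R"
      by (rule DERIV_continuous_on[where D="\<lambda>x. \<integral>z. kap z * (f x - f (x - z)) \<partial>lborel"])
         (rule has_field_derivative_at_within, rule kap_convolution(2)[OF has_derivative_Phi Phi_lipschitz f_lipschitz], measurable)
  qed (rule open_UNIV, rule ae, rule UNIV_I)
qed

lemma E1: "f x + x * f1 x = (\<integral>z. kap z * (f x - f (x - z)) \<partial>lborel)"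
proof -
  have "((\<lambda>x. x * f x) has_real_derivative 1 * f x + f1 x * x) (at x)"
    by (intro DERIV_mult DERIV_ident has_derivative_f)
  moreover have "((\<lambda>x. x * f x) has_real_derivative (\<integral>z. kap z * (f x - f (x - z)) \<partial>lborel)) (at x)"
    unfolding E0 by (rule kap_convolution(2)[OF has_derivative_Phi Phi_lipschitz f_lipschitz]) measurable
  ultimately show ?thesis using DERIV_unique by (fastforce simp: mult.commute)
qed

lemma E2: "2 * f1 x + x * f2 x = (\<integral>z. kap z * (f1 x - f1 (x - z)) \<partial>lborel)"
proof -
  have "((\<lambda>x. f x + x * f1 x) has_real_derivative f1 x + (1 * f1 x + f2 x * x)) (at x)"
    by (intro DERIV_add DERIV_mult DERIV_ident has_derivative_f has_derivative_f1)
  moreover have "((\<lambda>x. f x + x * f1 x) has_real_derivative (\<integral>z. kap z * (f1 x - f1 (x - z)) \<partial>lborel)) (at x)"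
    unfolding E1 by (rule kap_convolution(2)[OF has_derivative_f f_lipschitz f1_lipschitz]) measurable
  ultimately have "f1 x + (1 * f1 x + f2 x * x) = (\<integral>z. kap z * (f1 x - f1 (x - z)) \<partial>lborel)" by (rule DERIV_unique)
  then show ?thesis by (simp add: mult.commute)
qed

text \<open>The criterion \<open>unimodal_of_delay_equation\<close> applies once f' is nonpositive
  somewhere on the positive half line; otherwise f would stay above f 1 on [1, infinity) and have
  infinite mass.\<close>

lemma f_unimodal:
  "\<exists>a>0. (\<forall>x y. x \<le> y \<and> y \<le> a \<longrightarrow> f x \<le> f y) \<and> (\<forall>x y. a \<le> x \<and> x \<le> y \<longrightarrow> f y \<le> f x)"
proof -
  have "\<exists>x0>0. f1 x0 \<le> 0"
  proof (rule ccontr)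
    assume "\<not> ?thesis"
    then have p: "0 < f1 x" if "0 < x" for x using that by force
    have ge: "f 1 \<le> f x" if "1 \<le> x" for x
    proof (rule DERIV_nonneg_imp_nondecreasing[OF that])
      fix z assume "1 \<le> z" "z \<le> x"
      then show "\<exists>y. (f has_real_derivative y) (at z) \<and> 0 \<le> y"
        using has_derivative_f[of z] p[of z] by (intro exI[of _ "f1 z"]) auto
    qed
    have "(\<integral>\<^sup>+x. ennreal (f 1) * indicator {1::real..} x \<partial>lborel) \<le> (\<integral>\<^sup>+x. ennreal (f x) \<partial>lborel)"
      by (rule nn_integral_mono) (use ge in \<open>auto simp: indicator_def intro!: ennreal_leI\<close>)
    moreover have "(\<integral>\<^sup>+x. ennreal (f 1) * indicator {1::real..} x \<partial>lborel) = ennreal (f 1) * emeasure lborel {1::real..}"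
      by (rule nn_integral_cmult_indicator) simp
    moreover have "emeasure lborel {1::real..} = \<top>"
    proof (rule ccontr)
      assume fin: "emeasure lborel {1::real..} \<noteq> \<top>"
      define c where "c = enn2real (emeasure lborel {1::real..})"
      have c: "emeasure lborel {1::real..} = ennreal c" "0 \<le> c"
        using fin by (simp_all add: c_def top.not_eq_extremum)
      have "emeasure lborel {1..1 + (c + 1)} \<le> emeasure lborel {1::real..}" by (rule emeasure_mono) auto
      moreover have "emeasure lborel {1..1 + (c + 1)} = ennreal (c + 1)" using c(2) by simp
      ultimately have "ennreal (c + 1) \<le> ennreal c" unfolding c(1) by simp
      then show False using c(2) by (subst (asm) ennreal_le_iff) auto
    qed
    ultimately show False using f_pos[of 1] by (simp add: nn_integral_f ennreal_mult_top top_unique)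
  qed
  then obtain x0 where x0: "x0 > 0" "f1 x0 \<le> 0" by blast
  show ?thesis
  proof (rule unimodal_of_delay_equation[where kap=kap, OF has_derivative_f has_derivative_f1 f_eq_0 f_pos _ f1_pos _ _ _ _ E1 E2 x0])
    show "0 < 3 / b" using b by simp
    show "kap z = 0" if "z \<le> 0" for z using that by (simp add: kap_def)
    show "0 < kap z" if "0 < z" for z using that tail_pos[of z] by (simp add: kap_def)
    show "integrable lborel (\<lambda>z. kap z * (f x - f (x - z)))" for x
      by (rule kap_convolution(1)[OF has_derivative_f f_lipschitz f1_lipschitz]) measurable
    show "integrable lborel (\<lambda>z. kap z * (f1 x - f1 (x - z)))" for x
    proof (rule Bochner_Integration.integrable_bound)
      show "integrable lborel (\<lambda>z. bnd * (indicator {0<..} z * tail N z))" using N.integrable_tail by simp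
      show "AE z in lborel. norm (kap z * (f1 x - f1 (x - z))) \<le> norm (bnd * (indicator {0<..} z * tail N z))"
      proof (rule AE_I2)
        fix z
        have "\<bar>kap z * (f1 x - f1 (x - z))\<bar> \<le> \<bar>kap z\<bar> * (bnd * \<bar>z\<bar>)"
          unfolding abs_mult using f1_lipschitz[of x "x - z"] by (intro mult_left_mono) auto
        also have "\<dots> = bnd * (indicator {0<..} z * tail N z)" using kap_abs[of z] by (simp add: mult.left_commute)
        finally show "norm (kap z * (f1 x - f1 (x - z))) \<le> norm (bnd * (indicator {0<..} z * tail N z))" by simp
      qed
    qed measurable
  qed auto
qed

end

text \<open>Scaling by exp (- s) turns the Levy density into \<open>levy N (exp s * z) / z\<close>.
  As \<open>levy N\<close> is nonincreasing, its difference to \<open>levy N z / z\<close> is again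
  a Levy density, realised by \<open>ex_infinitely_divisible\<close>.\<close>

lemma (in fixed_point_ppp) self_decomposable_N: "self_decomposable N"
  unfolding self_decomposable_def
proof (intro allI impI)
  fix s :: real assume s: "s > 0"
  define j where "j z = (if 0 < z then (levy N z - levy N (exp s * z)) / z else 0)" for z
  have [measurable]: "j \<in> borel_measurable borel" unfolding j_def by measurable
  have e1: "z \<le> exp s * z" if "0 < z" for z using s that by simp
  have j0: "0 \<le> j z" for z using N.levy_antimono[of z "exp s * z"] e1[of z] by (simp add: j_def)
  have "(\<integral>\<^sup>+z. ennreal (z * j z) * indicator {0<..} z \<partial>lborel) \<le> (\<integral>\<^sup>+z. ennreal (levy N z) \<partial>lborel)"
    by (rule nn_integral_mono) (auto simp: j_def indicator_def intro!: ennreal_leI)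
  then have "(\<integral>\<^sup>+z. ennreal (z * j z) * indicator {0<..} z \<partial>lborel) < \<top>"
    unfolding N.levy_integral by (rule le_less_trans) simp
  then obtain nu where nu: "nonneg_distribution nu"
    "\<And>u. u \<ge> 0 \<Longrightarrow> laplace nu u = expm (\<integral>\<^sup>+z. ennreal ((1 - exp (- (u * z))) * j z) * indicator {0<..} z \<partial>lborel)"
    using ex_infinitely_divisible[OF prob_M ppp, of j] j0 by auto
  interpret nu: nonneg_distribution nu by fact
  have ex: "laplace N u = expm (\<integral>\<^sup>+z. ennreal ((1 - exp (- (u * z))) / z * levy N z) \<partial>lborel)" if u: "u \<ge> 0" for u
  proof (cases "u = 0")
    case False
    then show ?thesis using laplace_fixed[OF u] N.quad_integral_laplace[of u] u by simp
  qed (simp add: N.laplace_0)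
  have "laplace N u = laplace (distr (N \<Otimes>\<^sub>M nu) borel (\<lambda>(x, y). exp (- s) * x + y)) u" if u: "u \<ge> 0" for u
  proof -
    have 1: "(\<integral>\<^sup>+z. ennreal ((1 - exp (- (exp (- s) * u * z))) / z * levy N z) \<partial>lborel)
      = (\<integral>\<^sup>+z. ennreal ((1 - exp (- (u * z))) / z * levy N (exp s * z)) \<partial>lborel)"
    proof -
      have "(\<integral>\<^sup>+z. ennreal ((1 - exp (- (exp (- s) * u * z))) / z * levy N z) \<partial>lborel)
        = ennreal \<bar>exp s\<bar> * (\<integral>\<^sup>+z. ennreal ((1 - exp (- (exp (- s) * u * (0 + exp s * z)))) / (0 + exp s * z) * levy N (0 + exp s * z)) \<partial>lborel)"
        by (rule nn_integral_real_affine) auto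
      also have "\<dots> = (\<integral>\<^sup>+z. ennreal \<bar>exp s\<bar> * ennreal ((1 - exp (- (exp (- s) * u * (0 + exp s * z)))) / (0 + exp s * z) * levy N (0 + exp s * z)) \<partial>lborel)"
        by (rule nn_integral_cmult[symmetric]) measurable
      also have "\<dots> = (\<integral>\<^sup>+z. ennreal ((1 - exp (- (u * z))) / z * levy N (exp s * z)) \<partial>lborel)"
      proof (rule nn_integral_cong)
        fix z :: real
        have e: "exp (- s) * u * (0 + exp s * z) = u * z" by (simp add: exp_minus)
        have "ennreal \<bar>exp s\<bar> * ennreal ((1 - exp (- (u * z))) / (0 + exp s * z) * levy N (0 + exp s * z))
          = ennreal (exp s * ((1 - exp (- (u * z))) / (exp s * z) * levy N (exp s * z)))"
          by (subst ennreal_mult') simp_all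
        also have "exp s * ((1 - exp (- (u * z))) / (exp s * z) * levy N (exp s * z)) = (1 - exp (- (u * z))) / z * levy N (exp s * z)"
          by simp
        finally show "ennreal \<bar>exp s\<bar> * ennreal ((1 - exp (- (exp (- s) * u * (0 + exp s * z)))) / (0 + exp s * z) * levy N (0 + exp s * z))
          = ennreal ((1 - exp (- (u * z))) / z * levy N (exp s * z))" unfolding e .
      qed
      finally show ?thesis .
    qed
    have "(\<integral>\<^sup>+z. ennreal ((1 - exp (- (u * z))) / z * levy N z) \<partial>lborel)
      = (\<integral>\<^sup>+z. ennreal ((1 - exp (- (u * z))) / z * levy N (exp s * z)) + ennreal ((1 - exp (- (u * z))) * j z) * indicator {0<..} z \<partial>lborel)"
    proof (rule nn_integral_cong)
      fix z :: real
      show "ennreal ((1 - exp (- (u * z))) / z * levy N z) = ennreal ((1 - exp (- (u * z))) / z * levy N (exp s * z)) + ennreal ((1 - exp (- (u * z))) * j z) * indicator {0<..} z"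
      proof (cases "z > 0")
        case True
        have e0: "0 \<le> 1 - exp (- (u * z))" using u True by simp
        have "(1 - exp (- (u * z))) / z * levy N z = (1 - exp (- (u * z))) / z * levy N (exp s * z) + (1 - exp (- (u * z))) * j z"
          using True by (simp add: j_def field_simps)
        moreover have "ennreal ((1 - exp (- (u * z))) / z * levy N (exp s * z) + (1 - exp (- (u * z))) * j z)
          = ennreal ((1 - exp (- (u * z))) / z * levy N (exp s * z)) + ennreal ((1 - exp (- (u * z))) * j z)"
          using e0 j0[of z] True by (intro ennreal_plus) auto
        ultimately show ?thesis using True by simp
      next
        case False
        then have "\<not> 0 < exp s * z" by (simp add: zero_less_mult_iff)
        then show ?thesis using False by (simp add: levy_def)
      qed
    qed
    also have "\<dots> = (\<integral>\<^sup>+z. ennreal ((1 - exp (- (u * z))) / z * levy N (exp s * z)) \<partial>lborel) + (\<integral>\<^sup>+z. ennreal ((1 - exp (- (u * z))) * j z) * indicator {0<..} z \<partial>lborel)"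
      by (rule nn_integral_add) measurable
    finally have "laplace N u = laplace N (exp (- s) * u) * laplace nu u"
      using ex[OF u] ex[of "exp (- s) * u"] nu(2)[OF u] u unfolding 1 by (simp add: expm_add)
    then show ?thesis using laplace_convolution[OF N.nonneg_distribution_axioms nu(1), of "exp (- s)" u] u by simp
  qed
  then have "N = distr (N \<Otimes>\<^sub>M nu) borel (\<lambda>(x, y). exp (- s) * x + y)"
    by (intro laplace_unique nonneg_distribution_convolution N.nonneg_distribution_axioms nu(1)) auto
  moreover have "prob_space nu" "sets nu = sets borel" by (auto intro: nu.prob_space_axioms)
  ultimately show "\<exists>nu. prob_space nu \<and> sets nu = sets borel \<and> N = distr (N \<Otimes>\<^sub>M nu) borel (\<lambda>(a, b). exp (- s) * a + b)"
    by blast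
qed

section \<open>Logarithmic asymptotics of the density\<close>

context erlang_factored
begin

lemma emeasure_N: "A \<in> sets borel \<Longrightarrow> emeasure N A = (\<integral>\<^sup>+x. ennreal (f x) * indicator A x \<partial>lborel)"
  by (subst N_density) (simp add: emeasure_density)

lemma measure_Icc_le:
  assumes pq: "p \<le> q" and c: "0 \<le> c" "\<And>u. p \<le> u \<Longrightarrow> u \<le> q \<Longrightarrow> f u \<le> c"
  shows "measure N {p..q} \<le> c * (q - p)"
proof -
  have "emeasure N {p..q} \<le> (\<integral>\<^sup>+x. ennreal c * indicator {p..q} x \<partial>lborel)"
    unfolding emeasure_N[of "{p..q}", simplified]
    by (rule nn_integral_mono) (use c in \<open>auto simp: indicator_def intro!: ennreal_leI\<close>)
  also have "\<dots> = ennreal c * ennreal (q - p)" using pq by (subst nn_integral_cmult_indicator) auto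
  also have "\<dots> = ennreal (c * (q - p))" using c by (simp add: ennreal_mult')
  finally have "ennreal (measure N {p..q}) \<le> ennreal (c * (q - p))" by (simp add: N.emeasure_eq_measure)
  then show ?thesis using c pq by (subst (asm) ennreal_le_iff) auto
qed

lemma measure_Icc_ge:
  assumes pq: "p \<le> q" and c: "0 \<le> c" "\<And>u. p \<le> u \<Longrightarrow> u \<le> q \<Longrightarrow> c \<le> f u"
  shows "c * (q - p) \<le> measure N {p..q}"
proof -
  have "ennreal (c * (q - p)) = ennreal c * ennreal (q - p)" using c by (simp add: ennreal_mult')
  also have "\<dots> = (\<integral>\<^sup>+x. ennreal c * indicator {p..q} x \<partial>lborel)" using pq by (subst nn_integral_cmult_indicator) auto
  also have "\<dots> \<le> emeasure N {p..q}"
    unfolding emeasure_N[of "{p..q}", simplified]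
    by (rule nn_integral_mono) (use c in \<open>auto simp: indicator_def intro!: ennreal_leI\<close>)
  finally have "ennreal (c * (q - p)) \<le> ennreal (measure N {p..q})" by (simp add: N.emeasure_eq_measure)
  then show ?thesis by (subst (asm) ennreal_le_iff) auto
qed

text \<open>Beyond the mode f is nonincreasing. So f x is at most the mass of [x - 1, x], to which
  Chernoff's bound applies for every t < \<open>r_star\<close>; and f x * (d * x) is at least the
  mass of [x, (1 + d) x], which \<open>interval_mass_lower\<close> bounds below.\<close>

lemma asymp_at_top: "(\<lambda>x. - ln (f x)) \<sim>[at_top] (\<lambda>x. r_star * x)"
proof (rule asymp_equivI', rule order_tendstoI)
  obtain a where a: "a > 0" "\<And>x y. a \<le> x \<Longrightarrow> x \<le> y \<Longrightarrow> f y \<le> f x" using f_unimodal by blast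
  {
    fix c :: real assume c: "c < 1"
    \<comment> \<open>Truncation at 0 covers negative c. Below, t is the midpoint of
      \<open>r_star\<close> * c' and \<open>r_star\<close>, so that the linear excess t -
      \<open>r_star\<close> * c' beats the constants.\<close>
    define c' where "c' = max c 0"
    have c': "0 \<le> c'" "c \<le> c'" "c' < 1" using c by (auto simp: c'_def)
    define t where "t = r_star * ((1 + c') / 2)"
    have "r_star * ((1 + c') / 2) < r_star * 1" "r_star * c' < r_star * ((1 + c') / 2)"
      using c' r_star_pos by (intro mult_strict_left_mono; simp)+
    then have t: "0 < t" "t < r_star" "r_star * c' < t" using c' r_star_pos by (auto simp: t_def)
    define K where "K = ln (mgf t)"
    have m: "0 < mgf t" using mgf_ge[OF t(1,2)] t by simp
    have bound: "t * (x - 1) - K \<le> - ln (f x)" if x: "x \<ge> a + 1" for x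
    proof -
      have x0: "0 < x" using x a by simp
      have "f x * (x - (x - 1)) \<le> measure N {x - 1..x}"
        by (rule measure_Icc_ge) (use a x in auto)
      then have "exp (t * (x - 1)) * f x \<le> exp (t * (x - 1)) * measure N {x - 1..x}" by (intro mult_left_mono) auto
      also have "\<dots> = (\<integral>u. exp (t * (x - 1)) * indicator {x - 1..x} u \<partial>N)" by simp
      also have "\<dots> \<le> (\<integral>u. exp (t * u) \<partial>N)"
        by (rule integral_mono') (use integrable_mgf[OF t(1,2)] t in \<open>auto simp: indicator_def\<close>)
      finally have le: "exp (t * (x - 1)) * f x \<le> mgf t" by (simp add: mgf_def)
      have "ln (exp (t * (x - 1)) * f x) \<le> K" unfolding K_def using le f_pos[OF x0] m by (subst ln_le_cancel_iff) auto
      then show ?thesis using f_pos[OF x0] by (simp add: ln_mult)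
    qed
    have e: "t - r_star * c' > 0" using t by simp
    have "\<forall>\<^sub>F x in at_top. (t + K) / (t - r_star * c') < x" by (rule eventually_gt_at_top)
    then show "\<forall>\<^sub>F x in at_top. c < - ln (f x) / (r_star * x)"
      using eventually_ge_at_top[of "a + 1"]
    proof eventually_elim
      case (elim x)
      have x0: "0 < x" using elim a by simp
      have "t + K < x * (t - r_star * c')" using elim e by (simp add: pos_divide_less_eq)
      then have "r_star * c' * x < t * (x - 1) - K" by (simp add: algebra_simps)
      then have "c' * (r_star * x) < - ln (f x)" using bound[of x] elim by (simp add: mult_ac)
      then have "c' < - ln (f x) / (r_star * x)" using x0 r_star_pos by (subst pos_less_divide_eq) auto
      then show ?case using c' by simp
    qed
  }
  {
    fix c :: real assume c: "1 < c"
    \<comment> \<open>Half of the excess c - 1 pays for the length of the interval, the other half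
      for the logarithmic term ln (d * x).\<close>
    define d where "d = (c - 1) / 2"
    have d: "0 < d" "1 + 2 * d = c" using c by (auto simp: d_def field_simps)
    obtain K where K: "K > 0" "\<forall>\<^sub>F y in at_top. K * exp (- (r_star * (1 + d) * y)) \<le> measure N {y<..<(1 + d) * y}"
      using interval_mass_lower[OF d(1)] by blast
    have rd: "0 < r_star * d" using d r_star_pos by simp
    then have "\<forall>\<^sub>F x in at_top. ln (d * x) - ln K < (r_star * d) * x" using d by real_asymp
    then show "\<forall>\<^sub>F x in at_top. - ln (f x) / (r_star * x) < c"
      using K(2) eventually_ge_at_top[of a]
    proof eventually_elim
      case (elim x)
      have x0: "0 < x" using elim a by simp
      have "K * exp (- (r_star * (1 + d) * x)) \<le> measure N {x<..<(1 + d) * x}" by (rule elim)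
      also have "\<dots> \<le> measure N {x..(1 + d) * x}" by (intro N.finite_measure_mono) auto
      also have "\<dots> \<le> f x * ((1 + d) * x - x)"
        by (rule measure_Icc_le) (use a elim x0 d in auto)
      also have "\<dots> = f x * (d * x)" by (simp add: algebra_simps)
      finally have "ln (K * exp (- (r_star * (1 + d) * x))) \<le> ln (f x * (d * x))"
        using K f_pos[OF x0] d x0 by (subst ln_le_cancel_iff) auto
      then have "ln K - r_star * (1 + d) * x \<le> ln (f x) + ln (d * x)"
        using K f_pos[OF x0] d x0 by (simp add: ln_mult)
      then have "- ln (f x) < (r_star * d) * x + r_star * (1 + d) * x" using elim by linarith
      also have "\<dots> = c * (r_star * x)" unfolding d(2)[symmetric] by (simp add: algebra_simps)
      finally show ?case using x0 r_star_pos by (subst pos_divide_less_eq) auto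
    qed
  }
qed

lemma laplace_at_top_small: "0 < e \<Longrightarrow> \<exists>w>0. laplace N w < e"
proof -
  assume e: "0 < e"
  define C where "C = 1 - laplace N 1"
  have "laplace N 1 \<le> exp (- (1 - 1\<^sup>2 / 6))" by (rule N.norm_upper) simp
  also have "\<dots> < 1" by simp
  finally have C: "C > 0" by (simp add: C_def)
  have "((\<lambda>s. exp (- (C * (ln (s / 1))\<^sup>2 / 2))) \<longlongrightarrow> 0) at_top" using C by real_asymp
  then have "\<forall>\<^sub>F s in at_top. exp (- (C * (ln (s / 1))\<^sup>2 / 2)) < e" using e by (rule order_tendstoD(2))
  then have "\<forall>\<^sub>F s in at_top. 1 \<le> s \<and> exp (- (C * (ln (s / 1))\<^sup>2 / 2)) < e" using eventually_ge_at_top by (rule eventually_conj[rotated])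
  then obtain s where s: "1 \<le> s" "exp (- (C * (ln (s / 1))\<^sup>2 / 2)) < e" using eventually_happens by force
  have "laplace N s < e" using laplace_upper_log[of 1 s] s by (simp add: C_def)
  then show ?thesis using s by (intro exI[of _ s]) auto
qed

text \<open>Left of the mode f is nondecreasing. So x * f x is at most the mass of [x, 2x], hence at
  most e^2 times \<open>laplace N (1 / x)\<close>; and it is at least the mass of [0, x], which is
  bounded below because \<open>laplace N s\<close> is at most that mass plus exp (- s x).\<close>

lemma asymp_at_0: "(\<lambda>x. - ln (f x)) \<sim>[at_right 0] (\<lambda>x. (ln x)\<^sup>2 / 2)"
proof (rule asymp_equivI', rule order_tendstoI)
  obtain a where a: "a > 0" "\<And>x y. x \<le> y \<Longrightarrow> y \<le> a \<Longrightarrow> f x \<le> f y" using f_unimodal by blast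
  have near: "\<forall>\<^sub>F x in at_right 0. 0 < x \<and> x < min (a / 2) 1"
    using eventually_at_right_real[of 0 "min (a / 2) 1"] a by (auto elim!: eventually_mono)
  {
    fix c :: real assume c: "c < 1"
    \<comment> \<open>A suitable w makes the coefficient 1 - \<open>laplace N w\<close> of
      \<open>laplace_upper_log\<close> exceed c.\<close>
    obtain w where w: "w > 0" "laplace N w < 1 - c" using laplace_at_top_small[of "1 - c"] c by auto
    define C where "C = 1 - laplace N w"
    have C: "c < C" using w by (simp add: C_def)
    have ev: "\<forall>\<^sub>F x in at_right 0. c * ((ln x)\<^sup>2 / 2) < ln x - 2 + C * (ln (1 / x / w))\<^sup>2 / 2"
    proof -
      have D: "C - c > 0" using C by simp
      have "\<forall>\<^sub>F l in at_bot. 0 < (C - c) * l\<^sup>2 / 2 + (1 + C * ln w) * l + (C * (ln w)\<^sup>2 / 2 - 2)"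
        using D by real_asymp
      from eventually_compose_filterlim[OF this ln_at_0]
      have "\<forall>\<^sub>F x in at_right 0. 0 < (C - c) * (ln x)\<^sup>2 / 2 + (1 + C * ln w) * ln x + (C * (ln w)\<^sup>2 / 2 - 2)" .
      then show ?thesis using near
      proof eventually_elim
        case (elim x)
        have "ln (1 / x / w) = - (ln x + ln w)" using elim w by (simp add: ln_div ln_mult)
        then have "(ln (1 / x / w))\<^sup>2 = (ln x + ln w)\<^sup>2" by (simp only: power2_minus)
        moreover have "ln x - 2 + C * (ln x + ln w)\<^sup>2 / 2 - c * ((ln x)\<^sup>2 / 2)
           = (C - c) * (ln x)\<^sup>2 / 2 + (1 + C * ln w) * ln x + (C * (ln w)\<^sup>2 / 2 - 2)"
          by (simp add: power2_eq_square field_simps)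
        ultimately show ?case using elim by simp
      qed
    qed
    have ev2: "\<forall>\<^sub>F x in at_right 0. x < 1 / w"
      using eventually_at_right_real[of 0 "1 / w"] w by (auto elim!: eventually_mono)
    show "\<forall>\<^sub>F x in at_right 0. c < - ln (f x) / ((ln x)\<^sup>2 / 2)"
      using ev near ev2
    proof eventually_elim
      case (elim x)
      then have x: "0 < x" "x < a / 2" "x < 1" by auto
      have ws: "w \<le> 1 / x" using elim w x by (simp add: field_simps)
      have "f x * (2 * x - x) \<le> measure N {x..2 * x}"
        by (rule measure_Icc_ge) (use a x in auto)
      then have "exp (- 2) * (f x * x) \<le> exp (- 2) * measure N {x..2 * x}" by simp
      also have "\<dots> = (\<integral>u. exp (- 2) * indicator {x..2 * x} u \<partial>N)" by simp
      also have "\<dots> \<le> (\<integral>u. exp (- (1 / x * u)) \<partial>N)"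
      proof (rule integral_mono')
        show "integrable N (\<lambda>u. exp (- (1 / x * u)))" using x by (intro N.integrable_exp_neg) simp
        show "exp (- 2) * indicator {x..2 * x} u \<le> exp (- (1 / x * u))" for u
          using x by (auto simp: indicator_def field_simps)
      qed simp
      also have "\<dots> \<le> exp (- (C * (ln (1 / x / w))\<^sup>2 / 2))"
        using laplace_upper_log[OF w(1) ws] by (simp add: laplace_def C_def)
      finally have "ln (exp (- 2) * (f x * x)) \<le> ln (exp (- (C * (ln (1 / x / w))\<^sup>2 / 2)))"
        using f_pos[OF x(1)] x by (subst ln_le_cancel_iff) auto
      then have "- 2 + ln (f x) + ln x \<le> - (C * (ln (1 / x / w))\<^sup>2 / 2)"
        using f_pos[OF x(1)] x by (simp add: ln_mult)
      then have "c * ((ln x)\<^sup>2 / 2) < - ln (f x)" using elim by linarith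
      moreover have "0 < (ln x)\<^sup>2 / 2" using x by simp
      ultimately show ?case by (subst pos_less_divide_eq)
    qed
  }
  {
    fix c :: real assume c: "1 < c"
    \<comment> \<open>With s x * x = (- ln x)^3 the error exp (- s x * x) is negligible against exp
      (- (ln x)^2 / 2), while ln (s x) is still equivalent to - ln x.\<close>
    define s where "s x = (- ln x) ^ 3 / x" for x :: real
    define A where "A x = (ln (s x))\<^sup>2 / 2 + ln (s x) + 1" for x
    have c1: "\<forall>\<^sub>F x in at_right 0. 1 \<le> s x" unfolding s_def by real_asymp
    have c2: "\<forall>\<^sub>F x in at_right 0. A x + ln 2 \<le> (- ln x) ^ 3" unfolding A_def s_def by real_asymp
    have c3: "\<forall>\<^sub>F x in at_right 0. A x + ln 2 + ln x < c * ((ln x)\<^sup>2 / 2)" using c unfolding A_def s_def by real_asymp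
    show "\<forall>\<^sub>F x in at_right 0. - ln (f x) / ((ln x)\<^sup>2 / 2) < c"
      using c1 c2 c3 near
    proof eventually_elim
      case (elim x)
      then have x: "0 < x" "x < a / 2" "x < 1" by auto
      have "exp (- A x) \<le> laplace N (s x)" unfolding A_def using laplace_lower_log[OF elim(1)] .
      also have "\<dots> \<le> (\<integral>u. indicator {0..x} u + exp (- (s x * x)) \<partial>N)"
        unfolding laplace_def
      proof (rule integral_mono_AE)
        show "integrable N (\<lambda>u. exp (- (s x * u)))" using elim by (intro N.integrable_exp_neg) simp
        show "integrable N (\<lambda>u. indicator {0..x} u + exp (- (s x * x)))"
          by (rule N.integrable_const_bound[of _ "1 + exp (- (s x * x))"]) (auto simp: indicator_def)
        show "AE u in N. exp (- (s x * u)) \<le> indicator {0..x} u + exp (- (s x * x))"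
          using N.AE_nonneg
        proof eventually_elim
          case (elim u)
          show ?case
          proof (cases "u \<le> x")
            case True
            have "exp (- (s x * u)) \<le> 1" using elim \<open>1 \<le> s x\<close> by simp
            moreover have "0 < exp (- (s x * x))" by simp
            ultimately have "exp (- (s x * u)) \<le> 1 + exp (- (s x * x))" by linarith
            then show ?thesis using True elim by simp
          next
            case False
            then show ?thesis using \<open>1 \<le> s x\<close> by (simp add: mult_left_mono)
          qed
        qed
      qed
      also have "\<dots> = measure N {0..x} + exp (- (s x * x))"
        by (subst Bochner_Integration.integral_add) (auto intro!: N.integrable_const_bound[of _ 1])
      also have "measure N {0..x} \<le> f x * (x - 0)"
        by (rule measure_Icc_le) (use a x in auto)
      also have "s x * x = (- ln x) ^ 3" using x by (simp add: s_def)
      finally have "exp (- A x) \<le> f x * x + exp (- ((- ln x) ^ 3))" by simp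
      moreover have "exp (- ((- ln x) ^ 3)) \<le> exp (- A x) / 2"
      proof -
        have "exp (- ((- ln x) ^ 3)) \<le> exp (- A x - ln 2)" using elim(2) by simp
        also have "\<dots> = exp (- A x) / 2" by (simp add: exp_diff)
        finally show ?thesis .
      qed
      ultimately have "exp (- A x) / 2 \<le> f x * x" by linarith
      then have "ln (exp (- A x) / 2) \<le> ln (f x * x)" using f_pos[OF x(1)] x by (subst ln_le_cancel_iff) auto
      then have "- A x - ln 2 \<le> ln (f x) + ln x" using f_pos[OF x(1)] x by (simp add: ln_mult ln_div)
      then have "- ln (f x) < c * ((ln x)\<^sup>2 / 2)" using elim by linarith
      moreover have "0 < (ln x)\<^sup>2 / 2" using x by simp
      ultimately show ?case by (subst pos_divide_less_eq)
    qed
  }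
qed

lemma unimodal_f: "unimodal f"
proof -
  obtain a where "\<And>x y. x \<le> y \<Longrightarrow> y \<le> a \<Longrightarrow> f x \<le> f y" "\<And>x y. a \<le> x \<Longrightarrow> x \<le> y \<Longrightarrow> f y \<le> f x"
    using f_unimodal by blast
  then show ?thesis unfolding unimodal_def by (intro exI[of _ a]) auto
qed

end

theorem theorem1p2:
  fixes M :: "'a measure" and xi :: "nat list \<Rightarrow> nat \<Rightarrow> 'a \<Rightarrow> real \<times> real"
    and W :: "'a \<Rightarrow> real"
  assumes "prob_space M"
    and "brw_offspring M xi"
    and "W \<in> borel_measurable M"
    and "AE \<omega> in M. (\<lambda>n. brw_W xi n \<omega>) \<longlonglongrightarrow> W \<omega>"
  shows "self_decomposable (distr M borel W) \<and>
         (\<exists>f. f \<in> borel_measurable borel \<and> (\<forall>x. 0 \<le> f x) \<and>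
              distr M borel W = density lborel (\<lambda>x. ennreal (f x)) \<and>
              unimodal f \<and>
              ((\<lambda>x. - ln (f x)) \<sim>[at_top] (\<lambda>x. r_star * x)) \<and>
              ((\<lambda>x. - ln (f x)) \<sim>[at_right 0] (\<lambda>x. (ln x)\<^sup>2 / 2)))"
proof -
  interpret B: brw_limit M xi W
    using assms by (simp add: brw_limit_def brw_limit_axioms_def brw_def brw_axioms_def)
  \<comment> \<open>The offspring process of the root serves as the Poisson process from which the
    infinitely divisible factors are built.\<close>
  interpret F: fixed_point_ppp "distr M borel W" M "xi []"
    using B.fixed_point_mu assms(1) B.ppp[of "[]"]
    by (simp add: fixed_point_ppp_def fixed_point_ppp_axioms_def B.mu_def)
  obtain b nu where "0 < b" "nonneg_distribution nu"
    "distr M borel W = distr (density lborel (\<lambda>x. ennreal (erlang_density 3 b x)) \<Otimes>\<^sub>M nu) borel (\<lambda>(x, y). 1 * x + y)"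
    using F.erlang_factor by blast
  then interpret D: erlang_factored "distr M borel W" b nu
    by (intro erlang_factored.intro erlang_factored_axioms.intro F.fixed_point_axioms)
  show ?thesis
    using F.self_decomposable_N D.measurable_f D.f_nonneg D.N_density D.unimodal_f D.asymp_at_top D.asymp_at_0 by blast
qed

end
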